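(* Let $\nu$ be any real number and $\varepsilon$ any non-zero real number. Then for any real $t>0$ the density $\alpha_t^{(\nu,\varepsilon)}$ of the random variable $\bigl(A_t^{(\nu)}\bigr)^{\varepsilon}$ is given, for every $w>0$ and for any choice of real parameters $\theta\in[\frac{\pi}{2},\pi]$ and $R\ge 1$, by the iterated integral $$\alpha_t^{(\nu,\varepsilon)}(w)=c_{\nu,\varepsilon,t}(w)\int_0^\infty x^{\nu}e^{-x^2}\,\frac{1}{2\pi i}\int_{\log C_{\theta,R}} e^{-\frac{\xi^2}{2t}}\sinh(\xi)\exp\left(\frac{2x\cosh(\xi)}{\sqrt{2w^{1/\varepsilon}}}\right)d\xi\,dx .$$
   Context: $B=(B_t)_{t\ge0}$ is a standard one-dimensional Brownian motion with $B_0=0$. For real $\nu$ and $t>0$, $$A_t^{(\nu)}=\int_0^t e^{2(\nu x+B_x)}\,dx .$$ For real $\varepsilon\neq0$, $\alpha_t^{(\nu,\varepsilon)}$ denotes the density with respect to Lebesgue measure on $(0,\infty)$ of $\bigl(A_t^{(\nu)}\bigr)^{\varepsilon}$ (continuous version). For $w>0$, $$c_{\nu,\varepsilon,t}(w)=|\varepsilon|^{-1}\frac{2^{\nu/2}}{\sqrt{\pi t}}\exp\left(-\tfrac12\bigl(\nu^2t+w^{-1/\varepsilon}\bigr)\right)w^{\frac{1}{2\varepsilon}(\nu-1)-1}.$$ For $\theta\in[\frac\pi2,\pi]$ and $R\ge1$, $\log C_{\theta,R}$ is the image under the logarithm of the Hankel contour $C_{\theta,R}$ (incoming from infinity along the ray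 of argument $-\theta$ to modulus $R$, counterclockwise along the circle of radius $R$ to argument $\theta$, outgoing to infinity along the ray of argument $\theta$). Explicitly, it is the contour running along the horizontal half-line from $+\infty-i\theta$ to $\log R-i\theta$, then along the vertical segment to $\log R+i\theta$, then along the horizontal half-line to $+\infty+i\theta$. *)

theory Defs
  imports "HOL-Probability.Probability" "HOL-Complex_Analysis.Complex_Analysis"
begin

text \<open>
  A standard one-dimensional Brownian motion on a probability space, started at \<open>0\<close>.
  Time is a real parameter and only the values at times \<open>\<ge> 0\<close> matter. All paths (not merely
  almost all) are continuous, so that path functionals are measurable without completing \<open>M\<close>.
\<close>

definition standard_brownian_motion :: "'a measure \<Rightarrow> (real \<Rightarrow> 'a \<Rightarrow> real) \<Rightarrow> bool" where
  "standard_brownian_motion M B \<longleftrightarrow>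
     prob_space M \<and>
     (\<forall>t\<ge>0. B t \<in> borel_measurable M) \<and>
     (AE \<omega> in M. B 0 \<omega> = 0) \<and>
     (\<forall>\<omega>\<in>space M. continuous_on {0..} (\<lambda>t. B t \<omega>)) \<and>
     (\<forall>s t. 0 \<le> s \<and> s < t \<longrightarrow>
        distributed M lborel (\<lambda>\<omega>. B t \<omega> - B s \<omega>)
          (\<lambda>x. ennreal (normal_density 0 (sqrt (t - s)) x))) \<and>
     (\<forall>n (\<tau> :: nat \<Rightarrow> real). 0 \<le> \<tau> 0 \<and> (\<forall>i<n. \<tau> i < \<tau> (Suc i)) \<longrightarrow>
        prob_space.indep_vars M (\<lambda>_. borel) (\<lambda>i \<omega>. B (\<tau> (Suc i)) \<omega> - B (\<tau> i) \<omega>) {..<n})"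

definition exp_functional :: "real \<Rightarrow> (real \<Rightarrow> 'a \<Rightarrow> real) \<Rightarrow> real \<Rightarrow> 'a \<Rightarrow> real" where
  "exp_functional \<nu> B t \<omega> = (LBINT x:{0..t}. exp (2 * (\<nu> * x + B x \<omega>)))"

text \<open>
  Nonnegativity is required separately since \<open>ennreal\<close> maps negative reals to \<open>0\<close>. The values of
  \<open>\<alpha>\<close> on \<open>(0, \<infinity>)\<close> are uniquely determined by this predicate; those outside are irrelevant.
\<close>

definition continuous_density_pos :: "'a measure \<Rightarrow> ('a \<Rightarrow> real) \<Rightarrow> (real \<Rightarrow> real) \<Rightarrow> bool" where
  "continuous_density_pos M X \<alpha> \<longleftrightarrow>
     continuous_on {0<..} \<alpha> \<and> (\<forall>w>0. 0 \<le> \<alpha> w) \<and>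
     distributed M lborel X (\<lambda>w. ennreal (indicator {0<..} w * \<alpha> w))"

definition prefactor :: "real \<Rightarrow> real \<Rightarrow> real \<Rightarrow> real \<Rightarrow> real" where
  "prefactor \<nu> \<epsilon> t w =
     1 / \<bar>\<epsilon>\<bar> * (2 powr (\<nu> / 2) / sqrt (pi * t)) *
     exp (- (1/2) * (\<nu>\<^sup>2 * t + w powr (- 1 / \<epsilon>))) * w powr (1 / (2 * \<epsilon>) * (\<nu> - 1) - 1)"

text \<open>
  The logarithm of the Hankel contour: the half-line from \<open>+\<infinity> - i\<theta>\<close> to \<open>log R - i\<theta>\<close> (traversed
  leftwards, hence the minus sign), the segment up to \<open>log R + i\<theta>\<close>, and the half-line to
  \<open>+\<infinity> + i\<theta>\<close>. The integrals over the half-lines are Lebesgue integrals.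
\<close>

definition log_hankel_integrable :: "real \<Rightarrow> real \<Rightarrow> (complex \<Rightarrow> complex) \<Rightarrow> bool" where
  "log_hankel_integrable \<theta> R f \<longleftrightarrow>
     set_integrable lborel {ln R..} (\<lambda>s. f (Complex s (- \<theta>))) \<and>
     f contour_integrable_on linepath (Complex (ln R) (- \<theta>)) (Complex (ln R) \<theta>) \<and>
     set_integrable lborel {ln R..} (\<lambda>s. f (Complex s \<theta>))"

definition log_hankel_integral :: "real \<Rightarrow> real \<Rightarrow> (complex \<Rightarrow> complex) \<Rightarrow> complex" where
  "log_hankel_integral \<theta> R f =
     - (LBINT s:{ln R..}. f (Complex s (- \<theta>)))
     + contour_integral (linepath (Complex (ln R) (- \<theta>)) (Complex (ln R) \<theta>)) f
     + (LBINT s:{ln R..}. f (Complex s \<theta>))"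

definition inner_integrand :: "real \<Rightarrow> real \<Rightarrow> real \<Rightarrow> real \<Rightarrow> complex \<Rightarrow> complex" where
  "inner_integrand \<epsilon> t w x \<xi> =
     exp (- (\<xi>\<^sup>2 / (2 * of_real t))) * sinh \<xi> *
     exp (2 * of_real x * cosh \<xi> / of_real (sqrt (2 * w powr (1 / \<epsilon>))))"

definition outer_integrand ::
    "real \<Rightarrow> real \<Rightarrow> real \<Rightarrow> real \<Rightarrow> real \<Rightarrow> real \<Rightarrow> real \<Rightarrow> complex" where
  "outer_integrand \<nu> \<epsilon> t w \<theta> R x =
     of_real (x powr \<nu> * exp (- x\<^sup>2)) *
     (1 / (2 * of_real pi * \<i>) * log_hankel_integral \<theta> R (inner_integrand \<epsilon> t w x))"

end

theory Submission
  imports Defs "HOL-Real_Asymp.Real_Asymp"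
begin

text \<open>
  Put \<open>\<rho> = exp (\<nu> * t + B t)\<close>, let \<open>A\<close> be the exponential functional at time \<open>t\<close>, and remove the drift by
  the weight \<open>D = exp (- \<nu> * B t - \<nu>\<^sup>2 * t / 2)\<close>. The function \<open>V x \<eta> = exp (- a * exp x * cosh \<eta>)\<close>
  satisfies \<open>V\<^sub>x\<^sub>x - a\<^sup>2 * exp (2 * x) * V = V\<^sub>\<eta>\<^sub>\<eta>\<close>, so the Feynman--Kac semigroup in \<open>x\<close> acts on it as the free
  heat semigroup in \<open>\<eta>\<close>. Hence
  \<open>E [D * exp (- a * cosh \<eta> * \<rho> - a\<^sup>2 / 2 * A)] = E [exp (- a * cosh (\<eta> + B t))]\<close>
  for \<open>a > 0\<close> and real \<open>\<eta>\<close>; the bounds being uniform, a Trotter product argument along Riemann sums of \<open>A\<close>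
  proves this without stochastic calculus.

  The candidate joint density of \<open>(\<rho> / A, ln A)\<close> has the same transform: after Fubini this is the
  integral of \<open>exp (- s\<^sup>2 / (2 * t)) * sin (pi * s / t) * sinh s / (cosh s + cosh \<delta>)\<close>, evaluated by shifting the line of
  integration. The transform contains all moments of a pair of bounded variables, so it determines the
  law, and integrating out the first variable against \<open>\<rho> powr \<nu>\<close> gives the law of \<open>ln A\<close> under the
  original measure. Its nonnegativity yields the integrability of the outer integral for every real \<open>\<nu>\<close>.
\<close>

subsection \<open>One Gaussian step\<close>

text \<open>Write \<open>K = a * exp x * cosh \<eta>\<close> and
  \<open>S = a * exp x * sinh \<eta>\<close>. For \<open>V = exp (- K)\<close> the second
  derivatives in x and in \<eta> are \<open>K\<^sup>2 - K\<close> and \<open>S\<^sup>2 - K\<close>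
  times V, and \<open>K\<^sup>2 - S\<^sup>2\<close> is the potential. Since polynomials in K are
  bounded against \<open>exp (- K)\<close>, the unbounded potential does no harm to the error
  bounds. Varying \<eta> moves the coefficient \<open>a * cosh \<eta>\<close> of \<rho> through all
  values from \<open>a\<close> upwards, which is enough freedom for the moments of two suitably
  chosen bounded variables. The second obstacle is the outer integral: \<open>Theta\<close> is an
  oscillating integral without a visible sign, and for \<nu> \<le> -1 the power of x is not
  integrable at 0, where a bound on \<open>Theta\<close> by a constant is of no use. So uniqueness
  is proved for signed weights, the sign is read off from the law of an actual pair, and
  integrability comes from total mass 1. Probabilistically, the outer variable x is
  \<open>\<rho> / sqrt (2 * A)\<close>: the Gaussian factor and the powers of w in the prefactor
  come from this scaling of \<open>\<rho> / A\<close>.\<close>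

lemma cosh_borel_measurable[measurable]: "(cosh :: real \<Rightarrow> real) \<in> borel_measurable borel"
  by (intro borel_measurable_continuous_onI continuous_intros)

lemma sinh_borel_measurable[measurable]: "(sinh :: real \<Rightarrow> real) \<in> borel_measurable borel"
  by (intro borel_measurable_continuous_onI continuous_intros)

text \<open>The parameter is the variance, that is, the length of a time step.\<close>

definition gauss :: "real \<Rightarrow> real measure" where
  "gauss h = density lborel (\<lambda>x. ennreal (normal_density 0 (sqrt h) x))"

lemma sets_gauss[simp, measurable_cong]: "sets (gauss h) = sets borel"
  by (simp add: gauss_def)

lemma space_gauss[simp]: "space (gauss h) = UNIV"
  by (simp add: gauss_def)

lemma prob_space_gauss: "h > 0 \<Longrightarrow> prob_space (gauss h)"
  unfolding gauss_def by (rule prob_space_normal_density) simp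

lemma integral_gauss:
  fixes f :: "real \<Rightarrow> 'b::{banach, second_countable_topology}"
  assumes "f \<in> borel_measurable borel"
  shows "integral\<^sup>L (gauss h) f = (LBINT z. normal_density 0 (sqrt h) z *\<^sub>R f z)"
  unfolding gauss_def using assms by (subst integral_density) auto

lemma integrable_gauss_bounded:
  fixes f :: "real \<Rightarrow> real"
  assumes "h > 0" "f \<in> borel_measurable borel" "\<And>z. \<bar>f z\<bar> \<le> C"
  shows "integrable (gauss h) f"
proof -
  interpret prob_space "gauss h" by (rule prob_space_gauss) fact
  show ?thesis using assms by (intro integrable_const_bound[where B=C]) auto
qed

lemma gauss_power:
  assumes "h > 0"
  shows "integrable (gauss h) (\<lambda>z. z ^ k)"
    and "integral\<^sup>L (gauss h) (\<lambda>z. z) = 0"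
    and "integral\<^sup>L (gauss h) (\<lambda>z. z ^ 2) = h"
    and "integral\<^sup>L (gauss h) (\<lambda>z. z ^ 4) = 3 * h\<^sup>2"
proof -
  show "integrable (gauss h) (\<lambda>z. z ^ k)"
    unfolding gauss_def using assms integrable_normal_moment[of "sqrt h" 0 k]
    by (subst integrable_density) auto
  show "integral\<^sup>L (gauss h) (\<lambda>z. z) = 0"
    using assms normal_moment_odd[of "sqrt h" 0 0]
    by (simp add: integral_gauss has_bochner_integral_iff)
  show "integral\<^sup>L (gauss h) (\<lambda>z. z ^ 2) = h"
    using assms normal_moment_even[of "sqrt h" 0 1]
    by (simp add: integral_gauss has_bochner_integral_iff)
  show "integral\<^sup>L (gauss h) (\<lambda>z. z ^ 4) = 3 * h\<^sup>2"
    using assms normal_moment_even[of "sqrt h" 0 2]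
    by (simp add: integral_gauss has_bochner_integral_iff fact_numeral power_divide power2_eq_square)
qed

text \<open>This is \<open>z\<^sup>2 * (\<bar>z\<bar> - s)\<^sup>2 \<ge> 0\<close> divided by
  \<open>s\<close>. It trades the third absolute moment for even ones; with
  \<open>s = sqrt h\<close> both terms have Gaussian mean of order
  \<open>h * sqrt h\<close>.\<close>

lemma abs_cube_le:
  fixes z s :: real
  assumes "s > 0"
  shows "\<bar>z\<bar> ^ 3 \<le> (s * z\<^sup>2 + z ^ 4 / s) / 2"
proof -
  have "0 \<le> z\<^sup>2 * (\<bar>z\<bar> - s)\<^sup>2 / s" using assms by simp
  also have "\<dots> = s * z\<^sup>2 + z ^ 4 / s - 2 * \<bar>z\<bar> ^ 3"
  proof -
    have a: "z\<^sup>2 = \<bar>z\<bar>\<^sup>2" "z ^ 4 = \<bar>z\<bar> ^ 4" by (simp_all add: power_abs[symmetric])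
    show ?thesis unfolding a using assms
      by (simp add: field_simps power2_eq_square power3_eq_cube power4_eq_xxxx)
  qed
  finally show ?thesis by simp
qed

text \<open>In the second-order Taylor expansion the linear term has mean 0 and the quadratic one
  gives the generator. The cubic remainder contributes \<open>L / 6 * (1 + 3) / 2 = L / 3\<close>
  times \<open>h * sqrt h\<close>, by the second and fourth moments.\<close>

lemma gauss_taylor:
  fixes f f1 f2 f3 :: "real \<Rightarrow> real"
  assumes h: "h > 0"
    and d: "\<And>z. (f has_real_derivative f1 z) (at z)" "\<And>z. (f1 has_real_derivative f2 z) (at z)"
      "\<And>z. (f2 has_real_derivative f3 z) (at z)"
    and f3: "\<And>z. \<bar>f3 z\<bar> \<le> L" and bd: "\<And>z. \<bar>f z\<bar> \<le> C"
  shows "\<bar>integral\<^sup>L (gauss h) f - f 0 - h / 2 * f2 0\<bar> \<le> L / 3 * (h * sqrt h)"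
proof -
  interpret prob_space "gauss h" by (rule prob_space_gauss) fact
  define r where "r z = f z - (f 0 + f1 0 * z + f2 0 / 2 * z\<^sup>2)" for z
  have r: "\<bar>r z\<bar> \<le> L / 6 * \<bar>z\<bar> ^ 3" for z
  proof -
    define dd where "dd m = (if m = (0::nat) then f else if m = 1 then f1 else if m = 2 then f2 else f3)" for m
    have "\<exists>s. \<bar>s\<bar> \<le> \<bar>z\<bar> \<and> f z = (\<Sum>m<3. dd m 0 / fact m * z ^ m) + dd 3 s / fact 3 * z ^ 3"
      by (rule Maclaurin_bi_le) (auto simp: dd_def d numeral_3_eq_3 less_Suc_eq)
    then obtain s where "f z = (\<Sum>m<3. dd m 0 / fact m * z ^ m) + f3 s / 6 * z ^ 3"
      by (auto simp: dd_def fact_numeral)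
    then have "r z = f3 s / 6 * z ^ 3"
      by (simp add: r_def dd_def numeral_3_eq_3 fact_numeral power2_eq_square)
    then have "\<bar>r z\<bar> = \<bar>f3 s\<bar> / 6 * \<bar>z\<bar> ^ 3" by (simp only: abs_mult power_abs abs_divide abs_numeral)
    then show ?thesis using f3[of s] by (simp add: mult_right_mono)
  qed
  have L0: "L \<ge> 0" using f3[of 0] by linarith
  have r2: "\<bar>r z\<bar> \<le> L / 12 * (sqrt h * z\<^sup>2 + z ^ 4 / sqrt h)" for z
  proof -
    have "L / 6 * \<bar>z\<bar> ^ 3 \<le> L / 6 * ((sqrt h * z\<^sup>2 + z ^ 4 / sqrt h) / 2)"
      using abs_cube_le[of "sqrt h" z] h L0 by (intro mult_left_mono) auto
    then show ?thesis using r[of z] by simp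
  qed
  have fm: "f \<in> borel_measurable borel"
    by (intro borel_measurable_continuous_onI DERIV_continuous_on) (auto intro: d)
  have fi: "integrable (gauss h) f" using h fm bd by (rule integrable_gauss_bounded)
  note I = gauss_power(1)[OF h] gauss_power(1)[OF h, of 1, simplified]
  have "integral\<^sup>L (gauss h) r = integral\<^sup>L (gauss h) f - (f 0 + f2 0 / 2 * h)"
    unfolding r_def using fi I by (simp add: gauss_power(2-)[OF h] prob_space[simplified])
  then have "\<bar>integral\<^sup>L (gauss h) f - f 0 - h / 2 * f2 0\<bar> = \<bar>integral\<^sup>L (gauss h) r\<bar>"
    by (simp add: mult.commute diff_diff_add)
  also have "\<dots> \<le> integral\<^sup>L (gauss h) (\<lambda>z. \<bar>r z\<bar>)" by (rule integral_abs_bound)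
  also have "\<dots> \<le> integral\<^sup>L (gauss h) (\<lambda>z. L / 12 * (sqrt h * z\<^sup>2 + z ^ 4 / sqrt h))"
    using fi I r2 by (intro integral_mono) (auto simp: r_def)
  also have "\<dots> = L / 12 * (sqrt h * h + 3 * h\<^sup>2 / sqrt h)"
    using I by (simp add: gauss_power(2-)[OF h])
  also have "\<dots> = L / 12 * (sqrt h * h + 3 * (h * sqrt h))"
  proof -
    have "h\<^sup>2 / sqrt h = h * sqrt h" using h by (simp add: field_simps power2_eq_square)
    then have "3 * h\<^sup>2 / sqrt h = 3 * (h * sqrt h)" unfolding times_divide_eq_right[symmetric] by simp
    then show ?thesis by simp
  qed
  also have "\<dots> = L / 3 * (h * sqrt h)" by (simp add: algebra_simps)
  finally show ?thesis .
qed

text \<open>A single term of the exponential series. It bounds polynomials in \<open>K\<close>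
  against \<open>exp (- K)\<close> uniformly in \<open>K\<close>, which makes the one-step error
  independent of the starting point.\<close>

lemma power_le_fact_exp:
  fixes K :: real assumes "K \<ge> 0" shows "K ^ n * exp (- K) \<le> fact n"
proof -
  have "(\<Sum>i\<in>{n}. K ^ i / fact i) \<le> (\<Sum>i. K ^ i / fact i)"
    using assms summable_exp_generic[of K] by (intro sum_le_suminf) (auto simp: divide_inverse mult.commute)
  also have "\<dots> = exp K" by (simp add: exp_def divide_inverse mult.commute)
  finally have "K ^ n \<le> fact n * exp K" by (simp add: field_simps)
  then show ?thesis by (simp add: exp_minus field_simps)
qed

text \<open>If \<open>S\<close> is the derivative of \<open>K\<close> and \<open>K\<close> that of
  \<open>S\<close>, this expression is the third derivative of \<open>exp (- K)\<close>. The
  constant is \<open>fact 3 + 3 * fact 2 + fact 1\<close>.\<close>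

lemma cubic_exp_bound:
  fixes K S :: real
  assumes "\<bar>S\<bar> \<le> K"
  shows "\<bar>(- (S ^ 3) + 3 * S * K - S) * exp (- K)\<bar> \<le> 13"
proof -
  have K: "K \<ge> 0" using assms by linarith
  have "\<bar>- (S ^ 3) + 3 * S * K - S\<bar> \<le> \<bar>S\<bar> ^ 3 + 3 * \<bar>S\<bar> * K + \<bar>S\<bar>"
  proof -
    have "\<bar>- (S ^ 3) + 3 * S * K - S\<bar> \<le> \<bar>S ^ 3\<bar> + \<bar>3 * S * K\<bar> + \<bar>S\<bar>" by linarith
    also have "\<dots> = \<bar>S\<bar> ^ 3 + 3 * \<bar>S\<bar> * K + \<bar>S\<bar>" using K by (simp add: abs_mult power_abs)
    finally show ?thesis .
  qed
  also have "\<dots> \<le> K ^ 3 + 3 * K * K + K"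
    using assms K by (intro add_mono power_mono mult_mono) auto
  finally have "\<bar>(- (S ^ 3) + 3 * S * K - S) * exp (- K)\<bar> \<le> (K ^ 3 + 3 * K * K + K) * exp (- K)"
    by (simp add: abs_mult mult_right_mono)
  also have "\<dots> = K ^ 3 * exp (- K) + 3 * (K ^ 2 * exp (- K)) + K ^ 1 * exp (- K)"
    by (simp add: algebra_simps power2_eq_square)
  also have "\<dots> \<le> fact 3 + 3 * fact 2 + fact 1"
    using K by (intro add_mono mult_left_mono power_le_fact_exp) auto
  finally show ?thesis by (simp add: fact_numeral)
qed

lemma abs_sinh_le_cosh: "\<bar>sinh (x::real)\<bar> \<le> cosh x"
  using cosh_square_eq[of x] by (metis abs_le_square_iff abs_of_nonneg cosh_real_nonneg less_eq_real_def less_add_one)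

text \<open>
  Both \<open>K z = c * cosh (\<eta> + z)\<close> and \<open>K z = d * exp z\<close> satisfy \<open>K'' = K\<close> and \<open>\<bar>K'\<bar> \<le> K\<close>.
\<close>

lemma gauss_exp_hyperbolic:
  fixes K S :: "real \<Rightarrow> real"
  assumes h: "h > 0" and dK: "\<And>z. (K has_real_derivative S z) (at z)" and dS: "\<And>z. (S has_real_derivative K z) (at z)"
    and SK: "\<And>z. \<bar>S z\<bar> \<le> K z"
  shows "\<bar>integral\<^sup>L (gauss h) (\<lambda>z. exp (- K z)) - exp (- K 0) - h / 2 * (((S 0)\<^sup>2 - K 0) * exp (- K 0))\<bar>
         \<le> 13 / 3 * (h * sqrt h)"
proof (rule gauss_taylor[OF h, where ?f1.0 = "\<lambda>z. - S z * exp (- K z)" and ?f2.0 = "\<lambda>z. ((S z)\<^sup>2 - K z) * exp (- K z)"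
      and ?f3.0 = "\<lambda>z. (- (S z ^ 3) + 3 * S z * K z - S z) * exp (- K z)" and C = 1])
  fix z
  show "((\<lambda>z. exp (- K z)) has_real_derivative - S z * exp (- K z)) (at z)"
    by (auto intro!: derivative_eq_intros dK)
  show "((\<lambda>z. - S z * exp (- K z)) has_real_derivative ((S z)\<^sup>2 - K z) * exp (- K z)) (at z)"
    by (auto intro!: derivative_eq_intros dK dS simp: algebra_simps power2_eq_square)
  show "((\<lambda>z. ((S z)\<^sup>2 - K z) * exp (- K z)) has_real_derivative (- (S z ^ 3) + 3 * S z * K z - S z) * exp (- K z)) (at z)"
    by (auto intro!: derivative_eq_intros dK dS simp: algebra_simps power2_eq_square power3_eq_cube)
  show "\<bar>(- (S z ^ 3) + 3 * S z * K z - S z) * exp (- K z)\<bar> \<le> 13" by (rule cubic_exp_bound[OF SK])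
  show "\<bar>exp (- K z)\<bar> \<le> 1" using SK[of z] by simp
qed

text \<open>Compared are a free step in \<eta> and a killed step in x of the same function. To first
  order in \<open>h\<close> the Taylor expansions differ by the term with
  \<open>K\<^sup>2 - S\<^sup>2 = c\<^sup>2\<close>, which the factor
  \<open>exp (- (h / 2 * c\<^sup>2))\<close> removes. Here \<open>26 / 3\<close> is twice the Taylor
  error \<open>13 / 3\<close>, and \<open>11 = 3 + 8\<close> collects the terms of order
  \<open>h\<^sup>2\<close>.\<close>

lemma one_step_error:
  fixes c \<eta> h :: real
  assumes h: "h > 0" and c: "c > 0"
  shows "\<bar>integral\<^sup>L (gauss h) (\<lambda>z. exp (- c * cosh (\<eta> + z)))
           - exp (- (h / 2 * c\<^sup>2)) * integral\<^sup>L (gauss h) (\<lambda>z. exp (- (c * cosh \<eta>) * exp z))\<bar>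
         \<le> 26 / 3 * (h * sqrt h) + 11 * h\<^sup>2"
proof -
  define K where "K = c * cosh \<eta>"
  define S where "S = c * sinh \<eta>"
  define m where "m = exp (- (h / 2 * c\<^sup>2))"
  define A where "A = integral\<^sup>L (gauss h) (\<lambda>z. exp (- c * cosh (\<eta> + z)))"
  define B where "B = integral\<^sup>L (gauss h) (\<lambda>z. exp (- K * exp z))"
  have cK: "c \<le> K" "K > 0" using c cosh_real_ge_1[of \<eta>] by (auto simp: K_def)
  have KS: "K\<^sup>2 - S\<^sup>2 = c\<^sup>2"
    using cosh_square_eq[of \<eta>] by (simp add: K_def S_def power_mult_distrib algebra_simps)
  have 1: "\<bar>A - exp (- K) - h / 2 * ((S\<^sup>2 - K) * exp (- K))\<bar> \<le> 13 / 3 * (h * sqrt h)"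
  proof -
    have "\<bar>c * sinh (\<eta> + z)\<bar> \<le> c * cosh (\<eta> + z)" for z
      using c abs_sinh_le_cosh[of "\<eta> + z"] by (simp add: abs_mult)
    moreover have "((\<lambda>z. c * cosh (\<eta> + z)) has_real_derivative c * sinh (\<eta> + z)) (at z)"
      "((\<lambda>z. c * sinh (\<eta> + z)) has_real_derivative c * cosh (\<eta> + z)) (at z)" for z
      by (auto intro!: derivative_eq_intros)
    ultimately show ?thesis
      using gauss_exp_hyperbolic[OF h, of "\<lambda>z. c * cosh (\<eta> + z)" "\<lambda>z. c * sinh (\<eta> + z)"]
      by (simp add: A_def K_def S_def)
  qed
  have 2: "\<bar>B - exp (- K) - h / 2 * ((K\<^sup>2 - K) * exp (- K))\<bar> \<le> 13 / 3 * (h * sqrt h)"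
  proof -
    have "((\<lambda>z. K * exp z) has_real_derivative K * exp z) (at z)" for z
      by (auto intro!: derivative_eq_intros)
    then show ?thesis
      using gauss_exp_hyperbolic[OF h, of "\<lambda>z. K * exp z" "\<lambda>z. K * exp z"] cK by (simp add: B_def)
  qed
  define y where "y = h / 2 * c\<^sup>2"
  have y0: "y \<ge> 0" using h by (simp add: y_def)
  have my: "m = exp (- y)" by (simp add: m_def y_def)
  have m1: "0 \<le> m" "m \<le> 1" "1 - m \<le> y" "1 - y \<le> m"
    using y0 exp_ge_add_one_self[of "-y"] by (auto simp: my)
  have m2: "m \<le> 1 - y + y\<^sup>2 / 2"
  proof -
    have "\<exists>s. \<bar>s\<bar> \<le> \<bar>-y\<bar> \<and> exp (-y) = (\<Sum>i<3. (-y) ^ i / fact i) + exp s / fact 3 * (-y) ^ 3"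
      by (rule Maclaurin_exp_le)
    then obtain s where "exp (-y) = 1 - y + y\<^sup>2 / 2 - exp s / 6 * y ^ 3"
      by (auto simp: numeral_3_eq_3 fact_numeral power2_eq_square)
    moreover have "exp s / 6 * y ^ 3 \<ge> 0" using y0 by simp
    ultimately show ?thesis by (simp add: my)
  qed
  have mB: "\<bar>m * B - m * (exp (- K) + h / 2 * ((K\<^sup>2 - K) * exp (- K)))\<bar> \<le> 13 / 3 * (h * sqrt h)"
  proof -
    have "\<bar>m * B - m * (exp (- K) + h / 2 * ((K\<^sup>2 - K) * exp (- K)))\<bar>
        = m * \<bar>B - exp (- K) - h / 2 * ((K\<^sup>2 - K) * exp (- K))\<bar>"
    proof -
      have "m * B - m * (exp (- K) + h / 2 * ((K\<^sup>2 - K) * exp (- K)))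
          = m * (B - exp (- K) - h / 2 * ((K\<^sup>2 - K) * exp (- K)))" by (simp add: algebra_simps)
      then show ?thesis by (metis abs_mult abs_of_nonneg m1(1))
    qed
    also have "\<dots> \<le> 1 * (13 / 3 * (h * sqrt h))" using m1 2 by (intro mult_mono) auto
    finally show ?thesis by simp
  qed
  have p: "K * exp (- K) \<le> 1" "K\<^sup>2 * exp (- K) \<le> 2" "K ^ 3 * exp (-K) \<le> 6" "K ^ 4 * exp (- K) \<le> 24"
    using power_le_fact_exp[of K 1] power_le_fact_exp[of K 2] power_le_fact_exp[of K 3] power_le_fact_exp[of K 4] cK
    by (auto simp: fact_numeral)
  \<comment> \<open>Powers of the unbounded \<open>c\<close> are replaced by powers of
    \<open>K\<close>, which \<open>exp (- K)\<close> absorbs.\<close>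
  have c2: "c\<^sup>2 \<le> K\<^sup>2" using cK c by (intro power_mono) auto
  have c4: "(c\<^sup>2)\<^sup>2 \<le> (K\<^sup>2)\<^sup>2" using c2 by (rule power_mono) simp
  have e1: "\<bar>m - 1 + y\<bar> * exp (- K) \<le> 3 * h\<^sup>2"
  proof -
    have "\<bar>m - 1 + y\<bar> * exp (- K) \<le> y\<^sup>2 / 2 * exp (- K)" using m1 m2 by (intro mult_right_mono) auto
    also have "\<dots> = h\<^sup>2 / 8 * ((c\<^sup>2)\<^sup>2 * exp (- K))" by (simp add: y_def power_mult_distrib power_divide)
    also have "\<dots> \<le> h\<^sup>2 / 8 * ((K\<^sup>2)\<^sup>2 * exp (- K))" using c4 by (intro mult_left_mono mult_right_mono) auto
    also have "\<dots> \<le> h\<^sup>2 / 8 * 24" using p(4) by (intro mult_left_mono) auto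
    finally show ?thesis by simp
  qed
  have e2: "\<bar>(m - 1) * (h / 2 * ((K\<^sup>2 - K) * exp (- K)))\<bar> \<le> 8 * h\<^sup>2"
  proof -
    have "\<bar>(m - 1) * (h / 2 * ((K\<^sup>2 - K) * exp (- K)))\<bar> = (1 - m) * (h / 2 * (\<bar>K\<^sup>2 - K\<bar> * exp (- K)))"
      using m1 h by (simp add: abs_mult)
    also have "\<dots> \<le> (h / 2 * K\<^sup>2) * (h / 2 * ((K\<^sup>2 + K) * exp (- K)))"
    proof (rule mult_mono)
      have "y \<le> h / 2 * K\<^sup>2" unfolding y_def using c2 h by (intro mult_left_mono) auto
      then show "1 - m \<le> h / 2 * K\<^sup>2" using m1 by linarith
      have "\<bar>K\<^sup>2 - K\<bar> \<le> K\<^sup>2 + K" using cK by (simp add: abs_le_iff)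
      then show "h / 2 * (\<bar>K\<^sup>2 - K\<bar> * exp (- K)) \<le> h / 2 * ((K\<^sup>2 + K) * exp (- K))"
        using h by (intro mult_left_mono mult_right_mono) auto
    qed (use h in auto)
    also have "\<dots> = h\<^sup>2 / 4 * (K ^ 4 * exp (- K) + K ^ 3 * exp (- K))"
      by (simp add: algebra_simps power2_eq_square power3_eq_cube power4_eq_xxxx)
    also have "\<dots> \<le> h\<^sup>2 / 4 * (24 + 6)" using p by (intro mult_left_mono) auto
    also have "\<dots> \<le> 8 * h\<^sup>2" by simp
    finally show ?thesis .
  qed
  \<comment> \<open>Exact algebra: \<open>h / 2 * (K\<^sup>2 - S\<^sup>2) = y\<close> is the
    first-order term of \<open>1 - m\<close>, so only second-order terms are left.\<close>
  have id: "m * (exp (- K) + h / 2 * ((K\<^sup>2 - K) * exp (- K)))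
      - (exp (- K) + h / 2 * ((S\<^sup>2 - K) * exp (- K)))
      = (m - 1 + y) * exp (- K) + (m - 1) * (h / 2 * ((K\<^sup>2 - K) * exp (- K)))"
  proof -
    have S2: "S\<^sup>2 = K\<^sup>2 - c\<^sup>2" using KS by simp
    show ?thesis unfolding S2 y_def by (simp add: field_simps)
  qed
  have e1': "\<bar>(m - 1 + y) * exp (- K)\<bar> \<le> 3 * h\<^sup>2" using e1 by (simp add: abs_mult)
  have triangle: "\<bar>A - b\<bar> \<le> 26 / 3 * d + 11 * e"
    if "\<bar>A - a1 - a2\<bar> \<le> 13 / 3 * d" "\<bar>b - c\<bar> \<le> 13 / 3 * d" "c - (a1 + a2) = p + q"
      "\<bar>p\<bar> \<le> 3 * e" "\<bar>q\<bar> \<le> 8 * e" for b c a1 a2 d e p q :: real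
    using that by linarith
  have "\<bar>A - m * B\<bar> \<le> 26 / 3 * (h * sqrt h) + 11 * h\<^sup>2"
    by (rule triangle[OF 1 mB id e1' e2])
  then show ?thesis unfolding A_def B_def m_def K_def .
qed

subsection \<open>Trotter product\<close>

text \<open>One step of a walk that survives with probability \<open>m\<close>. The factor is taken
  at the starting point, so the n-fold iterate collects it at the times 0, ..., n - 1, which is a
  left-endpoint Riemann sum in the exponent.\<close>

definition gstep :: "real \<Rightarrow> (real \<Rightarrow> real) \<Rightarrow> (real \<Rightarrow> real) \<Rightarrow> real \<Rightarrow> real" where
  "gstep h m f y = m y * (LINT z|gauss h. f (y + z))"

text \<open>Values in \<open>[0, 1]\<close> are preserved by all steps; this keeps every integral
  finite and every iterate in the same class.\<close>

definition unit_meas2 :: "(real \<Rightarrow> real \<Rightarrow> real) \<Rightarrow> bool" where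
  "unit_meas2 F \<longleftrightarrow> case_prod F \<in> borel_measurable (borel \<Otimes>\<^sub>M borel) \<and> (\<forall>x y. 0 \<le> F x y \<and> F x y \<le> 1)"

definition unit_meas :: "(real \<Rightarrow> real) \<Rightarrow> bool" where
  "unit_meas f \<longleftrightarrow> f \<in> borel_measurable borel \<and> (\<forall>x. 0 \<le> f x \<and> f x \<le> 1)"

lemma unit_measD:
  assumes "unit_meas f"
  shows "f \<in> borel_measurable borel" "0 \<le> f x" "f x \<le> 1"
  using assms by (auto simp: unit_meas_def)

lemma integral_gauss_unit:
  assumes h: "h > 0" and f: "f \<in> borel_measurable borel" "\<And>z. 0 \<le> f z" "\<And>z. f z \<le> (1::real)"
  shows "0 \<le> integral\<^sup>L (gauss h) f" "integral\<^sup>L (gauss h) f \<le> 1" "integrable (gauss h) f"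
proof -
  interpret prob_space "gauss h" by (rule prob_space_gauss) fact
  have "\<bar>f z\<bar> \<le> 1" for z using f(2,3)[of z] by simp
  then show i: "integrable (gauss h) f"
    using f(1) by (intro integrable_gauss_bounded[where C=1] h)
  show "0 \<le> integral\<^sup>L (gauss h) f" using f by simp
  show "integral\<^sup>L (gauss h) f \<le> 1" using i f by (intro integral_le_const) auto
qed

lemma unit_meas_gstep:
  assumes h: "h > 0" and m: "unit_meas m" and f: "unit_meas f"
  shows "unit_meas (gstep h m f)"
proof -
  interpret prob_space "gauss h" by (rule prob_space_gauss) fact
  note [measurable] = unit_measD(1)[OF m] unit_measD(1)[OF f]
  have "(\<lambda>y. LINT z|gauss h. f (y + z)) \<in> borel_measurable borel"
    by (rule borel_measurable_lebesgue_integral) measurable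
  moreover have "0 \<le> (LINT z|gauss h. f (y + z)) \<and> (LINT z|gauss h. f (y + z)) \<le> 1" for y
    by (intro conjI integral_gauss_unit h unit_measD(2,3)[OF f]) measurable
  ultimately show ?thesis
    using unit_measD[OF m] by (auto simp: unit_meas_def gstep_def[abs_def] intro!: mult_le_one)
qed

text \<open>The letters stand for killed and free. Each step freezes the variable on which the other
  acts, which is why they commute.\<close>

definition "kstep h m F x \<eta> = gstep h m (\<lambda>x. F x \<eta>) x"
definition "fstep h F x \<eta> = gstep h (\<lambda>_. 1) (F x) \<eta>"

text \<open>Up to a swap of variables the free step is a killed step without killing, so boundedness
  and contraction are shown once and transferred.\<close>

lemma fstep_eq_Tx: "fstep h F = (\<lambda>x \<eta>. kstep h (\<lambda>_. 1) (\<lambda>\<eta> x. F x \<eta>) \<eta> x)"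
  by (simp add: fstep_def[abs_def] kstep_def)

lemma unit_meas2_swap: "unit_meas2 F \<Longrightarrow> unit_meas2 (\<lambda>\<eta> x. F x \<eta>)"
  using measurable_pair_swap[of "case_prod F" borel borel] by (simp add: unit_meas2_def case_prod_beta')

lemma unit_meas_1: "unit_meas (\<lambda>_. 1)"
  by (simp add: unit_meas_def)

context
  fixes h :: real and m :: "real \<Rightarrow> real"
  assumes h: "h > 0" and m: "unit_meas m"
begin


lemma unit_meas2_kstep: assumes F: "unit_meas2 F" shows "unit_meas2 (kstep h m F)"
proof -
  interpret prob_space "gauss h" by (rule prob_space_gauss) (rule h)
  have [measurable]: "case_prod F \<in> borel_measurable (borel \<Otimes>\<^sub>M borel)" using F by (auto simp: unit_meas2_def)
  note [measurable] = unit_measD(1)[OF m]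
  have [measurable]: "(\<lambda>p. LINT z|gauss h. F (fst p + z) (snd p)) \<in> borel_measurable (borel \<Otimes>\<^sub>M borel)"
    by (rule borel_measurable_lebesgue_integral) measurable
  have FF: "0 \<le> F x y" "F x y \<le> 1" for x y using F by (auto simp: unit_meas2_def)
  have "0 \<le> (LINT z|gauss h. F (y + z) e) \<and> (LINT z|gauss h. F (y + z) e) \<le> 1" for y e
    by (intro conjI integral_gauss_unit h FF) measurable
  then show ?thesis
    using unit_measD[OF m] by (auto simp: unit_meas2_def gstep_def kstep_def case_prod_beta' intro!: mult_le_one)
qed

text \<open>Averaging against a probability and multiplying by a factor in \<open>[0, 1]\<close>
  cannot enlarge a uniform distance. The telescoping argument rests on this.\<close>

lemma kstep_contraction:
  assumes F: "unit_meas2 F" and G: "unit_meas2 G" and e: "\<And>x y. \<bar>F x y - G x y\<bar> \<le> e"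
  shows "\<bar>kstep h m F x y - kstep h m G x y\<bar> \<le> e"
proof -
  interpret prob_space "gauss h" by (rule prob_space_gauss) (rule h)
  have [measurable]: "case_prod F \<in> borel_measurable (borel \<Otimes>\<^sub>M borel)" "case_prod G \<in> borel_measurable (borel \<Otimes>\<^sub>M borel)"
    using F G by (auto simp: unit_meas2_def)
  have i: "integrable (gauss h) (\<lambda>z. F (x + z) y)" "integrable (gauss h) (\<lambda>z. G (x + z) y)"
    using F G by (intro integral_gauss_unit(3) h; simp add: unit_meas2_def)+
  have "\<bar>kstep h m F x y - kstep h m G x y\<bar> = \<bar>m x\<bar> * \<bar>LINT z|gauss h. (F (x + z) y - G (x + z) y)\<bar>"
  proof -
    have "kstep h m F x y - kstep h m G x y = m x * (LINT z|gauss h. (F (x + z) y - G (x + z) y))"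
      using i by (simp add: kstep_def gstep_def right_diff_distrib)
    then show ?thesis by (simp only: abs_mult)
  qed
  also have "\<dots> \<le> 1 * (LINT z|gauss h. \<bar>F (x + z) y - G (x + z) y\<bar>)"
    using unit_measD(2,3)[OF m, of x] by (intro mult_mono integral_abs_bound) auto
  also have "\<dots> \<le> e" using i e by (simp, intro integral_le_const) auto
  finally show ?thesis .
qed

end

context
  fixes h :: real and m :: "real \<Rightarrow> real"
  assumes h: "h > 0" and m: "unit_meas m"
begin


lemma unit_meas2_fstep: "unit_meas2 F \<Longrightarrow> unit_meas2 (fstep h F)"
  unfolding fstep_eq_Tx by (rule unit_meas2_swap, rule unit_meas2_kstep[OF h unit_meas_1], rule unit_meas2_swap)

lemma fstep_contraction:
  assumes "unit_meas2 F" "unit_meas2 G" "\<And>x y. \<bar>F x y - G x y\<bar> \<le> e"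
  shows "\<bar>fstep h F x y - fstep h G x y\<bar> \<le> e"
  unfolding fstep_eq_Tx
  by (rule kstep_contraction[OF h unit_meas_1 unit_meas2_swap[OF assms(1)] unit_meas2_swap[OF assms(2)] assms(3)])

lemma unit_meas2_funpow:
  assumes "unit_meas2 F" shows "unit_meas2 (((kstep h m) ^^ k) F)" "unit_meas2 ((fstep h ^^ k) F)"
  using assms by (induction k) (auto intro: unit_meas2_kstep[OF h m] unit_meas2_fstep)

text \<open>The killing factor depends on the first variable only, so the claim is Fubini for two
  independent Gaussian increments.\<close>

lemma kstep_fstep_commute:
  assumes F: "unit_meas2 F" shows "kstep h m (fstep h F) = fstep h (kstep h m F)"
proof (intro ext)
  fix x \<eta>
  interpret prob_space "gauss h" by (rule prob_space_gauss) (rule h)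
  interpret pair_prob_space "gauss h" "gauss h" ..
  have [measurable]: "case_prod F \<in> borel_measurable (borel \<Otimes>\<^sub>M borel)" using F by (auto simp: unit_meas2_def)
  have "integrable (gauss h \<Otimes>\<^sub>M gauss h) (\<lambda>(z, w). F (x + z) (\<eta> + w))"
  proof (rule P.integrable_const_bound[where B = 1])
    show "(\<lambda>(z, w). F (x + z) (\<eta> + w)) \<in> borel_measurable (gauss h \<Otimes>\<^sub>M gauss h)" by measurable
  qed (use F in \<open>auto simp: unit_meas2_def\<close>)
  then have "(LINT w|gauss h. LINT z|gauss h. F (x + z) (\<eta> + w)) = (LINT z|gauss h. LINT w|gauss h. F (x + z) (\<eta> + w))"
    by (rule Fubini_integral)
  then show "kstep h m (fstep h F) x \<eta> = fstep h (kstep h m F) x \<eta>"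
    by (simp add: kstep_def fstep_def gstep_def)
qed

lemma fstep_pow_commute:
  assumes F: "unit_meas2 F" shows "(fstep h ^^ k) (kstep h m F) = kstep h m ((fstep h ^^ k) F)"
  by (induction k) (use F in \<open>auto simp: kstep_fstep_commute unit_meas2_funpow\<close>)

text \<open>
  The killed step in the first variable and the free step in the second commute, so the one-step
  errors add up without amplification.
\<close>

lemma trotter_telescope:
  assumes V: "unit_meas2 V" and e: "\<And>x y. \<bar>kstep h m V x y - fstep h V x y\<bar> \<le> e"
  shows "\<bar>((kstep h m) ^^ n) V x y - (fstep h ^^ n) V x y\<bar> \<le> real n * e"
proof (induction n arbitrary: x y)
  case (Suc n)
  note U = unit_meas2_funpow[OF V] unit_meas2_kstep[OF h m V] unit_meas2_fstep[OF V]
  \<comment> \<open>With K and F for the two steps, K^(n+1) V - F^(n+1) V is K (K^n V - F^n V) plus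
    K F^n V - F^(n+1) V. The first part is the induction hypothesis under a contraction, the second
    is F^n applied to both sides of the one-step error.\<close>
  have 1: "\<bar>kstep h m (((kstep h m) ^^ n) V) x y - kstep h m ((fstep h ^^ n) V) x y\<bar> \<le> real n * e"
    by (rule kstep_contraction[OF h m]) (use U Suc in auto)
  have "\<bar>(fstep h ^^ k) (kstep h m V) x y - (fstep h ^^ k) (fstep h V) x y\<bar> \<le> e" for k x y
    by (induction k arbitrary: x y) (use U e in \<open>auto intro!: fstep_contraction unit_meas2_funpow\<close>)
  then have 2: "\<bar>kstep h m ((fstep h ^^ n) V) x y - fstep h ((fstep h ^^ n) V) x y\<bar> \<le> e"
    unfolding fstep_pow_commute[OF V] funpow_swap1[symmetric] .
  show ?case using 1 2 by (simp add: algebra_simps)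
qed simp

lemma kstep_funpow: "((kstep h m) ^^ n) F x \<eta> = (gstep h m ^^ n) (\<lambda>x. F x \<eta>) x"
proof -
  have "(\<lambda>x. ((kstep h m) ^^ n) F x \<eta>) = (gstep h m ^^ n) (\<lambda>x. F x \<eta>)"
    by (induction n) (auto simp: kstep_def)
  then show ?thesis by (rule fun_cong)
qed

lemma fstep_funpow: "(fstep h ^^ n) F x \<eta> = (gstep h (\<lambda>_. 1) ^^ n) (F x) \<eta>"
proof -
  have "(fstep h ^^ n) F x = (gstep h (\<lambda>_. 1) ^^ n) (F x)"
    by (induction n) (auto simp: fstep_def)
  then show ?thesis by (rule fun_cong)
qed

end

text \<open>At \<open>x\<close> the one-step error is used with \<open>c = a * exp x\<close>. With
  \<open>n * h = t\<close> fixed, the bound is of order \<open>sqrt h\<close>.\<close>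

lemma trotter_cosh:
  fixes a h x \<eta> :: real
  assumes a: "a > 0" and h: "h > 0"
  shows "\<bar>(gstep h (\<lambda>x. exp (- (h / 2 * (a * exp x)\<^sup>2))) ^^ n) (\<lambda>x. exp (- (a * exp x) * cosh \<eta>)) x
      - (gstep h (\<lambda>_. 1) ^^ n) (\<lambda>\<eta>. exp (- (a * exp x) * cosh \<eta>)) \<eta>\<bar>
     \<le> real n * (26 / 3 * (h * sqrt h) + 11 * h\<^sup>2)"
proof -
  define m where "m = (\<lambda>x. exp (- (h / 2 * (a * exp x)\<^sup>2)))"
  define V where "V = (\<lambda>x \<eta>. exp (- (a * exp x) * cosh \<eta>))"
  have m: "unit_meas m" using h by (auto simp: unit_meas_def m_def)
  have V: "unit_meas2 V" using a by (auto simp: unit_meas2_def V_def)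
  have "\<bar>kstep h m V x y - fstep h V x y\<bar> \<le> 26 / 3 * (h * sqrt h) + 11 * h\<^sup>2" for x y
  proof -
    have "\<bar>fstep h V x y - kstep h m V x y\<bar> \<le> 26 / 3 * (h * sqrt h) + 11 * h\<^sup>2"
      using one_step_error[OF h, of "a * exp x" y] a
      by (simp add: kstep_def fstep_def V_def m_def gstep_def exp_add mult_ac)
    then show ?thesis by (simp add: abs_minus_commute)
  qed
  from trotter_telescope[OF h m V this, of n x \<eta>] show ?thesis
    unfolding kstep_funpow[OF h m] fstep_funpow[OF h m] unfolding m_def V_def .
qed

subsection \<open>Gaussian random walks\<close>

text \<open>
  Cameron--Martin for one increment; applied step by step it replaces Girsanov's theorem.
\<close>

lemma nn_integral_gauss_shift:
  fixes G :: "real \<Rightarrow> ennreal"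
  assumes h: "h > 0" and G[measurable]: "G \<in> borel_measurable borel"
  shows "(\<integral>\<^sup>+z. ennreal (exp (- \<nu> * z - \<nu>\<^sup>2 * h / 2)) * G (z + \<nu> * h) \<partial>gauss h) = integral\<^sup>N (gauss h) G"
proof -
  have *: "normal_density 0 (sqrt h) z * exp (- \<nu> * z - \<nu>\<^sup>2 * h / 2) = normal_density 0 (sqrt h) (\<nu> * h + 1 * z)" for z
    using h by (simp add: normal_density_def exp_add[symmetric] field_simps power2_eq_square)
  have "(\<integral>\<^sup>+z. ennreal (exp (- \<nu> * z - \<nu>\<^sup>2 * h / 2)) * G (z + \<nu> * h) \<partial>gauss h)
     = (\<integral>\<^sup>+z. ennreal (normal_density 0 (sqrt h) z) * (ennreal (exp (- \<nu> * z - \<nu>\<^sup>2 * h / 2)) * G (z + \<nu> * h)) \<partial>lborel)"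
    unfolding gauss_def by (subst nn_integral_density) auto
  also have "\<dots> = (\<integral>\<^sup>+z. ennreal (normal_density 0 (sqrt h) (\<nu> * h + 1 * z)) * G (\<nu> * h + 1 * z) \<partial>lborel)"
    unfolding *[symmetric] by (intro nn_integral_cong) (simp add: ennreal_mult mult.assoc add.commute)
  also have "\<dots> = (\<integral>\<^sup>+z. ennreal (normal_density 0 (sqrt h) z) * G z \<partial>lborel)"
    using nn_integral_real_affine[of "\<lambda>z. ennreal (normal_density 0 (sqrt h) z) * G z" 1 "\<nu> * h"] by simp
  also have "\<dots> = integral\<^sup>N (gauss h) G"
    unfolding gauss_def by (subst nn_integral_density) auto
  finally show ?thesis .
qed

definition walk :: "real \<Rightarrow> (nat \<Rightarrow> real) \<Rightarrow> nat \<Rightarrow> real" where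
  "walk b x k = (\<Sum>i<k. x i + b)"

lemma walk_measurable[measurable]:
  "k \<le> n \<Longrightarrow> (\<lambda>x. walk b x k) \<in> borel_measurable (Pi\<^sub>M {..<n} (\<lambda>_. gauss h))"
  unfolding walk_def by (intro borel_measurable_sum borel_measurable_add) (auto intro!: measurable_component_singleton[of _ _ "\<lambda>_. gauss h", unfolded measurable_cong_sets[OF refl sets_gauss]])

lemma walk_upd: "k \<le> j \<Longrightarrow> walk b (x(j := z)) k = walk b x k"
  by (auto simp: walk_def intro!: sum.cong)

text \<open>\<open>w\<close> is evaluated at the increments, \<open>m\<close> at the positions
  before each increment, to match \<open>gstep\<close>. The product lives in \<open>ennreal\<close>
  because the Cameron--Martin weight is unbounded.\<close>

definition "walk_integrand w m f y0 b j x =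
    (\<Prod>k<j. ennreal (w (x k) * m (y0 + walk b x k))) * ennreal (f (y0 + walk b x j))"

lemma walk_integrand_measurable:
  assumes [measurable]: "w \<in> borel_measurable borel" "m \<in> borel_measurable borel" "f \<in> borel_measurable borel"
  shows "walk_integrand w m f y0 b j \<in> borel_measurable (Pi\<^sub>M {..<j} (\<lambda>_. gauss h))"
  unfolding walk_integrand_def[abs_def]
proof (intro borel_measurable_times_ennreal borel_measurable_prod_ennreal)
  fix k assume "k \<in> {..<j}"
  then have [simp]: "k < j" "k \<le> j" by auto
  have [measurable]: "(\<lambda>x. x k) \<in> borel_measurable (Pi\<^sub>M {..<j} (\<lambda>_. gauss h))"
    using measurable_component_singleton[of k "{..<j}" "\<lambda>_. gauss h"] by simp
  show "(\<lambda>x. ennreal (w (x k) * m (y0 + walk b x k))) \<in> borel_measurable (Pi\<^sub>M {..<j} (\<lambda>_. gauss h))"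
    by measurable
qed measurable

text \<open>Integrating out the last increment replaces \<open>f\<close> by
  \<open>gstep h m f\<close>, since the weight \<open>w\<close> cancels the drift
  \<open>\<nu> * h\<close> of that increment. Hence the induction keeps \<open>f\<close> arbitrary,
  and \<nu> is gone from the result.\<close>

lemma nn_integral_gauss_walk:
  fixes \<nu> h y0 :: real and m f :: "real \<Rightarrow> real"
  assumes h: "h > 0" and m: "unit_meas m" and f: "unit_meas f"
  defines "w \<equiv> \<lambda>z. exp (- \<nu> * z - \<nu>\<^sup>2 * h / 2)"
  shows "integral\<^sup>N (Pi\<^sub>M {..<j} (\<lambda>_. gauss h)) (walk_integrand w m f y0 (\<nu> * h) j) = ennreal ((gstep h m ^^ j) f y0)"
  using f
proof (induction j arbitrary: f)
  case 0
  show ?case by (simp add: walk_integrand_def walk_def PiM_empty nn_integral_count_space_finite)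
next
  case (Suc j)
  interpret prob_space "gauss h" by (rule prob_space_gauss) (rule h)
  interpret P: product_sigma_finite "\<lambda>_::nat. gauss h" ..
  note [measurable] = unit_measD(1)[OF m] unit_measD(1)[OF Suc.prems]
  have w[measurable]: "w \<in> borel_measurable borel" unfolding w_def by measurable
  have g: "unit_meas (gstep h m f)" by (rule unit_meas_gstep) fact+
  have w0: "w z \<ge> 0" for z by (simp add: w_def)
  let ?b = "\<nu> * h"
  have meas: "walk_integrand w m f y0 ?b (Suc j) \<in> borel_measurable (Pi\<^sub>M {..<Suc j} (\<lambda>_. gauss h))"
    by (rule walk_integrand_measurable) measurable
  have step: "(\<integral>\<^sup>+z. ennreal (w z * m y) * ennreal (f (y + (z + ?b))) \<partial>gauss h) = ennreal (gstep h m f y)" for y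
  proof -
    have "(\<integral>\<^sup>+z. ennreal (w z * m y) * ennreal (f (y + (z + ?b))) \<partial>gauss h)
        = (\<integral>\<^sup>+z. ennreal (m y) * (ennreal (w z) * ennreal (f (y + (z + ?b)))) \<partial>gauss h)"
      using w0 unit_measD(2)[OF m] by (intro nn_integral_cong) (simp add: ennreal_mult mult_ac)
    also have "\<dots> = ennreal (m y) * (\<integral>\<^sup>+z. ennreal (w z) * ennreal (f (y + (z + ?b))) \<partial>gauss h)"
      by (rule nn_integral_cmult) measurable
    also have "(\<integral>\<^sup>+z. ennreal (w z) * ennreal (f (y + (z + ?b))) \<partial>gauss h) = (\<integral>\<^sup>+z. ennreal (f (y + z)) \<partial>gauss h)"
      unfolding w_def by (rule nn_integral_gauss_shift[OF h, where G="\<lambda>z. ennreal (f (y + z))"]) measurable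
    also have "\<dots> = ennreal (LINT z|gauss h. f (y + z))"
      using unit_measD(2,3)[OF Suc.prems]
      by (intro nn_integral_eq_integral integral_gauss_unit(3) h) auto
    also have "ennreal (m y) * \<dots> = ennreal (gstep h m f y)"
      using unit_measD(2)[OF m] unit_measD(2)[OF Suc.prems] by (simp add: gstep_def ennreal_mult)
    finally show ?thesis .
  qed
  have "integral\<^sup>N (Pi\<^sub>M {..<Suc j} (\<lambda>_. gauss h)) (walk_integrand w m f y0 ?b (Suc j))
     = (\<integral>\<^sup>+x. (\<integral>\<^sup>+z. walk_integrand w m f y0 ?b (Suc j) (x(j := z)) \<partial>gauss h) \<partial>Pi\<^sub>M {..<j} (\<lambda>_. gauss h))"
    unfolding lessThan_Suc by (rule P.product_nn_integral_insert) (use meas in \<open>auto simp: lessThan_Suc\<close>)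
  also have "\<dots> = integral\<^sup>N (Pi\<^sub>M {..<j} (\<lambda>_. gauss h)) (walk_integrand w m (gstep h m f) y0 ?b j)"
  proof (rule nn_integral_cong)
    fix x :: "nat \<Rightarrow> real"
    define P where "P = (\<Prod>k<j. ennreal (w (x k) * m (y0 + walk ?b x k)))"
    define y where "y = y0 + walk ?b x j"
    have "walk_integrand w m f y0 ?b (Suc j) (x(j := z)) = P * (ennreal (w z * m y) * ennreal (f (y + (z + ?b))))" for z
    proof -
      have "(\<Prod>k<j. ennreal (w ((x(j := z)) k) * m (y0 + walk ?b (x(j := z)) k))) = P"
        unfolding P_def by (intro prod.cong) (auto simp: walk_upd)
      moreover have "walk ?b (x(j := z)) (Suc j) = walk ?b x j + (z + ?b)"
        using walk_upd[of j j ?b x z] by (simp add: walk_def)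
      ultimately show ?thesis by (simp add: walk_integrand_def walk_upd y_def mult.assoc add.assoc)
    qed
    then have "(\<integral>\<^sup>+z. walk_integrand w m f y0 ?b (Suc j) (x(j := z)) \<partial>gauss h)
       = (\<integral>\<^sup>+z. P * (ennreal (w z * m y) * ennreal (f (y + (z + ?b)))) \<partial>gauss h)"
      by simp
    also have "\<dots> = P * (\<integral>\<^sup>+z. ennreal (w z * m y) * ennreal (f (y + (z + ?b))) \<partial>gauss h)"
      by (rule nn_integral_cmult) measurable
    also have "\<dots> = P * ennreal (gstep h m f y)" by (simp only: step)
    finally show "(\<integral>\<^sup>+z. walk_integrand w m f y0 ?b (Suc j) (x(j := z)) \<partial>gauss h) = walk_integrand w m (gstep h m f) y0 ?b j x"
      by (simp only: P_def y_def walk_integrand_def)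
  qed
  also have "\<dots> = ennreal ((gstep h m ^^ j) (gstep h m f) y0)"
    by (rule Suc.IH) (rule g)
  finally show ?case by (simp add: funpow_swap1)
qed

subsection \<open>Brownian motion and its exponential functional\<close>

text \<open>The increments over the grid of mesh \<open>h\<close> are independent with law
  \<open>gauss h\<close>, and their weights multiply to the single weight at time \<open>t\<close>.
  So weighted functionals of the drifted motion on the grid become iterates of a driftless
  step.\<close>

lemma bm_walk:
  fixes M :: "'a measure" and B :: "real \<Rightarrow> 'a \<Rightarrow> real" and \<nu> t y0 :: real and m f :: "real \<Rightarrow> real"
  assumes bm: "standard_brownian_motion M B" and t: "t > 0" and n: "n > 0"
    and m: "unit_meas m" and f: "unit_meas f"
  defines "h \<equiv> t / real n"
  defines "Z \<equiv> \<lambda>\<omega>. exp (- \<nu> * B t \<omega> - \<nu>\<^sup>2 * t / 2) *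
      (\<Prod>k<n. m (y0 + (\<nu> * (h * real k) + B (h * real k) \<omega>))) * f (y0 + (\<nu> * t + B t \<omega>))"
  shows "integrable M Z" "integral\<^sup>L M Z = (gstep h m ^^ n) f y0"
proof -
  interpret prob_space M using bm by (simp add: standard_brownian_motion_def)
  have h: "h > 0" and hn: "h * real n = t" using t n by (auto simp: h_def)
  have Bm: "B s \<in> borel_measurable M" if "s \<ge> 0" for s
    using bm that by (simp add: standard_brownian_motion_def)
  have hk[simp]: "0 \<le> h * real k" for k using h by simp
  have [measurable]: "B (h * real k) \<in> borel_measurable M" for k by (rule Bm) simp
  have [measurable]: "B t \<in> borel_measurable M" using t by (intro Bm) simp
  note [measurable] = unit_measD(1)[OF m] unit_measD(1)[OF f]
  define X where "X i \<omega> = B (h * real (Suc i)) \<omega> - B (h * real i) \<omega>" for i \<omega>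
  have Xm[measurable]: "X i \<in> borel_measurable M" for i unfolding X_def[abs_def] by measurable
  have "indep_vars (\<lambda>_. borel) (\<lambda>i \<omega>. B (h * real (Suc i)) \<omega> - B (h * real i) \<omega>) {..<n}"
    using bm h unfolding standard_brownian_motion_def
    by (elim conjE allE[of _ n] allE[of _ "\<lambda>i. h * real i"]) auto
  then have ind: "indep_vars (\<lambda>_. borel) X {..<n}" by (simp add: X_def[abs_def])
  have dX: "distr M borel (X i) = gauss h" for i
  proof -
    have hh: "h * real i < h * real (Suc i)" using h by simp
    have "distributed M lborel (\<lambda>\<omega>. B (h * real (Suc i)) \<omega> - B (h * real i) \<omega>)
         (\<lambda>x. ennreal (normal_density 0 (sqrt (h * real (Suc i) - h * real i)) x))"
      using bm hk[of i] hh unfolding standard_brownian_motion_def by blast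
    moreover have "h * real (Suc i) - h * real i = h" by (simp add: algebra_simps)
    ultimately have "distr M lborel (X i) = gauss h"
      by (simp add: distributed_def gauss_def X_def[abs_def])
    moreover have "distr M borel (X i) = distr M lborel (X i)" by (rule distr_cong) auto
    ultimately show ?thesis by simp
  qed
  define \<Xi> where "\<Xi> \<omega> = (\<lambda>i\<in>{..<n}. X i \<omega>)" for \<omega>
  have "{..<n} \<noteq> {}" using n by auto
  then have "distr M (Pi\<^sub>M {..<n} (\<lambda>_. borel)) \<Xi> = Pi\<^sub>M {..<n} (\<lambda>i. distr M borel (X i))"
    using ind indep_vars_iff_distr_eq_PiM[of "{..<n}" X "\<lambda>_. borel"] Xm by (simp add: \<Xi>_def[abs_def])
  then have D: "distr M (Pi\<^sub>M {..<n} (\<lambda>_. borel)) \<Xi> = Pi\<^sub>M {..<n} (\<lambda>_. gauss h)"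
    by (simp add: dX)
  have \<Xi>m: "\<Xi> \<in> measurable M (Pi\<^sub>M {..<n} (\<lambda>_. borel))"
    unfolding \<Xi>_def[abs_def] by measurable
  let ?b = "\<nu> * h"
  define w where "w z = exp (- \<nu> * z - \<nu>\<^sup>2 * h / 2)" for z
  have wm[measurable]: "w \<in> borel_measurable borel" unfolding w_def by measurable
  define F where "F = walk_integrand w m f y0 ?b n"
  have Fm: "F \<in> borel_measurable (Pi\<^sub>M {..<n} (\<lambda>_. borel))"
  proof -
    have "F \<in> borel_measurable (Pi\<^sub>M {..<n} (\<lambda>_. gauss h))"
      unfolding F_def by (rule walk_integrand_measurable) measurable
    also have "borel_measurable (Pi\<^sub>M {..<n} (\<lambda>_. gauss h)) = borel_measurable (Pi\<^sub>M {..<n} (\<lambda>_. borel))"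
      by (intro measurable_cong_sets sets_PiM_cong) auto
    finally show ?thesis .
  qed
  have "integral\<^sup>N (Pi\<^sub>M {..<n} (\<lambda>_. gauss h)) F = ennreal ((gstep h m ^^ n) f y0)"
    unfolding F_def w_def by (rule nn_integral_gauss_walk) fact+
  then have E: "(\<integral>\<^sup>+\<omega>. F (\<Xi> \<omega>) \<partial>M) = ennreal ((gstep h m ^^ n) f y0)"
    unfolding D[symmetric] using nn_integral_distr[OF \<Xi>m] Fm by simp
  have B0: "AE \<omega> in M. B 0 \<omega> = 0" using bm by (simp add: standard_brownian_motion_def)
  \<comment> \<open>\<open>B 0 \<omega> = 0\<close> holds only almost surely, and it is what turns
    sums of increments into values of \<open>B\<close>.\<close>
  have FZ: "AE \<omega> in M. F (\<Xi> \<omega>) = ennreal (Z \<omega>)"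
    using B0
  proof eventually_elim
    fix \<omega> assume B0: "B 0 \<omega> = 0"
    have "(\<Sum>i<k. X i \<omega>) = B (h * real k) \<omega>" for k
      by (induction k) (use B0 in \<open>auto simp: X_def\<close>)
    moreover have "walk ?b (\<Xi> \<omega>) k = (\<Sum>i<k. X i \<omega> + ?b)" if "k \<le> n" for k
      using that by (auto simp: walk_def \<Xi>_def intro!: sum.cong)
    ultimately have wk: "walk ?b (\<Xi> \<omega>) k = \<nu> * (h * real k) + B (h * real k) \<omega>" if "k \<le> n" for k
      using that by (simp add: sum.distrib algebra_simps)
    have "(\<Prod>k<n. w (X k \<omega>)) = exp (\<Sum>k<n. - \<nu> * X k \<omega> - \<nu>\<^sup>2 * h / 2)"
      unfolding w_def by (simp add: exp_sum)
    also have "(\<Sum>k<n. - \<nu> * X k \<omega> - \<nu>\<^sup>2 * h / 2) = - \<nu> * B t \<omega> - \<nu>\<^sup>2 * t / 2"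
    proof -
      have "(\<Sum>k<n. - \<nu> * X k \<omega> - \<nu>\<^sup>2 * h / 2) = - \<nu> * (\<Sum>k<n. X k \<omega>) - \<nu>\<^sup>2 * (h * real n) / 2"
        by (simp add: sum_subtractf sum_distrib_left sum_negf)
      also have "(\<Sum>k<n. X k \<omega>) = B (h * real n) \<omega>" by fact
      finally show ?thesis by (simp only: hn)
    qed
    finally have W: "(\<Prod>k<n. w (X k \<omega>)) = exp (- \<nu> * B t \<omega> - \<nu>\<^sup>2 * t / 2)" .
    have w0: "w z \<ge> 0" for z by (simp add: w_def)
    have "(\<Prod>k<n. ennreal (w (\<Xi> \<omega> k) * m (y0 + walk ?b (\<Xi> \<omega>) k)))
        = (\<Prod>k<n. ennreal (w (X k \<omega>) * m (y0 + (\<nu> * (h * real k) + B (h * real k) \<omega>))))"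
    proof (intro prod.cong refl)
      fix k assume "k \<in> {..<n}"
      then have "k \<le> n" "\<Xi> \<omega> k = X k \<omega>" by (auto simp: \<Xi>_def)
      then show "ennreal (w (\<Xi> \<omega> k) * m (y0 + walk ?b (\<Xi> \<omega>) k))
          = ennreal (w (X k \<omega>) * m (y0 + (\<nu> * (h * real k) + B (h * real k) \<omega>)))" by (simp add: wk)
    qed
    also have "\<dots> = ennreal (\<Prod>k<n. w (X k \<omega>) * m (y0 + (\<nu> * (h * real k) + B (h * real k) \<omega>)))"
      using w0 unit_measD(2)[OF m] by (intro prod_ennreal) auto
    also have "\<dots> = ennreal (exp (- \<nu> * B t \<omega> - \<nu>\<^sup>2 * t / 2) * (\<Prod>k<n. m (y0 + (\<nu> * (h * real k) + B (h * real k) \<omega>))))"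
      by (simp only: prod.distrib W)
    finally show "F (\<Xi> \<omega>) = ennreal (Z \<omega>)"
      using unit_measD(2)[OF m] unit_measD(2)[OF f]
      by (simp add: F_def walk_integrand_def Z_def wk hn ennreal_mult prod_nonneg)
  qed
  have Z0: "Z \<omega> \<ge> 0" for \<omega>
    using unit_measD(2)[OF m] unit_measD(2)[OF f] by (simp add: Z_def prod_nonneg)
  have Zm: "Z \<in> borel_measurable M" unfolding Z_def by measurable
  have "(\<integral>\<^sup>+\<omega>. ennreal (Z \<omega>) \<partial>M) = (\<integral>\<^sup>+\<omega>. F (\<Xi> \<omega>) \<partial>M)"
    by (rule nn_integral_cong_AE) (use FZ in auto)
  then have NZ: "(\<integral>\<^sup>+\<omega>. ennreal (Z \<omega>) \<partial>M) = ennreal ((gstep h m ^^ n) f y0)" by (simp add: E)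
  show "integrable M Z" by (rule integrableI_nn_integral_finite[OF Zm _ NZ]) (use Z0 in auto)
  have "unit_meas ((gstep h m ^^ n) f)" by (induction n) (auto intro: unit_meas_gstep h m f)
  then have "0 \<le> (gstep h m ^^ n) f y0" by (rule unit_measD)
  then show "integral\<^sup>L M Z = (gstep h m ^^ n) f y0"
    by (subst integral_eq_nn_integral) (use Zm Z0 NZ in auto)
qed

text \<open>Left endpoints, as produced by the iterated killed step; \<open>Suc n\<close> avoids an
  empty subdivision. On each cell \<open>g\<close> stays within \<open>e\<close> of its left value,
  and the cell errors add up to \<open>t * e\<close>.\<close>

lemma riemann_sum_tendsto:
  fixes g :: "real \<Rightarrow> real"
  assumes t: "t > 0" and g: "continuous_on {0..t} g"
  shows "(\<lambda>n. t / real (Suc n) * (\<Sum>k<Suc n. g (t / real (Suc n) * real k))) \<longlonglongrightarrow> (LBINT x:{0..t}. g x)"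
proof -
  have I: "(LBINT x:{0..t}. g x) = integral {0..t} g"
    by (intro set_borel_integral_eq_integral borel_integrable_atLeastAtMost' g)
  show ?thesis unfolding I
  proof (rule LIMSEQ_I)
    fix r :: real assume r: "r > 0"
    \<comment> \<open>Half of \<open>r / t\<close>, so that the total error \<open>t * e\<close> is
      strictly below \<open>r\<close>.\<close>
    define e where "e = r / (2 * t)"
    have e: "e > 0" using r t by (simp add: e_def)
    have "uniformly_continuous_on {0..t} g" by (intro compact_uniformly_continuous g) auto
    then obtain d where d: "d > 0" "\<And>x y. x \<in> {0..t} \<Longrightarrow> y \<in> {0..t} \<Longrightarrow> dist y x < d \<Longrightarrow> dist (g y) (g x) < e"
      using e unfolding uniformly_continuous_on_def by metis
    obtain N where N: "inverse (real (Suc N)) < d / t" using reals_Archimedean[of "d / t"] d t by auto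
    have "norm (t / real (Suc n) * (\<Sum>k<Suc n. g (t / real (Suc n) * real k)) - integral {0..t} g) < r" if n: "n \<ge> N" for n
    proof -
      define h where "h = t / real (Suc n)"
      have h: "h > 0" using t by (simp add: h_def)
      have ht: "h * real (Suc n) = t" by (simp add: h_def)
      have hd: "h < d"
      proof -
        have "inverse (real (Suc n)) \<le> inverse (real (Suc N))" using n by (intro le_imp_inverse_le) auto
        then have "inverse (real (Suc n)) < d / t" using N by linarith
        then show ?thesis using t by (simp add: h_def field_simps)
      qed
      have "\<bar>integral {0..h * real j} g - h * (\<Sum>k<j. g (h * real k))\<bar> \<le> h * real j * e" if "j \<le> Suc n" for j
        using that
      proof (induction j)
        case (Suc j)
        have j1: "h * real (Suc j) \<le> t" unfolding ht[symmetric] using Suc.prems h by (intro mult_left_mono) auto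
        have j0: "0 \<le> h * real j" "h * real j \<le> h * real (Suc j)" using h by (auto simp: mult_left_mono)
        have c: "continuous_on {0..h * real (Suc j)} g" by (rule continuous_on_subset[OF g]) (use j1 in auto)
        have c2: "continuous_on {h * real j..h * real (Suc j)} g" by (rule continuous_on_subset[OF c]) (use j0 in auto)
        have comb: "integral {0..h * real (Suc j)} g = integral {0..h * real j} g + integral {h * real j..h * real (Suc j)} g"
          using Henstock_Kurzweil_Integration.integral_combine[OF j0 integrable_continuous_interval[OF c]] by simp
        have "norm (integral {h * real j..h * real (Suc j)} (\<lambda>x. g x - g (h * real j))) \<le> e * (h * real (Suc j) - h * real j)"
        proof (rule integral_bound[OF j0(2)])
          show "continuous_on {h * real j..h * real (Suc j)} (\<lambda>x. g x - g (h * real j))"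
            by (intro continuous_intros c2)
          fix x assume x: "x \<in> {h * real j..h * real (Suc j)}"
          have "dist x (h * real j) < d" using x hd j0 by (auto simp: dist_real_def algebra_simps)
          then have "dist (g x) (g (h * real j)) < e" using x j0 j1 by (intro d(2)) auto
          then show "norm (g x - g (h * real j)) \<le> e" by (simp add: dist_norm)
        qed
        also have "integral {h * real j..h * real (Suc j)} (\<lambda>x. g x - g (h * real j))
             = integral {h * real j..h * real (Suc j)} g - h * g (h * real j)"
          using j0 Henstock_Kurzweil_Integration.integral_diff[OF integrable_continuous_interval[OF c2] integrable_const_ivl, of "g (h * real j)"]
          by (simp add: algebra_simps)
        finally have "\<bar>integral {h * real j..h * real (Suc j)} g - h * g (h * real j)\<bar> \<le> e * h"
          by (simp add: algebra_simps)
        with Suc show ?case unfolding comb by (simp add: algebra_simps)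
      qed simp
      from this[of "Suc n"] have "\<bar>integral {0..t} g - h * (\<Sum>k<Suc n. g (h * real k))\<bar> \<le> t * e"
        unfolding ht by simp
      also have "t * e < r" using r t by (simp add: e_def)
      finally show ?thesis by (simp add: h_def abs_minus_commute)
    qed
    then show "\<exists>no. \<forall>n\<ge>no. norm (t / real (Suc n) * (\<Sum>k<Suc n. g (t / real (Suc n) * real k)) - integral {0..t} g) < r" by blast
  qed
qed

lemma unit_meas_exp: "c \<ge> 0 \<Longrightarrow> unit_meas (\<lambda>x. exp (- (c * exp x)))"
  by (auto simp: unit_meas_def)

lemma bm_gauss:
  assumes bm: "standard_brownian_motion M B" and t: "t > 0" and f[measurable]: "f \<in> borel_measurable borel"
  shows "(LINT \<omega>|M. f (B t \<omega>)) = integral\<^sup>L (gauss t) (f :: real \<Rightarrow> real)"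
proof -
  interpret prob_space M using bm by (simp add: standard_brownian_motion_def)
  have [measurable]: "B 0 \<in> borel_measurable M" "B t \<in> borel_measurable M"
    using bm t by (simp_all add: standard_brownian_motion_def)
  have "distributed M lborel (\<lambda>\<omega>. B t \<omega> - B 0 \<omega>) (\<lambda>x. ennreal (normal_density 0 (sqrt (t - 0)) x))"
    using bm t unfolding standard_brownian_motion_def by blast
  then have "(LBINT x. normal_density 0 (sqrt t) x * f x) = (LINT \<omega>|M. f (B t \<omega> - B 0 \<omega>))"
    by (intro distributed_integral) auto
  also have "\<dots> = (LINT \<omega>|M. f (B t \<omega>))"
  proof (rule integral_cong_AE)
    show "AE \<omega> in M. f (B t \<omega> - B 0 \<omega>) = f (B t \<omega>)"
      using bm by (auto simp: standard_brownian_motion_def)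
  qed measurable
  finally show ?thesis by (simp add: integral_gauss)
qed

text \<open>All paths are continuous, so the Riemann sums converge at every point of the space and
  carry measurability over. The minimum of the positive integrand over \<open>{0..t}\<close> gives
  strict positivity.\<close>

lemma exp_functional_measurable:
  assumes bm: "standard_brownian_motion M B" and t: "t > 0"
  shows "exp_functional \<nu> B t \<in> borel_measurable M"
    and "\<omega> \<in> space M \<Longrightarrow> (\<lambda>n. t / real (Suc n) * (\<Sum>k<Suc n. exp (2 * (\<nu> * (t / real (Suc n) * real k) + B (t / real (Suc n) * real k) \<omega>))))
           \<longlonglongrightarrow> exp_functional \<nu> B t \<omega>"
    and "\<omega> \<in> space M \<Longrightarrow> exp_functional \<nu> B t \<omega> > 0"
proof -
  have c: "continuous_on {0..t} (\<lambda>x. exp (2 * (\<nu> * x + B x \<omega>)))" if "\<omega> \<in> space M" for \<omega>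
  proof -
    have "continuous_on {0..} (\<lambda>t. B t \<omega>)" using bm that by (simp add: standard_brownian_motion_def)
    then have "continuous_on {0..t} (\<lambda>t. B t \<omega>)" by (rule continuous_on_subset) auto
    then show ?thesis by (intro continuous_intros)
  qed
  show lim: "(\<lambda>n. t / real (Suc n) * (\<Sum>k<Suc n. exp (2 * (\<nu> * (t / real (Suc n) * real k) + B (t / real (Suc n) * real k) \<omega>))))
           \<longlonglongrightarrow> exp_functional \<nu> B t \<omega>" if "\<omega> \<in> space M" for \<omega>
    unfolding exp_functional_def by (rule riemann_sum_tendsto[OF t c[OF that]])
  have Bm: "B (t / real (Suc n) * real k) \<in> borel_measurable M" for n k
    using bm t by (simp add: standard_brownian_motion_def)
  show "exp_functional \<nu> B t \<in> borel_measurable M"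
    by (rule borel_measurable_LIMSEQ_real[OF lim]) (use Bm in measurable)
  show "exp_functional \<nu> B t \<omega> > 0" if w: "\<omega> \<in> space M"
  proof -
    obtain x0 where x0: "x0 \<in> {0..t}" "\<forall>y\<in>{0..t}. exp (2 * (\<nu> * x0 + B x0 \<omega>)) \<le> exp (2 * (\<nu> * y + B y \<omega>))"
      using continuous_attains_inf[OF _ _ c[OF w]] t by auto
    define e where "e = exp (2 * (\<nu> * x0 + B x0 \<omega>))"
    have i: "set_integrable lborel {0..t} (\<lambda>x. exp (2 * (\<nu> * x + B x \<omega>)))"
      by (rule borel_integrable_atLeastAtMost'[OF c[OF w]])
    have "0 < t * e" using t by (simp add: e_def)
    also have "t * e = (LBINT x:{0..t}. e)" using t by (simp add: set_integral_const)
    also have "\<dots> \<le> (LBINT x:{0..t}. exp (2 * (\<nu> * x + B x \<omega>)))"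
      using x0(2) by (intro set_integral_mono i borel_integrable_atLeastAtMost') (auto simp: e_def)
    finally show ?thesis by (simp add: exp_functional_def)
  qed
qed

text \<open>The limit of \<open>trotter_cosh\<close> along grids of mesh \<open>t / Suc n\<close>,
  started at \<open>x = 0\<close>. The killing factors multiply to the exponential of a Riemann sum
  of the functional, and the weight dominates the limit passage.\<close>

theorem feynman_kac_cosh:
  fixes M :: "'a measure" and B :: "real \<Rightarrow> 'a \<Rightarrow> real" and \<nu> t a \<eta> :: real
  assumes bm: "standard_brownian_motion M B" and t: "t > 0" and a: "a > 0"
  shows "integrable M (\<lambda>\<omega>. exp (- \<nu> * B t \<omega> - \<nu>\<^sup>2 * t / 2))"
    and "(LINT \<omega>|M. exp (- \<nu> * B t \<omega> - \<nu>\<^sup>2 * t / 2) *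
       exp (- (a * cosh \<eta> * exp (\<nu> * t + B t \<omega>)) - a\<^sup>2 / 2 * exp_functional \<nu> B t \<omega>))
     = (LINT z|gauss t. exp (- a * cosh (\<eta> + z)))"
proof -
  interpret prob_space M using bm by (simp add: standard_brownian_motion_def)
  define D where "D \<omega> = exp (- \<nu> * B t \<omega> - \<nu>\<^sup>2 * t / 2)" for \<omega>
  have [measurable]: "B t \<in> borel_measurable M" using bm t by (simp add: standard_brownian_motion_def)
  have [measurable]: "exp_functional \<nu> B t \<in> borel_measurable M" by (rule exp_functional_measurable[OF bm t])
  \<comment> \<open>The weight alone is a one-step walk without killing and with constant terminal
    function.\<close>
  show Di: "integrable M (\<lambda>\<omega>. exp (- \<nu> * B t \<omega> - \<nu>\<^sup>2 * t / 2))"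
    using bm_walk(1)[OF bm t _ unit_meas_1 unit_meas_1, where n = 1 and \<nu> = \<nu>] by simp
  define h where "h n = t / real (Suc n)" for n
  have h: "h n > 0" for n using t by (simp add: h_def)
  define m where "m n = (\<lambda>x. exp (- (h n / 2 * (a * exp x)\<^sup>2)))" for n
  define f where "f = (\<lambda>x. exp (- (a * cosh \<eta> * exp x)))"
  have f: "unit_meas f" unfolding f_def using a by (intro unit_meas_exp) simp
  have m: "unit_meas (m n)" for n using h[of n] by (auto simp: unit_meas_def m_def)
  define g where "g = (\<lambda>\<eta>. exp (- a * cosh \<eta>))"
  have g: "unit_meas g" using a by (auto simp: unit_meas_def g_def)
  define S where "S n \<omega> = h n * (\<Sum>k<Suc n. exp (2 * (\<nu> * (h n * real k) + B (h n * real k) \<omega>)))" for n \<omega>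
  define Z where "Z n \<omega> = D \<omega> * exp (- (a\<^sup>2 / 2 * S n \<omega>)) * f (\<nu> * t + B t \<omega>)" for n \<omega>
  have Zw: "D \<omega> * (\<Prod>k<Suc n. m n (0 + (\<nu> * (h n * real k) + B (h n * real k) \<omega>))) * f (0 + (\<nu> * t + B t \<omega>)) = Z n \<omega>" for n \<omega>
  proof -
    have "(\<Prod>k<Suc n. m n (\<nu> * (h n * real k) + B (h n * real k) \<omega>))
        = exp (\<Sum>k<Suc n. - (h n / 2 * (a * exp (\<nu> * (h n * real k) + B (h n * real k) \<omega>))\<^sup>2))"
      unfolding m_def by (rule exp_sum[symmetric]) simp
    also have "(\<Sum>k<Suc n. - (h n / 2 * (a * exp (\<nu> * (h n * real k) + B (h n * real k) \<omega>))\<^sup>2)) = - (a\<^sup>2 / 2 * S n \<omega>)"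
      unfolding S_def sum_negf sum_distrib_left
      by (intro arg_cong[where f=uminus] sum.cong refl) (simp add: power_mult_distrib exp_double[symmetric] power2_eq_square[of "exp _"] exp_add[symmetric])
    finally show ?thesis by (simp add: Z_def)
  qed
  have W: "integrable M (Z n)" "integral\<^sup>L M (Z n) = (gstep (h n) (m n) ^^ Suc n) f 0" for n
    using bm_walk[OF bm t _ m[of n] f, where n = "Suc n" and \<nu> = \<nu> and ?y0.0 = 0, folded h_def D_def, unfolded Zw] by auto
  \<comment> \<open>With drift 0 and no killing, \<open>bm_walk\<close> collapses the free steps
    into one Gaussian of variance \<open>t\<close>.\<close>
  have G: "(gstep (h n) (\<lambda>_. 1) ^^ Suc n) g \<eta> = (LINT z|gauss t. g (\<eta> + z))" for n
  proof -
    have "(gstep (h n) (\<lambda>_. 1) ^^ Suc n) g \<eta> = (LINT \<omega>|M. g (\<eta> + B t \<omega>))"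
      using bm_walk(2)[OF bm t _ unit_meas_1 g, where n = "Suc n" and \<nu> = 0 and ?y0.0 = \<eta>] by (simp add: h_def)
    also have "\<dots> = (LINT z|gauss t. g (\<eta> + z))"
      unfolding g_def by (intro bm_gauss[OF bm t, of "\<lambda>z. exp (- a * cosh (\<eta> + z))"]) measurable
    finally show ?thesis .
  qed
  have diff: "\<bar>integral\<^sup>L M (Z n) - (LINT z|gauss t. g (\<eta> + z))\<bar> \<le> 26 / 3 * t * sqrt (h n) + 11 * t * h n" for n
  proof -
    have "\<bar>(gstep (h n) (m n) ^^ Suc n) f 0 - (gstep (h n) (\<lambda>_. 1) ^^ Suc n) g \<eta>\<bar>
      \<le> real (Suc n) * (26 / 3 * (h n * sqrt (h n)) + 11 * (h n)\<^sup>2)"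
      using trotter_cosh[OF a h[of n], where n = "Suc n" and x = 0 and \<eta> = \<eta>]
      by (simp del: funpow.simps add: m_def f_def g_def mult.commute mult.left_commute)
    also have "\<dots> = 26 / 3 * (real (Suc n) * h n) * sqrt (h n) + 11 * (real (Suc n) * h n) * h n"
      by (simp add: algebra_simps power2_eq_square)
    also have "real (Suc n) * h n = t" by (simp add: h_def)
    finally show ?thesis by (simp only: W G)
  qed
  have h0: "h \<longlonglongrightarrow> 0" unfolding h_def
    by (rule real_tendsto_divide_at_top[OF tendsto_const]) (rule filterlim_compose[OF filterlim_real_sequentially filterlim_Suc])
  have "(\<lambda>n. 26 / 3 * t * sqrt (h n) + 11 * t * h n) \<longlonglongrightarrow> 26 / 3 * t * sqrt 0 + 11 * t * 0"
    by (intro tendsto_intros h0)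
  then have "(\<lambda>n. 26 / 3 * t * sqrt (h n) + 11 * t * h n) \<longlonglongrightarrow> 0" by simp
  then have "(\<lambda>n. integral\<^sup>L M (Z n) - (LINT z|gauss t. g (\<eta> + z))) \<longlonglongrightarrow> 0"
    by (rule Lim_null_comparison[rotated]) (use diff in auto)
  then have L1: "(\<lambda>n. integral\<^sup>L M (Z n)) \<longlonglongrightarrow> (LINT z|gauss t. g (\<eta> + z))"
    by (rule LIM_zero_cancel)
  have "(\<lambda>n. integral\<^sup>L M (Z n)) \<longlonglongrightarrow>
      integral\<^sup>L M (\<lambda>\<omega>. D \<omega> * exp (- (a\<^sup>2 / 2 * exp_functional \<nu> B t \<omega>)) * f (\<nu> * t + B t \<omega>))"
  proof (rule integral_dominated_convergence[where w=D])
    note [measurable] = unit_measD(1)[OF f]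
    show "(\<lambda>\<omega>. D \<omega> * exp (- (a\<^sup>2 / 2 * exp_functional \<nu> B t \<omega>)) * f (\<nu> * t + B t \<omega>)) \<in> borel_measurable M"
      unfolding D_def by measurable
    show "Z n \<in> borel_measurable M" for n by (rule borel_measurable_integrable[OF W(1)])
    show "integrable M D" using Di by (simp add: D_def[abs_def])
    have "(\<lambda>n. Z n \<omega>) \<longlonglongrightarrow> D \<omega> * exp (- (a\<^sup>2 / 2 * exp_functional \<nu> B t \<omega>)) * f (\<nu> * t + B t \<omega>)" if "\<omega> \<in> space M" for \<omega>
      unfolding Z_def S_def h_def by (intro tendsto_intros exp_functional_measurable[OF bm t] that)
    then show "AE \<omega> in M. (\<lambda>n. Z n \<omega>) \<longlonglongrightarrow> D \<omega> * exp (- (a\<^sup>2 / 2 * exp_functional \<nu> B t \<omega>)) * f (\<nu> * t + B t \<omega>)" by auto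
    show "AE \<omega> in M. norm (Z n \<omega>) \<le> D \<omega>" for n
    proof (rule AE_I2)
      fix \<omega>
      have "S n \<omega> \<ge> 0" unfolding S_def using h[of n] by (intro mult_nonneg_nonneg sum_nonneg) auto
      then have e: "exp (- (a\<^sup>2 / 2 * S n \<omega>)) \<le> 1" by simp
      have "norm (Z n \<omega>) = D \<omega> * (exp (- (a\<^sup>2 / 2 * S n \<omega>)) * f (\<nu> * t + B t \<omega>))"
        using unit_measD(2)[OF f] by (simp add: Z_def D_def abs_mult)
      also have "\<dots> \<le> D \<omega> * 1"
        using e unit_measD(2,3)[OF f] by (intro mult_left_mono mult_le_one) (auto simp: D_def)
      finally show "norm (Z n \<omega>) \<le> D \<omega>" by simp
    qed
  qed
  then have "integral\<^sup>L M (\<lambda>\<omega>. D \<omega> * exp (- (a\<^sup>2 / 2 * exp_functional \<nu> B t \<omega>)) * f (\<nu> * t + B t \<omega>)) = (LINT z|gauss t. g (\<eta> + z))"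
    using L1 by (rule LIMSEQ_unique)
  moreover have "exp (- p - q) = exp (- q) * exp (- p)" for p q :: real
    by (simp add: exp_add[symmetric])
  ultimately show "(LINT \<omega>|M. exp (- \<nu> * B t \<omega> - \<nu>\<^sup>2 * t / 2) *
       exp (- (a * cosh \<eta> * exp (\<nu> * t + B t \<omega>)) - a\<^sup>2 / 2 * exp_functional \<nu> B t \<omega>))
     = (LINT z|gauss t. exp (- a * cosh (\<eta> + z)))"
    by (simp only: D_def f_def g_def mult.assoc)
qed

subsection \<open>An integral evaluated by a shift of the contour\<close>

text \<open>The deviation of coth from 1 is \<open>exp (- w) / sinh w\<close>, and the norm of
  \<open>sinh w\<close> is at least \<open>sinh (Re w)\<close>. The bound depends on
  \<open>Re w\<close> only and is thus uniform on vertical segments.\<close>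

lemma coth_near_1:
  fixes w :: complex
  assumes "Re w > 0"
  shows "sinh w \<noteq> 0" "norm (cosh w / sinh w - 1) \<le> exp (- Re w) / sinh (Re w)"
proof -
  have "sinh (Re w) = (norm (exp w) - norm (exp (- w))) / 2"
    by (simp add: sinh_field_def)
  also have "\<dots> \<le> norm (exp w - exp (- w)) / 2"
    using norm_triangle_ineq2[of "exp w" "exp (-w)"] by simp
  also have "\<dots> = norm (sinh w)" by (simp add: sinh_field_def norm_divide)
  finally have le: "sinh (Re w) \<le> norm (sinh w)" .
  have pos: "sinh (Re w) > 0" using assms by simp
  then show nz: "sinh w \<noteq> 0" using le by auto
  have "cosh w / sinh w - 1 = exp (- w) / sinh w" using nz by (simp add: field_simps flip: cosh_minus_sinh)
  then have "norm (cosh w / sinh w - 1) = exp (- Re w) / norm (sinh w)" by (simp add: norm_divide)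
  also have "\<dots> \<le> exp (- Re w) / sinh (Re w)" using le pos by (intro divide_left_mono mult_pos_pos) auto
  finally show "norm (cosh w / sinh w - 1) \<le> exp (- Re w) / sinh (Re w)" .
qed

text \<open>Regroup as \<open>e * c - e0 * (c - 1)\<close> with \<open>c\<close> the hyperbolic
  cotangent. Later \<open>e\<close> is Gaussian small and \<open>c\<close> close to 1, so the
  integrand with its residue subtracted tends to \<open>- e0\<close>.\<close>

lemma coth_gauss_bound:
  fixes w e :: complex and e0 m :: real
  assumes "Re w > 0" "norm e \<le> m" "e0 \<ge> 0"
  defines "b \<equiv> exp (- Re w) / sinh (Re w)"
  shows "norm ((e - of_real e0) * (cosh w / sinh w) + of_real e0) \<le> m * (1 + b) + e0 * b"
proof -
  define c where "c = cosh w / sinh w"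
  have c: "norm (c - 1) \<le> b" unfolding c_def b_def by (rule coth_near_1) fact
  have "norm c \<le> 1 + b" using norm_triangle_ineq[of "c - 1" 1] c by simp
  have "(e - of_real e0) * c + of_real e0 = e * c - of_real e0 * (c - 1)" by (simp add: algebra_simps)
  also have "norm \<dots> \<le> norm (e * c) + norm (of_real e0 * (c - 1))" by (rule norm_triangle_ineq4)
  also have "\<dots> \<le> m * (1 + b) + e0 * b"
    unfolding norm_mult using assms c \<open>norm c \<le> 1 + b\<close> order_trans[OF norm_ge_zero assms(2)]
    by (intro add_mono mult_mono) auto
  finally show ?thesis by (simp add: c_def)
qed

text \<open>The zeros of sinh are the integer multiples of i pi. Applied at half the variable, this
  covers a strip of half-width \<open>2 * pi\<close>.\<close>

lemma complex_sinh_eq_0_strip: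
  fixes w :: complex
  assumes "sinh w = 0" "\<bar>Im w\<bar> < pi"
  shows "w = 0"
proof -
  have "sin (\<i> * w) = 0" using assms(1) by (simp add: sinh_conv_sin)
  then obtain n :: int where n: "\<i> * w = of_real (real_of_int n * pi)"
    by (auto simp: sin_eq_0)
  have "Im w = - (real_of_int n * pi)" "Re w = 0"
    using arg_cong[OF n, of Re] arg_cong[OF n, of Im] by auto
  moreover have "n = 0"
  proof (rule ccontr)
    assume "n \<noteq> 0"
    then have "1 * pi \<le> \<bar>real_of_int n\<bar> * pi" by (intro mult_right_mono) auto
    then show False using assms(2) calculation by (simp add: abs_mult)
  qed
  ultimately show ?thesis by (simp add: complex_eq_iff)
qed

lemma cosh_sinh_half_pi:
  fixes x :: real
  shows "cosh (Complex x (pi / 2)) = \<i> * of_real (sinh x)" "sinh (Complex x (pi / 2)) = \<i> * of_real (cosh x)"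
    "cosh (Complex x (- (pi / 2))) = - (\<i> * of_real (sinh x))" "sinh (Complex x (- (pi / 2))) = - (\<i> * of_real (cosh x))"
proof -
  have "exp (Complex x (pi / 2)) = of_real (exp x) * \<i>" "exp (- Complex x (pi / 2)) = - (of_real (exp (- x)) * \<i>)"
    "exp (Complex x (- (pi / 2))) = - (of_real (exp x) * \<i>)" "exp (- Complex x (- (pi / 2))) = of_real (exp (- x)) * \<i>"
    by (simp_all add: complex_eq_iff Re_exp Im_exp)
  then show "cosh (Complex x (pi / 2)) = \<i> * of_real (sinh x)" "sinh (Complex x (pi / 2)) = \<i> * of_real (cosh x)"
    "cosh (Complex x (- (pi / 2))) = - (\<i> * of_real (sinh x))" "sinh (Complex x (- (pi / 2))) = - (\<i> * of_real (cosh x))"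
    by (simp_all add: cosh_field_def sinh_field_def field_simps)
qed

lemma integrable_exp_sq:
  assumes "c > 0" shows "integrable lborel (\<lambda>s::real. exp (- (c * s\<^sup>2)))"
proof -
  have "integrable lborel (normal_density 0 (sqrt (1 / (2 * c))))" using assms by (intro integrable_normal_density) simp
  then have "integrable lborel (\<lambda>s. sqrt (2 * pi * (1 / (2 * c))) * normal_density 0 (sqrt (1 / (2 * c))) s)"
    by (rule integrable_mult_right)
  also have "(\<lambda>s. sqrt (2 * pi * (1 / (2 * c))) * normal_density 0 (sqrt (1 / (2 * c))) s) = (\<lambda>s. exp (- (c * s\<^sup>2)))"
    using assms by (auto simp: normal_density_def field_simps)
  finally show ?thesis .
qed

lemma exp_gauss_complex:
  fixes s y t :: real
  assumes "t > 0"
  shows "exp (- ((Complex s y)\<^sup>2 / (2 * of_real t))) =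
     of_real (exp ((y\<^sup>2 - s\<^sup>2) / (2 * t))) * exp (- (\<i> * of_real (s * y / t)))"
    and "norm (exp (- ((Complex s y)\<^sup>2 / (2 * of_real t)))) = exp ((y\<^sup>2 - s\<^sup>2) / (2 * t))"
proof -
  have "- ((Complex s y)\<^sup>2 / (2 * of_real t)) = of_real ((y\<^sup>2 - s\<^sup>2) / (2 * t)) + - (\<i> * of_real (s * y / t))"
    using assms by (simp add: complex_eq_iff power2_eq_square Re_divide Im_divide field_simps)
  then show 1: "exp (- ((Complex s y)\<^sup>2 / (2 * of_real t))) =
     of_real (exp ((y\<^sup>2 - s\<^sup>2) / (2 * t))) * exp (- (\<i> * of_real (s * y / t)))"
    by (simp only: exp_add exp_of_real)
  show "norm (exp (- ((Complex s y)\<^sup>2 / (2 * of_real t)))) = exp ((y\<^sup>2 - s\<^sup>2) / (2 * t))"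
    unfolding 1 norm_mult by simp
qed

text \<open>
  Subtracting the residue makes \<open>(exp (- z\<^sup>2 / (2 * t)) - exp (- \<delta>\<^sup>2 / (2 * t))) * coth ((z + \<delta>) / 2)\<close>
  holomorphic in the strip \<open>\<bar>Im z\<bar> < 2 * pi\<close>; the difference of its integrals along \<open>Im z = pi\<close> and \<open>Im z = - pi\<close>
  is read off from a primitive, and there \<open>coth\<close> becomes \<open>tanh\<close>.
\<close>

lemma tanh_gauss_integral:
  fixes t \<delta> :: real
  assumes t: "t > 0"
  defines "r \<equiv> \<lambda>s. exp (- s\<^sup>2 / (2 * t)) * sin (pi * s / t) * tanh ((s + \<delta>) / 2)"
  shows "integrable lborel r"
    and "(LBINT s. r s) = 2 * pi * exp (- pi\<^sup>2 / (2 * t)) * exp (- \<delta>\<^sup>2 / (2 * t))"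
proof -
  have tanh_cont: "isCont (tanh :: real \<Rightarrow> real) x" for x
    by (intro continuous_intros) simp_all
  have rc: "isCont r x" for x
    unfolding r_def using t by (intro continuous_intros isCont_o2[OF _ tanh_cont]) auto
  have rm: "r \<in> borel_measurable borel"
    by (intro borel_measurable_continuous_onI continuous_at_imp_continuous_on ballI rc)
  show ri: "integrable lborel r"
  proof (rule Bochner_Integration.integrable_bound)
    show "integrable lborel (\<lambda>s. exp (- (1 / (2 * t) * s\<^sup>2)))" by (rule integrable_exp_sq) (use t in simp)
    show "r \<in> borel_measurable lborel" using rm by simp
    have "norm (r s) \<le> norm (exp (- (1 / (2 * t) * s\<^sup>2)))" for s
    proof -
      have "\<bar>tanh ((s + \<delta>) / 2)\<bar> \<le> 1" using tanh_real_bounds[of "(s + \<delta>) / 2"] by auto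
      then have "\<bar>sin (pi * s / t) * tanh ((s + \<delta>) / 2)\<bar> \<le> 1"
        unfolding abs_mult by (intro mult_le_one) auto
      then have "exp (- s\<^sup>2 / (2 * t)) * \<bar>sin (pi * s / t) * tanh ((s + \<delta>) / 2)\<bar> \<le> exp (- s\<^sup>2 / (2 * t)) * 1"
        by (intro mult_left_mono) auto
      then show ?thesis by (simp add: r_def abs_mult mult.assoc)
    qed
    then show "AE s in lborel. norm (r s) \<le> norm (exp (- (1 / (2 * t) * s\<^sup>2)))" by simp
  qed
  define E where "E z = exp (- (z\<^sup>2 / (2 * of_real t)))" for z :: complex
  define e0 where "e0 = exp (- \<delta>\<^sup>2 / (2 * t))"
  define a where "a = complex_of_real (- \<delta>)"
  define N where "N z = E z - of_real e0" for z
  define S where "S = {z. \<bar>Im z\<bar> < 2 * pi}"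
  have Sopen: "open S" unfolding S_def by (intro open_Collect_less continuous_intros)
  have Sconv: "convex S"
  proof -
    have "S = {z. Im z < 2 * pi} \<inter> {z. Im z > - (2 * pi)}" by (auto simp: S_def)
    then show ?thesis by (simp add: convex_Int convex_halfspace_Im_lt convex_halfspace_Im_gt)
  qed
  define q where "q z = sinh ((z - a) / 2)" for z
  \<comment> \<open>Numerator and denominator are both divided by \<open>z - a\<close>. The
    difference quotients are entire, and \<open>p2\<close> has no zero in the strip, so
    \<open>f0\<close> continues the quotient across the cancelled pole \<open>a\<close>.\<close>
  define p1 where "p1 z = (if z = a then deriv N a else (N z - N a) / (z - a))" for z
  define p2 where "p2 z = (if z = a then deriv q a else (q z - q a) / (z - a))" for z
  have Na: "N a = 0" by (simp add: N_def E_def a_def e0_def flip: exp_of_real)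
  have qa: "q a = 0" by (simp add: q_def)
  have t0: "complex_of_real t \<noteq> 0" using t by simp
  have "N holomorphic_on UNIV" unfolding N_def E_def by (intro holomorphic_intros) (use t0 in auto)
  then have p1h: "p1 holomorphic_on UNIV" unfolding p1_def by (rule pole_lemma) simp
  have "q holomorphic_on UNIV" unfolding q_def sinh_field_def by (intro holomorphic_intros) auto
  then have p2h: "p2 holomorphic_on UNIV" unfolding p2_def by (rule pole_lemma) simp
  have dq: "deriv q a = 1 / 2"
    unfolding q_def by (rule DERIV_imp_deriv) (auto intro!: derivative_eq_intros)
  have qnz: "q z \<noteq> 0" if "z \<in> S" "z \<noteq> a" for z
  proof
    assume "q z = 0"
    have "(z - a) / 2 = 0"
      by (rule complex_sinh_eq_0_strip) (use \<open>q z = 0\<close> that(1) in \<open>auto simp: q_def S_def a_def\<close>)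
    then show False using that by simp
  qed
  have p2nz: "p2 z \<noteq> 0" if "z \<in> S" for z
    using qnz[OF that] dq qa by (auto simp: p2_def)
  define f0 where "f0 z = p1 z / p2 z * cosh ((z - a) / 2)" for z
  have f0h: "f0 holomorphic_on S"
    unfolding f0_def cosh_field_def
    by (intro holomorphic_intros holomorphic_on_subset[OF p1h] holomorphic_on_subset[OF p2h]) (use p2nz in auto)
  have f0eq: "f0 z = N z * (cosh ((z - a) / 2) / sinh ((z - a) / 2))" if "z \<noteq> a" for z
    using that Na qa by (simp add: f0_def p1_def p2_def q_def)
  obtain G where G: "\<And>z. z \<in> S \<Longrightarrow> (G has_field_derivative f0 z) (at z within S)"
    using holomorphic_convex_primitive'[OF Sconv Sopen f0h] by blast
  have G': "(G has_field_derivative f0 z) (at z)" if "z \<in> S" for z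
    using G[OF that] at_within_open[OF that Sopen] by simp
  have pi_S: "Complex x pi \<in> S" "Complex x (- pi) \<in> S" for x by (auto simp: S_def)
  define K where "K x = G (Complex x pi) - G (Complex x (- pi))" for x
  define k where "k x = f0 (Complex x pi) - f0 (Complex x (- pi))" for x
  have dK: "(K has_vector_derivative k x) (at x)" for x
  proof -
    have dG: "((\<lambda>x. G (Complex x y)) has_vector_derivative f0 (Complex x y)) (at x)" if "Complex x y \<in> S" for y
    proof -
      have "((\<lambda>x. Complex x y) has_vector_derivative 1) (at x)"
        unfolding Complex_eq has_vector_derivative_def
        by (auto intro!: derivative_eq_intros simp: scaleR_conv_of_real)
      from field_vector_diff_chain_at[OF this G'[OF that]] show ?thesis by (simp add: o_def)
    qed
    show ?thesis unfolding K_def k_def by (intro has_vector_derivative_diff dG pi_S)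
  qed
  \<comment> \<open>The lines \<open>Im z = pi\<close> and \<open>Im z = - pi\<close> carry the same
    factor tanh, so the constant \<open>e0\<close> cancels and the two Gaussian phases leave a
    sine.\<close>
  have keq: "k x = - (2 * \<i> * of_real (exp (pi\<^sup>2 / (2 * t)) * r x))" for x
  proof -
    have na: "Complex x pi \<noteq> a" "Complex x (- pi) \<noteq> a" by (auto simp: a_def complex_eq_iff)
    have h: "(Complex x pi - a) / 2 = Complex ((x + \<delta>) / 2) (pi / 2)" "(Complex x (- pi) - a) / 2 = Complex ((x + \<delta>) / 2) (- (pi / 2))"
      by (auto simp: a_def complex_eq_iff)
    have "f0 (Complex x pi) = N (Complex x pi) * of_real (tanh ((x + \<delta>) / 2))"
      "f0 (Complex x (- pi)) = N (Complex x (- pi)) * of_real (tanh ((x + \<delta>) / 2))"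
      unfolding f0eq[OF na(1)] f0eq[OF na(2)] h cosh_sinh_half_pi by (simp_all add: tanh_def)
    then have "k x = (E (Complex x pi) - E (Complex x (- pi))) * of_real (tanh ((x + \<delta>) / 2))"
      unfolding k_def N_def by (simp only: left_diff_distrib) simp
    also have "E (Complex x pi) - E (Complex x (- pi)) = of_real (exp ((pi\<^sup>2 - x\<^sup>2) / (2 * t))) *
        (exp (- (\<i> * of_real (x * pi / t))) - exp (\<i> * of_real (x * pi / t)))"
      unfolding E_def exp_gauss_complex(1)[OF t] by (simp add: algebra_simps)
    also have "exp (- (\<i> * of_real (x * pi / t))) - exp (\<i> * of_real (x * pi / t)) = - (2 * \<i> * of_real (sin (x * pi / t)))"
      by (simp add: sin_exp_eq' flip: sin_of_real)
    also have "exp ((pi\<^sup>2 - x\<^sup>2) / (2 * t)) = exp (pi\<^sup>2 / (2 * t)) * exp (- x\<^sup>2 / (2 * t))"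
      by (simp add: exp_add[symmetric] diff_divide_distrib)
    finally show ?thesis by (simp add: r_def mult_ac)
  qed
  define b where "b x = exp (- x) / sinh x" for x :: real
  define U where "U x d = exp ((pi\<^sup>2 - x\<^sup>2) / (2 * t)) * (1 + b ((x + d) / 2)) + e0 * b ((x + d) / 2)" for x d
  have U0: "((\<lambda>x. U x d) \<longlongrightarrow> 0) at_top" for d
    unfolding U_def b_def using t by real_asymp
  have En: "norm (E (Complex x y)) \<le> exp ((pi\<^sup>2 - x\<^sup>2) / (2 * t))" if "\<bar>y\<bar> \<le> pi" for x y
  proof -
    have "y\<^sup>2 \<le> pi\<^sup>2" using that by (simp add: abs_le_square_iff[symmetric])
    then show ?thesis unfolding E_def exp_gauss_complex(2)[OF t] using t by (simp add: divide_right_mono)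
  qed
  \<comment> \<open>Mean value inequality for \<open>G z - c * z\<close> on a vertical segment of
    length \<open>2 * pi\<close>: where \<open>f0\<close> is close to \<open>c\<close>,
    \<open>K x\<close> is close to \<open>c * (2 * pi * \<i>)\<close>.\<close>
  have seg: "norm (K x - c * (2 * pi * \<i>)) \<le> B * (2 * pi)"
    if B: "\<And>y. \<bar>y\<bar> \<le> pi \<Longrightarrow> norm (f0 (Complex x y) - c) \<le> B" for x c B
  proof -
    define T where "T = {z. Re z \<le> x} \<inter> {z. Re z \<ge> x} \<inter> {z. Im z \<le> pi} \<inter> {z. Im z \<ge> - pi}"
    have Tc: "convex T" unfolding T_def
      by (intro convex_Int convex_halfspace_Im_le convex_halfspace_Im_ge convex_halfspace_Re_le convex_halfspace_Re_ge)
    have TS: "z \<in> S \<and> \<bar>Im z\<bar> \<le> pi \<and> z = Complex x (Im z)" if "z \<in> T" for z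
    proof -
      have "\<bar>Im z\<bar> \<le> pi" "Re z = x" using that by (auto simp: T_def abs_le_iff)
      moreover have "\<bar>Im z\<bar> < 2 * pi" using calculation(1) pi_gt_zero by linarith
      ultimately show ?thesis by (auto simp: S_def complex_eq_iff)
    qed
    have "norm ((G (Complex x pi) - c * Complex x pi) - (G (Complex x (- pi)) - c * Complex x (- pi)))
        \<le> B * norm (Complex x pi - Complex x (- pi))"
    proof (rule field_differentiable_bound[OF Tc, where f' = "\<lambda>z. f0 z - c"])
      fix z assume z: "z \<in> T"
      show "((\<lambda>z. G z - c * z) has_field_derivative f0 z - c) (at z within T)"
        using TS[OF z] by (auto intro!: derivative_eq_intros DERIV_subset[OF G'])
      show "norm (f0 z - c) \<le> B" using TS[OF z] B[of "Im z"] by metis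
    qed (auto simp: T_def)
    also have "Complex x pi - Complex x (- pi) = 2 * pi * \<i>" by (simp add: complex_eq_iff)
    also have "(G (Complex x pi) - c * Complex x pi) - (G (Complex x (- pi)) - c * Complex x (- pi))
        = K x - c * (Complex x pi - Complex x (- pi))" by (simp add: K_def algebra_simps)
    also have "Complex x pi - Complex x (- pi) = 2 * pi * \<i>" by (simp add: complex_eq_iff)
    finally show ?thesis by (simp add: norm_mult)
  qed
  have wRe: "Re ((Complex x y - a) / 2) = (x + \<delta>) / 2" for x y by (simp add: a_def)
  have K_top: "norm (K x - (- of_real e0) * (2 * pi * \<i>)) \<le> U x \<delta> * (2 * pi)" if "x > \<bar>\<delta>\<bar>" for x
  proof (rule seg)
    fix y assume y: "\<bar>y\<bar> \<le> pi"
    have "Complex x y \<noteq> a" using that by (auto simp: a_def complex_eq_iff)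
    then have "f0 (Complex x y) - (- of_real e0) = (E (Complex x y) - of_real e0) * (cosh ((Complex x y - a) / 2) / sinh ((Complex x y - a) / 2)) + of_real e0"
      by (simp add: f0eq N_def)
    then show "norm (f0 (Complex x y) - (- of_real e0)) \<le> U x \<delta>"
      using coth_gauss_bound[of "(Complex x y - a) / 2" "E (Complex x y)" "exp ((pi\<^sup>2 - x\<^sup>2) / (2 * t))" e0] En[OF y, of x] that
      unfolding wRe U_def b_def by (simp add: e0_def)
  qed
  \<comment> \<open>coth is odd, so on the left \<open>f0\<close> tends to \<open>e0\<close> instead
    of \<open>- e0\<close>. Negating the half-argument gives the same bound with
    \<open>- \<delta>\<close>.\<close>
  have K_bot: "norm (K (- x) - of_real e0 * (2 * pi * \<i>)) \<le> U x (- \<delta>) * (2 * pi)" if "x > \<bar>\<delta>\<bar>" for x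
  proof (rule seg)
    fix y assume y: "\<bar>y\<bar> \<le> pi"
    define w where "w = - ((Complex (- x) y - a) / 2)"
    have Rw: "Re w = (x + - \<delta>) / 2" by (simp add: w_def a_def field_simps)
    have "Complex (- x) y \<noteq> a" using that by (auto simp: a_def complex_eq_iff)
    then have "f0 (Complex (- x) y) - of_real e0 = N (Complex (- x) y) * (cosh (- w) / sinh (- w)) - of_real e0"
      by (simp add: f0eq w_def)
    also have "\<dots> = - ((E (Complex (- x) y) - of_real e0) * (cosh w / sinh w) + of_real e0)"
      by (simp add: N_def algebra_simps)
    finally have "norm (f0 (Complex (- x) y) - of_real e0) = norm ((E (Complex (- x) y) - of_real e0) * (cosh w / sinh w) + of_real e0)"
      by (simp only: norm_minus_cancel)
    then show "norm (f0 (Complex (- x) y) - of_real e0) \<le> U x (- \<delta>)"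
      using coth_gauss_bound[of w "E (Complex (- x) y)" "exp ((pi\<^sup>2 - x\<^sup>2) / (2 * t))" e0] En[OF y, of "- x"] that
      unfolding Rw U_def b_def by (simp add: e0_def)
  qed
  have Ktop: "(K \<longlongrightarrow> (- of_real e0) * (2 * pi * \<i>)) at_top"
  proof -
    have "((\<lambda>x. U x \<delta> * (2 * pi)) \<longlongrightarrow> 0 * (2 * pi)) at_top" by (intro tendsto_intros U0)
    then have l: "((\<lambda>x. U x \<delta> * (2 * pi)) \<longlongrightarrow> 0) at_top" by simp
    have "eventually (\<lambda>x. norm (K x - (- of_real e0) * (2 * pi * \<i>)) \<le> U x \<delta> * (2 * pi)) at_top"
      using eventually_gt_at_top[of "\<bar>\<delta>\<bar>"] by eventually_elim (rule K_top)
    then have "((\<lambda>x. K x - (- of_real e0) * (2 * pi * \<i>)) \<longlongrightarrow> 0) at_top"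
      using l by (rule Lim_null_comparison)
    then show ?thesis by (rule LIM_zero_cancel)
  qed
  have Kbot: "(K \<longlongrightarrow> of_real e0 * (2 * pi * \<i>)) at_bot"
  proof -
    have "((\<lambda>x. U x (- \<delta>) * (2 * pi)) \<longlongrightarrow> 0 * (2 * pi)) at_top" by (intro tendsto_intros U0)
    then have l: "((\<lambda>x. U x (- \<delta>) * (2 * pi)) \<longlongrightarrow> 0) at_top" by simp
    have "eventually (\<lambda>x. norm (K (- x) - of_real e0 * (2 * pi * \<i>)) \<le> U x (- \<delta>) * (2 * pi)) at_top"
      using eventually_gt_at_top[of "\<bar>\<delta>\<bar>"] by eventually_elim (rule K_bot)
    then have "((\<lambda>x. K (- x) - of_real e0 * (2 * pi * \<i>)) \<longlongrightarrow> 0) at_top"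
      using l by (rule Lim_null_comparison)
    then have "((\<lambda>x. K (- x)) \<longlongrightarrow> of_real e0 * (2 * pi * \<i>)) at_top" by (rule LIM_zero_cancel)
    then show ?thesis by (simp add: filterlim_at_bot_mirror)
  qed
  have ki: "integrable lborel k"
    unfolding keq[abs_def] by (intro integrable_minus integrable_mult_right integrable_of_real ri)
  have kc: "isCont k x" for x
    unfolding keq[abs_def] by (intro continuous_intros rc)
  have "(LBINT x=-\<infinity>..\<infinity>. k x) = (- of_real e0) * (2 * pi * \<i>) - of_real e0 * (2 * pi * \<i>)"
  proof (rule interval_integral_FTC_integrable)
    show "(K has_vector_derivative k x) (at x)" for x by (rule dK)
    show "isCont k x" for x by (rule kc)
    show "set_integrable lborel (einterval (- \<infinity>) \<infinity>) k"
      using ki by (simp add: set_integrable_def einterval_eq)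
  qed (use Ktop Kbot in \<open>simp_all add: ereal_tendsto_simps\<close>)
  then have "(LBINT x. k x) = - (4 * pi * \<i> * of_real e0)"
    by (simp add: interval_lebesgue_integral_def einterval_eq set_lebesgue_integral_def)
  also have "(LBINT x. k x) = - (2 * \<i> * of_real (exp (pi\<^sup>2 / (2 * t)) * (LBINT x. r x)))"
    unfolding keq[abs_def] by simp
  finally have "2 * \<i> * of_real (exp (pi\<^sup>2 / (2 * t)) * (LBINT x. r x)) = 2 * \<i> * of_real (2 * pi * e0)"
    by (simp add: mult_ac)
  then have "exp (pi\<^sup>2 / (2 * t)) * (LBINT x. r x) = 2 * pi * e0"
    by (metis complex_i_not_zero mult_cancel_left of_real_eq_iff zero_neq_numeral mult_eq_0_iff)
  then show "(LBINT s. r s) = 2 * pi * exp (- pi\<^sup>2 / (2 * t)) * exp (- \<delta>\<^sup>2 / (2 * t))"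
    by (simp add: e0_def exp_minus field_simps)
qed

subsection \<open>The kernel of the joint density and its transform\<close>

text \<open>\<open>2 * pi * kappa t s\<close> is the imaginary part of
  \<open>exp (- z\<^sup>2 / (2 * t)) * sinh z\<close> at \<open>z = s + \<i> * pi\<close>. With this
  constant, \<open>Theta t q\<close> will be exactly the contour integral divided by
  \<open>2 * pi * \<i>\<close>.\<close>

definition kappa :: "real \<Rightarrow> real \<Rightarrow> real" where
  "kappa t s = exp (pi\<^sup>2 / (2 * t)) / (2 * pi) * exp (- s\<^sup>2 / (2 * t)) * sinh s * sin (pi * s / t)"

text \<open>
  Up to elementary factors \<open>Theta t q\<close> is the Hartman--Watson density, in Yor's integral form.
\<close>

definition Theta :: "real \<Rightarrow> real \<Rightarrow> real" where
  "Theta t q = (LBINT s. kappa t s * exp (- q * cosh s))"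

lemma kappa_measurable[measurable]: "kappa t \<in> borel_measurable borel"
  unfolding kappa_def by measurable

lemma cosh_le_exp_abs: "cosh (x::real) \<le> exp \<bar>x\<bar>"
  by (auto simp: cosh_field_def abs_if)

text \<open>From \<open>(\<bar>s\<bar> - 2 * t)\<^sup>2 \<ge> 0\<close>: half of the Gaussian
  exponent absorbs the growth of cosh.\<close>

lemma cosh_gauss_le:
  fixes s t :: real
  assumes "t > 0"
  shows "exp (- s\<^sup>2 / (2 * t)) * cosh s \<le> exp t * exp (- (1 / (4 * t) * s\<^sup>2))"
proof -
  have "0 \<le> (\<bar>s\<bar> - 2 * t)\<^sup>2 / (4 * t)" using assms by simp
  also have "\<dots> = s\<^sup>2 / (4 * t) - \<bar>s\<bar> + t" using assms by (simp add: field_simps power2_eq_square)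
  finally have *: "\<bar>s\<bar> \<le> s\<^sup>2 / (4 * t) + t" by simp
  have "exp (- s\<^sup>2 / (2 * t)) * cosh s \<le> exp (- s\<^sup>2 / (2 * t)) * exp \<bar>s\<bar>"
    by (intro mult_left_mono cosh_le_exp_abs) auto
  also have "\<dots> = exp (- s\<^sup>2 / (2 * t) + \<bar>s\<bar>)" by (rule exp_add[symmetric])
  also have "\<dots> \<le> exp (t + - (1 / (4 * t) * s\<^sup>2))"
  proof -
    have "s\<^sup>2 / (2 * t) = 2 * (s\<^sup>2 / (4 * t))" by simp
    then show ?thesis using * by simp
  qed
  finally show ?thesis by (simp only: exp_add)
qed

lemma kappa_bound:
  assumes "t > 0"
  shows "\<bar>kappa t s\<bar> \<le> exp (pi\<^sup>2 / (2 * t)) / (2 * pi) * exp t * exp (- (1 / (4 * t) * s\<^sup>2))"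
proof -
  have "\<bar>sinh s\<bar> * \<bar>sin (pi * s / t)\<bar> \<le> cosh s * 1"
    by (intro mult_mono abs_sinh_le_cosh) auto
  then have "exp (- s\<^sup>2 / (2 * t)) * (\<bar>sinh s\<bar> * \<bar>sin (pi * s / t)\<bar>) \<le> exp (- s\<^sup>2 / (2 * t)) * cosh s"
    by (intro mult_left_mono) auto
  also have "\<dots> \<le> exp t * exp (- (1 / (4 * t) * s\<^sup>2))" by (rule cosh_gauss_le) fact
  finally have "exp (pi\<^sup>2 / (2 * t)) / (2 * pi) * (exp (- s\<^sup>2 / (2 * t)) * (\<bar>sinh s\<bar> * \<bar>sin (pi * s / t)\<bar>))
      \<le> exp (pi\<^sup>2 / (2 * t)) / (2 * pi) * (exp t * exp (- (1 / (4 * t) * s\<^sup>2)))"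
    by (intro mult_left_mono) auto
  then show ?thesis by (simp add: kappa_def abs_mult mult.assoc)
qed

lemma kappa_integrable:
  assumes t: "t > 0" shows "integrable lborel (kappa t)"
proof (rule Bochner_Integration.integrable_bound)
  show "integrable lborel (\<lambda>s. exp (pi\<^sup>2 / (2 * t)) / (2 * pi) * exp t * exp (- (1 / (4 * t) * s\<^sup>2)))"
    by (rule integrable_mult_right, rule integrable_exp_sq) (use t in simp)
  show "AE s in lborel. norm (kappa t s) \<le> norm (exp (pi\<^sup>2 / (2 * t)) / (2 * pi) * exp t * exp (- (1 / (4 * t) * s\<^sup>2)))"
    using kappa_bound[OF t] by (intro AE_I2) (simp only: real_norm_def abs_mult abs_exp_cancel abs_divide, simp)
qed measurable

lemma kappa_exp_integrable:
  assumes "t > 0" "q \<ge> 0"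
  shows "integrable lborel (\<lambda>s. kappa t s * exp (- q * cosh s))"
proof (rule Bochner_Integration.integrable_bound[OF kappa_integrable[OF assms(1)]])
  have "exp (- q * cosh s) \<le> 1" for s using assms by simp
  then show "AE s in lborel. norm (kappa t s * exp (- q * cosh s)) \<le> norm (kappa t s)"
    by (auto simp: abs_mult mult_left_le)
qed measurable

lemma Theta_measurable[measurable]: "Theta t \<in> borel_measurable borel"
  unfolding Theta_def by (rule lborel.borel_measurable_lebesgue_integral) measurable

text \<open>The decay in \<open>q\<close> comes from \<open>cosh s \<ge> 1\<close>; it dominates the
  q-integrals in \<open>hdens_laplace\<close>.\<close>

lemma Theta_bound:
  assumes t: "t > 0" and q: "q \<ge> 0"
  shows "\<bar>Theta t q\<bar> \<le> (LBINT s. \<bar>kappa t s\<bar>) * exp (- q)"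
proof -
  have "\<bar>Theta t q\<bar> \<le> (LBINT s. \<bar>kappa t s * exp (- q * cosh s)\<bar>)"
    unfolding Theta_def by (rule integral_abs_bound)
  also have "\<dots> \<le> (LBINT s. \<bar>kappa t s\<bar> * exp (- q))"
  proof (rule integral_mono)
    show "integrable lborel (\<lambda>s. \<bar>kappa t s * exp (- q * cosh s)\<bar>)"
      by (intro integrable_abs kappa_exp_integrable t q)
    show "integrable lborel (\<lambda>s. \<bar>kappa t s\<bar> * exp (- q))"
      by (intro integrable_mult_left integrable_abs kappa_integrable t)
    fix s
    have "q * 1 \<le> q * cosh s" using q cosh_real_ge_1[of s] by (intro mult_left_mono)
    then show "\<bar>kappa t s * exp (- q * cosh s)\<bar> \<le> \<bar>kappa t s\<bar> * exp (- q)"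
      by (simp add: abs_mult mult_left_mono)
  qed
  finally show ?thesis by simp
qed

lemma Theta_continuous:
  assumes t: "t > 0"
  shows "continuous_on {0..} (Theta t)"
  unfolding continuous_on_sequentially
proof (intro ballI allI impI, elim conjE)
  fix q x assume q: "q \<in> {0..}" and x: "\<forall>n. (x n :: real) \<in> {0..}" "x \<longlonglongrightarrow> q"
  show "(Theta t \<circ> x) \<longlonglongrightarrow> Theta t q"
    unfolding o_def Theta_def
  proof (rule integral_dominated_convergence[where w = "\<lambda>s. \<bar>kappa t s\<bar>"])
    show "integrable lborel (\<lambda>s. \<bar>kappa t s\<bar>)" by (intro integrable_abs kappa_integrable t)
    show "AE s in lborel. (\<lambda>i. kappa t s * exp (- x i * cosh s)) \<longlonglongrightarrow> kappa t s * exp (- q * cosh s)"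
      by (intro AE_I2 tendsto_intros x)
    fix i
    have "exp (- x i * cosh s) \<le> 1" for s using x(1) by (auto intro!: mult_nonneg_nonneg)
    then show "AE s in lborel. norm (kappa t s * exp (- x i * cosh s)) \<le> \<bar>kappa t s\<bar>"
      by (auto simp: abs_mult mult_left_le)
  qed measurable
qed

text \<open>\<open>sinh s / (cosh s + cosh \<delta>)\<close> is half the sum of tanh at
  \<open>(s + \<delta>) / 2\<close> and at \<open>(s - \<delta>) / 2\<close>. So
  \<open>tanh_gauss_integral\<close> is applied for \<open>\<delta>\<close> and
  \<open>- \<delta>\<close>, and the normalisation of \<open>kappa\<close> cancels the common
  factor.\<close>

lemma kappa_cosh_integral:
  assumes t: "t > 0"
  shows "(LBINT s. kappa t s / (cosh s + cosh \<delta>)) = exp (- \<delta>\<^sup>2 / (2 * t))"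
proof -
  define r where "r \<delta> s = exp (- s\<^sup>2 / (2 * t)) * sin (pi * s / t) * tanh ((s + \<delta>) / 2)" for \<delta> s
  note r = tanh_gauss_integral[OF t, folded r_def]
  have "kappa t s / (cosh s + cosh \<delta>) = exp (pi\<^sup>2 / (2 * t)) / (4 * pi) * (r \<delta> s + r (- \<delta>) s)" for s
  proof -
    define A where "A = (s + \<delta>) / 2"
    define B where "B = (s - \<delta>) / 2"
    have s: "s = A + B" "\<delta> = A - B" by (auto simp: A_def B_def field_simps)
    have "sinh s / (cosh s + cosh \<delta>) = (tanh A + tanh B) / 2"
      unfolding s tanh_def sinh_add cosh_add cosh_diff by (simp add: field_simps)
    then have tt: "sinh s / (cosh s + cosh \<delta>) = (tanh A + tanh B) / 2" .
    have "kappa t s / (cosh s + cosh \<delta>) = exp (pi\<^sup>2 / (2 * t)) / (2 * pi) * (exp (- s\<^sup>2 / (2 * t)) * sin (pi * s / t)) * (sinh s / (cosh s + cosh \<delta>))"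
      by (simp add: kappa_def)
    also have "\<dots> = exp (pi\<^sup>2 / (2 * t)) / (2 * pi) * (exp (- s\<^sup>2 / (2 * t)) * sin (pi * s / t)) * ((tanh A + tanh B) / 2)"
      by (simp only: tt)
    finally show ?thesis by (simp add: r_def A_def B_def algebra_simps add_divide_distrib)
  qed
  then have "(LBINT s. kappa t s / (cosh s + cosh \<delta>)) = exp (pi\<^sup>2 / (2 * t)) / (4 * pi) * ((LBINT s. r \<delta> s) + (LBINT s. r (- \<delta>) s))"
    using r(1)[of \<delta>] r(1)[of "- \<delta>"] by simp
  also have "\<dots> = exp (- \<delta>\<^sup>2 / (2 * t))"
    unfolding r(2) by (simp add: exp_minus field_simps)
  finally show ?thesis .
qed

lemma integral_exp_Ioi:
  fixes k :: real
  assumes k: "k > 0"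
  shows "integrable lborel (\<lambda>q. indicator {0<..} q * exp (- (k * q)))"
    and "(LBINT q. indicator {0<..} q * exp (- (k * q))) = 1 / k"
proof -
  have "has_bochner_integral lborel (\<lambda>x. indicator {0<..} x * exp (- x)) (1::real)"
    using has_bochner_integral_I0i_power_exp_m[of 0] by (simp add: mult.commute)
  then have 1: "has_bochner_integral lborel (\<lambda>q. indicator {0<..} (0 + k * q) * exp (- (0 + k * q))) (1 / k)"
    using lborel_has_bochner_integral_real_affine_iff[of k "\<lambda>x. indicator {0<..} x * exp (- x)" 1 0] k
    by (simp add: field_simps)
  moreover have "indicator {0<..} (0 + k * q) = (indicator {0<..} q :: real)" for q
    using k by (auto simp: indicator_def zero_less_mult_iff)
  ultimately have "has_bochner_integral lborel (\<lambda>q. indicator {0<..} q * exp (- (k * q))) (1 / k)" by simp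
  then show "integrable lborel (\<lambda>q. indicator {0<..} q * exp (- (k * q)))"
    and "(LBINT q. indicator {0<..} q * exp (- (k * q))) = 1 / k"
    by (auto simp: has_bochner_integral_iff)
qed

abbreviation lborel2 :: "(real \<times> real) measure" where
  "lborel2 \<equiv> lborel \<Otimes>\<^sub>M lborel"

lemma integrable_prod_bound:
  fixes f :: "real \<times> real \<Rightarrow> real" and g k :: "real \<Rightarrow> real"
  assumes f[measurable]: "f \<in> borel_measurable lborel2"
    and g: "integrable lborel g" and k: "integrable lborel k"
    and b: "\<And>x y. \<bar>f (x, y)\<bar> \<le> g x * k y"
  shows "integrable lborel2 f"
proof (rule Bochner_Integration.integrable_bound)
  note [measurable] = borel_measurable_integrable[OF g] borel_measurable_integrable[OF k]
  show "integrable lborel2 (\<lambda>(x, y). g x * k y)"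
  proof (rule lborel_pair.Fubini_integrable)
    show "integrable lborel (\<lambda>x. LBINT y. norm (case (x, y) of (x, y) \<Rightarrow> g x * k y))"
      using g by (simp add: abs_mult)
    show "AE x in lborel. integrable lborel (\<lambda>y. case (x, y) of (x, y) \<Rightarrow> g x * k y)"
      using k by simp
  qed measurable
  show "AE p in lborel2. norm (f p) \<le> norm (case p of (x, y) \<Rightarrow> g x * k y)"
    using b by (auto intro!: AE_I2 order_trans[OF b])
qed (rule f)

lemma integrable_exp_cosh:
  fixes a :: real assumes "a > 0" shows "integrable lborel (\<lambda>x. exp (- (a * cosh x)))"
proof (rule Bochner_Integration.integrable_bound)
  show "integrable lborel (\<lambda>x. exp (- (a / 4 * x\<^sup>2)))" by (rule integrable_exp_sq) (use assms in simp)
  have "x\<^sup>2 / 4 \<le> cosh x" for x :: real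
  proof -
    have "1 + \<bar>x\<bar> + \<bar>x\<bar>\<^sup>2 / 2 \<le> exp \<bar>x\<bar>" by (rule exp_lower_Taylor_quadratic) simp
    moreover have "exp \<bar>x\<bar> / 2 \<le> cosh x" by (auto simp: cosh_field_def abs_if)
    ultimately show ?thesis by simp
  qed
  then have "a / 4 * x\<^sup>2 \<le> a * cosh x" for x using assms mult_left_mono[of "x\<^sup>2 / 4" "cosh x" a] by simp
  then show "AE x in lborel. norm (exp (- (a * cosh x))) \<le> norm (exp (- (a / 4 * x\<^sup>2)))" by simp
qed measurable

text \<open>
  Translate by \<open>ln (a + q * exp \<eta>)\<close>: this turns the exponent into the symmetric form on the right.
\<close>

lemma cosh_pair_integral:
  fixes a q \<eta> :: real
  assumes a: "a > 0" and q: "q > 0"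
  shows "(LBINT y. exp (- (exp (- y) / 2) - q\<^sup>2 * exp y / 2 - a * cosh \<eta> * (q * exp y) - a\<^sup>2 / 2 * exp y))
       = (LBINT x. exp (- (a * cosh x) - q * cosh (x - \<eta>)))"
proof -
  define c where "c = a + q * exp \<eta>"
  have c: "c > 0" using a q by (simp add: c_def add_pos_pos)
  define f where "f y = exp (- (exp (- y) / 2) - q\<^sup>2 * exp y / 2 - a * cosh \<eta> * (q * exp y) - a\<^sup>2 / 2 * exp y)" for y
  have "f (- ln c + 1 * x) = exp (- (a * cosh x) - q * cosh (x - \<eta>))" for x
  proof -
    have e1: "exp (- (- ln c + 1 * x)) = exp (- x) * c"
      using c by (simp add: exp_diff exp_minus field_simps)
    have e2: "exp (- ln c + 1 * x) = exp x / c"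
      using c by (simp add: exp_diff exp_add exp_minus field_simps)
    have ee: "exp \<eta> * exp (- \<eta>) = 1" by (simp add: exp_minus)
    \<comment> \<open>The quadratic form splits into conjugate factors. The translation by
      \<open>ln c\<close> moves one of them from the exponential of \<open>y\<close> to that of
      \<open>- y\<close>.\<close>
    have num: "q\<^sup>2 + 2 * a * cosh \<eta> * q + a\<^sup>2 = c * (a + q * exp (- \<eta>))"
    proof -
      have "c * (a + q * exp (- \<eta>)) = a\<^sup>2 + a * q * (exp \<eta> + exp (- \<eta>)) + q\<^sup>2 * (exp \<eta> * exp (- \<eta>))"
        by (simp add: c_def algebra_simps power2_eq_square)
      then show ?thesis by (simp add: ee cosh_field_def algebra_simps)
    qed
    have "- (exp (- (- ln c + 1 * x)) / 2) - q\<^sup>2 * exp (- ln c + 1 * x) / 2 - a * cosh \<eta> * (q * exp (- ln c + 1 * x)) - a\<^sup>2 / 2 * exp (- ln c + 1 * x)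
      = - (exp (- x) * c) / 2 - (exp x / c) * (q\<^sup>2 + 2 * a * cosh \<eta> * q + a\<^sup>2) / 2"
      unfolding e1 e2 by (simp add: algebra_simps)
    also have "\<dots> = - (exp (- x) * c) / 2 - exp x * (a + q * exp (- \<eta>)) / 2"
      unfolding num using c by simp
    also have "\<dots> = - (a * cosh x) - q * cosh (x - \<eta>)"
      by (simp add: c_def cosh_field_def exp_diff exp_minus field_simps)
    finally show ?thesis by (simp only: f_def)
  qed
  then show ?thesis
    using lborel_integral_real_affine[of 1 f "- ln c"] by (simp add: f_def)
qed

text \<open>
  Under the weight \<open>exp (- \<nu> * B t - \<nu>\<^sup>2 * t / 2)\<close> this is the joint density of \<open>(\<rho> / A, ln A)\<close>, where
  \<open>\<rho> = exp (\<nu> * t + B t)\<close>; its sign is only known a posteriori.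
\<close>

definition hdens :: "real \<Rightarrow> real \<Rightarrow> real \<Rightarrow> real" where
  "hdens t q y = indicator {0<..} q * exp (- (exp (- y) / 2) - q\<^sup>2 * exp y / 2) * Theta t q / sqrt (2 * pi * t)"

lemma hdens_measurable[measurable]: "(\<lambda>p. hdens t (fst p) (snd p)) \<in> borel_measurable lborel2"
  unfolding hdens_def by measurable

text \<open>Integrating \<open>q\<close> first gives \<open>1 / (cosh s + cosh \<delta>)\<close>, so
  \<open>kappa_cosh_integral\<close> applies. The Laplace transform of \<open>Theta t\<close> at
  \<open>cosh \<delta>\<close> is thus the unnormalised heat kernel in \<delta>.\<close>

lemma theta_cosh_laplace:
  assumes t: "t > 0"
  shows "(LBINT q. indicator {0<..} q * (exp (- q * cosh \<delta>) * Theta t q)) = exp (- \<delta>\<^sup>2 / (2 * t))"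
proof -
  define f where "f p = indicator {0<..} (fst p) * (kappa t (snd p) * exp (- (fst p) * (cosh (snd p) + cosh \<delta>)))" for p :: "real \<times> real"
  have fi: "integrable lborel2 f"
  proof (rule integrable_prod_bound)
    show "f \<in> borel_measurable lborel2" unfolding f_def by measurable
    show "integrable lborel (\<lambda>q::real. indicator {0<..} q * exp (- (1 * q)))" by (rule integral_exp_Ioi) simp
    show "integrable lborel (\<lambda>s. \<bar>kappa t s\<bar>)" by (intro integrable_abs kappa_integrable t)
    fix q s
    have "exp (- q * (cosh s + cosh \<delta>)) \<le> exp (- (1 * q))" if "q > 0"
      using that mult_left_mono[of 1 "cosh s + cosh \<delta>" q] cosh_real_ge_1[of s] cosh_real_ge_1[of \<delta>] by simp
    then have "\<bar>kappa t s\<bar> * exp (- q * (cosh s + cosh \<delta>)) \<le> \<bar>kappa t s\<bar> * exp (- (1 * q))" if "q > 0"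
      using that by (intro mult_left_mono) auto
    then show "\<bar>f (q, s)\<bar> \<le> indicator {0<..} q * exp (- (1 * q)) * \<bar>kappa t s\<bar>"
      by (cases "q > 0") (simp_all add: f_def abs_mult mult.commute)
  qed
  have "(LBINT q. indicator {0<..} q * (exp (- q * cosh \<delta>) * Theta t q)) = (LBINT q. LBINT s. f (q, s))"
  proof (rule Bochner_Integration.integral_cong[OF refl])
    fix q
    have "(LBINT s. f (q, s)) = (LBINT s. indicator {0<..} q * exp (- q * cosh \<delta>) * (kappa t s * exp (- q * cosh s)))"
    proof (rule Bochner_Integration.integral_cong[OF refl])
      fix s
      have "exp (- q * (cosh s + cosh \<delta>)) = exp (- q * cosh \<delta>) * exp (- q * cosh s)"
        by (simp add: exp_add[symmetric] algebra_simps)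
      then show "f (q, s) = indicator {0<..} q * exp (- q * cosh \<delta>) * (kappa t s * exp (- q * cosh s))"
        by (simp add: f_def)
    qed
    then show "indicator {0<..} q * (exp (- q * cosh \<delta>) * Theta t q) = (LBINT s. f (q, s))"
      unfolding integral_mult_right_zero by (simp add: Theta_def)
  qed
  also have "\<dots> = (LBINT s. LBINT q. f (q, s))"
    using lborel_pair.Fubini_integral[of "\<lambda>q s. f (q, s)"] fi by (simp add: case_prod_beta')
  also have "\<dots> = (LBINT s. kappa t s / (cosh s + cosh \<delta>))"
  proof (rule Bochner_Integration.integral_cong[OF refl])
    fix s
    have c: "cosh s + cosh \<delta> > 0" by (simp add: add_pos_pos)
    have "(LBINT q. f (q, s)) = (LBINT q. kappa t s * (indicator {0<..} q * exp (- ((cosh s + cosh \<delta>) * q))))"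
      by (simp add: f_def algebra_simps)
    then show "(LBINT q. f (q, s)) = kappa t s / (cosh s + cosh \<delta>)"
      unfolding integral_mult_right_zero integral_exp_Ioi(2)[OF c] by simp
  qed
  also have "\<dots> = exp (- \<delta>\<^sup>2 / (2 * t))" by (rule kappa_cosh_integral[OF t])
  finally show ?thesis .
qed

lemma exp_exp_integrable:
  fixes c d :: real assumes "c > 0" "d > 0"
  shows "integrable lborel (\<lambda>y. exp (- (c * exp (- y)) - d * exp y))"
proof (rule Bochner_Integration.integrable_bound)
  define m where "m = min c d"
  have m: "m > 0" "m \<le> c" "m \<le> d" using assms by (auto simp: m_def)
  show "integrable lborel (\<lambda>y. exp (- (m * cosh y)))" by (rule integrable_exp_cosh) fact
  have "m * cosh y \<le> c * exp (- y) + d * exp y" for y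
  proof -
    have "m * cosh y \<le> m * (exp y + exp (- y))" using m by (intro mult_left_mono) (auto simp: cosh_field_def)
    also have "\<dots> \<le> c * exp (- y) + d * exp y"
      unfolding distrib_left using mult_right_mono[OF m(2) exp_ge_zero, of "- y"] mult_right_mono[OF m(3) exp_ge_zero, of y] by linarith
    finally show ?thesis .
  qed
  then have "- (c * exp (- y)) - d * exp y \<le> - (m * cosh y)" for y by (simp add: algebra_simps)
  then show "AE y in lborel. norm (exp (- (c * exp (- y)) - d * exp y)) \<le> norm (exp (- (m * cosh y)))" by simp
qed measurable

text \<open>\<open>cosh_pair_integral\<close> replaces the y-integral by one over x in which
  \<open>q\<close> enters through \<open>exp (- q * cosh (x - \<eta>))\<close>. The q-integral then
  produces the heat kernel at \<open>x - \<eta>\<close>, and what is left is the right-hand side of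
  \<open>feynman_kac_cosh\<close>.\<close>

lemma hdens_laplace:
  fixes a \<eta> t :: real
  assumes t: "t > 0" and a: "a > 0"
  defines "F \<equiv> \<lambda>p. hdens t (fst p) (snd p) * exp (- (a * cosh \<eta> * (fst p * exp (snd p))) - a\<^sup>2 / 2 * exp (snd p))"
  shows "integrable lborel2 F"
    and "integral\<^sup>L lborel2 F = (LINT z|gauss t. exp (- a * cosh (\<eta> + z)))"
proof -
  let ?e = "\<lambda>q y. exp (- (exp (- y) / 2) - q\<^sup>2 * exp y / 2 - a * cosh \<eta> * (q * exp y) - a\<^sup>2 / 2 * exp y)"
  define C where "C = (LBINT s. \<bar>kappa t s\<bar>)"
  have C0: "C \<ge> 0" unfolding C_def by simp
  define sq where "sq = sqrt (2 * pi * t)"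
  have sq: "sq > 0" using t by (simp add: sq_def)
  show Fi: "integrable lborel2 F"
  proof (rule integrable_prod_bound)
    show "F \<in> borel_measurable lborel2" unfolding F_def by measurable
    show "integrable lborel (\<lambda>q::real. C / sq * (indicator {0<..} q * exp (- (1 * q))))"
      by (intro integrable_mult_right integral_exp_Ioi) simp
    show "integrable lborel (\<lambda>y. exp (- (1 / 2 * exp (- y)) - a\<^sup>2 / 2 * exp y))"
      by (rule exp_exp_integrable) (use a in auto)
    fix q y :: real
    show "\<bar>F (q, y)\<bar> \<le> C / sq * (indicator {0<..} q * exp (- (1 * q))) * exp (- (1 / 2 * exp (- y)) - a\<^sup>2 / 2 * exp y)"
    proof (cases "q > 0")
      case True
      have "F (q, y) = Theta t q / sq * ?e q y"
        using True by (simp add: F_def hdens_def sq_def exp_add[symmetric] algebra_simps)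
      also have "\<bar>\<dots>\<bar> = \<bar>Theta t q\<bar> / sq * ?e q y"
        using sq by (simp add: abs_mult)
      also have "\<dots> \<le> (C * exp (- q)) / sq * exp (- (1 / 2 * exp (- y)) - a\<^sup>2 / 2 * exp y)"
      proof (intro mult_mono divide_right_mono)
        show "\<bar>Theta t q\<bar> \<le> C * exp (- q)" unfolding C_def by (rule Theta_bound) (use t True in auto)
        \<comment> \<open>The dropped terms are nonnegative. The one with
          \<open>a\<^sup>2 / 2\<close> is kept for decay as \<open>y\<close> tends to \<infinity>,
          where \<open>exp (- y)\<close> gives none.\<close>
        have "0 \<le> q\<^sup>2 * exp y / 2" "0 \<le> a * cosh \<eta> * (q * exp y)" using a True by auto
        then show "?e q y
            \<le> exp (- (1 / 2 * exp (- y)) - a\<^sup>2 / 2 * exp y)" unfolding exp_le_cancel_iff by linarith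
      qed (use sq C0 in auto)
      finally show ?thesis using True by simp
    qed (simp add: F_def hdens_def)
  qed
  define g where "g p = exp (- (a * cosh (snd p))) * (indicator {0<..} (fst p) * (exp (- (fst p) * cosh (snd p - \<eta>)) * Theta t (fst p)))" for p :: "real \<times> real"
  have gi: "integrable lborel2 g"
  proof (rule integrable_prod_bound)
    show "g \<in> borel_measurable lborel2" unfolding g_def by measurable
    show "integrable lborel (\<lambda>q::real. C * (indicator {0<..} q * exp (- (1 * q))))"
      by (intro integrable_mult_right integral_exp_Ioi) simp
    show "integrable lborel (\<lambda>x. exp (- (a * cosh x)))" by (rule integrable_exp_cosh) fact
    fix q x :: real
    show "\<bar>g (q, x)\<bar> \<le> C * (indicator {0<..} q * exp (- (1 * q))) * exp (- (a * cosh x))"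
    proof (cases "q > 0")
      case True
      have "\<bar>Theta t q\<bar> \<le> C * exp (- q)" unfolding C_def by (rule Theta_bound) (use t True in auto)
      moreover have "exp (- q * cosh (x - \<eta>)) \<le> 1" using True by simp
      ultimately have "exp (- q * cosh (x - \<eta>)) * \<bar>Theta t q\<bar> \<le> 1 * (C * exp (- q))"
        by (intro mult_mono) auto
      then have "exp (- (a * cosh x)) * (exp (- q * cosh (x - \<eta>)) * \<bar>Theta t q\<bar>) \<le> exp (- (a * cosh x)) * (1 * (C * exp (- q)))"
        by (intro mult_left_mono) auto
      then show ?thesis using True by (simp add: g_def abs_mult mult.commute)
    qed (simp add: g_def)
  qed
  have "integral\<^sup>L lborel2 F = (LBINT q. LBINT y. F (q, y))"
    using lborel_pair.integral_fst'[OF Fi] by simp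
  also have "\<dots> = (LBINT q. (LBINT x. g (q, x)) / sq)"
  proof (rule Bochner_Integration.integral_cong[OF refl])
    fix q :: real
    show "(LBINT y. F (q, y)) = (LBINT x. g (q, x)) / sq"
    proof (cases "q > 0")
      case True
      have "(LBINT y. F (q, y)) = (LBINT y. Theta t q / sq * ?e q y)"
        using True by (simp add: F_def hdens_def sq_def exp_add[symmetric] algebra_simps)
      also have "\<dots> = Theta t q / sq * (LBINT x. exp (- (a * cosh x) - q * cosh (x - \<eta>)))"
        unfolding integral_mult_right_zero cosh_pair_integral[OF a True] ..
      also have "\<dots> = (LBINT x. Theta t q * exp (- (a * cosh x) - q * cosh (x - \<eta>))) / sq"
        by simp
      also have "(\<lambda>x. Theta t q * exp (- (a * cosh x) - q * cosh (x - \<eta>))) = (\<lambda>x. g (q, x))"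
        using True by (auto simp: g_def exp_diff exp_minus field_simps)
      finally show ?thesis .
    qed (simp add: F_def hdens_def g_def)
  qed
  also have "\<dots> = (LBINT q. LBINT x. g (q, x)) / sq" by simp
  also have "(LBINT q. LBINT x. g (q, x)) = (LBINT x. LBINT q. g (q, x))"
    using lborel_pair.Fubini_integral[of "\<lambda>q s. g (q, s)"] gi by (simp add: case_prod_beta')
  also have "\<dots> = (LBINT x. exp (- (a * cosh x)) * exp (- (x - \<eta>)\<^sup>2 / (2 * t)))"
    unfolding g_def fst_conv snd_conv integral_mult_right_zero theta_cosh_laplace[OF t] ..
  also have "\<dots> = (LBINT z. exp (- (a * cosh (\<eta> + z))) * exp (- z\<^sup>2 / (2 * t)))"
    using lborel_integral_real_affine[of 1 "\<lambda>x. exp (- (a * cosh x)) * exp (- (x - \<eta>)\<^sup>2 / (2 * t))" \<eta>] by simp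
  also have "\<dots> / sq = (LINT z|gauss t. exp (- a * cosh (\<eta> + z)))"
    using t by (subst integral_gauss) (simp_all add: normal_density_def sq_def mult.commute)
  finally show "integral\<^sup>L lborel2 F = (LINT z|gauss t. exp (- a * cosh (\<eta> + z)))" .
qed

subsection \<open>Uniqueness from moments on the unit square\<close>

text \<open>A signed weight and a variable confined to the unit square stand for a finite signed
  measure on that square.\<close>

context
  fixes M :: "'a measure" and w :: "'a \<Rightarrow> real" and X :: "'a \<Rightarrow> real \<times> real"
  assumes w: "integrable M w" and X: "X \<in> borel_measurable M"
    and box: "\<forall>\<omega>\<in>space M. X \<omega> \<in> cbox (0, 0) (1, 1)"
begin

lemma weighted_integrable_continuous:
  assumes f: "continuous_on UNIV (f :: real \<times> real \<Rightarrow> real)"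
  shows "integrable M (\<lambda>\<omega>. w \<omega> * f (X \<omega>))"
proof -
  have "bounded (f ` cbox (0, 0) (1, 1))"
    by (intro compact_imp_bounded compact_continuous_image continuous_on_subset[OF f]) auto
  then obtain b where b: "\<And>v. v \<in> cbox (0, 0) (1, 1) \<Longrightarrow> \<bar>f v\<bar> \<le> b"
    by (auto simp: bounded_iff)
  show ?thesis
  proof (rule Bochner_Integration.integrable_bound)
    show "integrable M (\<lambda>\<omega>. w \<omega> * b)" using w by simp
    show "(\<lambda>\<omega>. w \<omega> * f (X \<omega>)) \<in> borel_measurable M"
      using borel_measurable_integrable[OF w] measurable_compose[OF X borel_measurable_continuous_onI[OF f]] by simp
    show "AE \<omega> in M. norm (w \<omega> * f (X \<omega>)) \<le> norm (w \<omega> * b)"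
      using b[OF box[rule_format]] by (intro AE_I2) (auto simp: abs_mult intro!: mult_left_mono intro: order_trans[OF _ abs_ge_self])
  qed
qed

lemma weighted_integral_approx:
  assumes f: "continuous_on UNIV (f :: real \<times> real \<Rightarrow> real)" and g: "continuous_on UNIV g"
    and e: "\<And>v. v \<in> cbox (0, 0) (1, 1) \<Longrightarrow> \<bar>f v - g v\<bar> \<le> e"
  shows "\<bar>(LINT \<omega>|M. w \<omega> * f (X \<omega>)) - (LINT \<omega>|M. w \<omega> * g (X \<omega>))\<bar> \<le> e * (LINT \<omega>|M. \<bar>w \<omega>\<bar>)"
proof -
  note i = weighted_integrable_continuous[OF f] weighted_integrable_continuous[OF g]
  have "\<bar>(LINT \<omega>|M. w \<omega> * f (X \<omega>)) - (LINT \<omega>|M. w \<omega> * g (X \<omega>))\<bar> = \<bar>LINT \<omega>|M. w \<omega> * f (X \<omega>) - w \<omega> * g (X \<omega>)\<bar>"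
    using i by simp
  also have "\<dots> \<le> (LINT \<omega>|M. \<bar>w \<omega> * f (X \<omega>) - w \<omega> * g (X \<omega>)\<bar>)" by (rule integral_abs_bound)
  also have "\<dots> \<le> (LINT \<omega>|M. e * \<bar>w \<omega>\<bar>)"
  proof (rule integral_mono)
    fix \<omega> assume "\<omega> \<in> space M"
    then have "\<bar>w \<omega>\<bar> * \<bar>f (X \<omega>) - g (X \<omega>)\<bar> \<le> \<bar>w \<omega>\<bar> * e" by (intro mult_left_mono e box[rule_format]) auto
    then show "\<bar>w \<omega> * f (X \<omega>) - w \<omega> * g (X \<omega>)\<bar> \<le> e * \<bar>w \<omega>\<bar>"
      by (simp add: abs_mult[symmetric] right_diff_distrib mult.commute)
  qed (use i w in auto)
  finally show ?thesis by simp
qed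

lemma weighted_integral_tendsto:
  fixes f :: "nat \<Rightarrow> real \<times> real \<Rightarrow> real"
  assumes m: "\<And>k. f k \<in> borel_measurable borel" "g \<in> borel_measurable borel"
    and b: "\<And>k v. \<bar>f k v\<bar> \<le> 1" and l: "\<And>v. (\<lambda>k. f k v) \<longlonglongrightarrow> g v"
  shows "(\<lambda>k. LINT \<omega>|M. w \<omega> * f k (X \<omega>)) \<longlonglongrightarrow> (LINT \<omega>|M. w \<omega> * g (X \<omega>))"
proof (rule integral_dominated_convergence[where w = "\<lambda>\<omega>. \<bar>w \<omega>\<bar>"])
  note [measurable] = borel_measurable_integrable[OF w] X m
  show "(\<lambda>\<omega>. w \<omega> * g (X \<omega>)) \<in> borel_measurable M" by measurable
  show "(\<lambda>\<omega>. w \<omega> * f k (X \<omega>)) \<in> borel_measurable M" for k by measurable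
  show "integrable M (\<lambda>\<omega>. \<bar>w \<omega>\<bar>)" using w by simp
  show "AE \<omega> in M. (\<lambda>k. w \<omega> * f k (X \<omega>)) \<longlonglongrightarrow> w \<omega> * g (X \<omega>)" by (intro AE_I2 tendsto_intros l)
  show "AE \<omega> in M. norm (w \<omega> * f k (X \<omega>)) \<le> \<bar>w \<omega>\<bar>" for k
    using b by (intro AE_I2) (simp add: abs_mult mult_left_le)
qed

end

lemma indicator_closed_limit:
  fixes C :: "'a::metric_space set"
  assumes "closed C" "C \<noteq> {}"
  shows "(\<lambda>k. max 0 (1 - real k * infdist v C)) \<longlonglongrightarrow> indicator C v"
proof (cases "v \<in> C")
  case True then show ?thesis by simp
next
  case False
  then have d: "infdist v C > 0" using assms by (metis in_closed_iff_infdist_zero infdist_nonneg less_eq_real_def)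
  obtain N where N: "1 / infdist v C < real N" using reals_Archimedean2 by blast
  have "max 0 (1 - real k * infdist v C) = indicator C v" if "k \<ge> N" for k
  proof -
    have "1 / infdist v C < real k" using N that by linarith
    then have "1 < real k * infdist v C" using d by (simp add: field_simps)
    then show ?thesis using False by simp
  qed
  then have "eventually (\<lambda>k. max 0 (1 - real k * infdist v C) = indicator C v) sequentially"
    unfolding eventually_sequentially by blast
  then show ?thesis by (rule tendsto_eventually)
qed

text \<open>Polynomials are dense among the continuous functions on the square, ramp functions of
  the distance lead to closed sets, and Dynkin's theorem to Borel sets. The weights are signed
  because the sign of the candidate density is still unknown when this is applied.\<close>

theorem signed_moments_unique:
  fixes M :: "'a measure" and M' :: "'b measure" and w :: "'a \<Rightarrow> real" and w' :: "'b \<Rightarrow> real"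
    and X :: "'a \<Rightarrow> real \<times> real" and X' :: "'b \<Rightarrow> real \<times> real"
  assumes A: "integrable M w" "X \<in> borel_measurable M" "\<forall>\<omega>\<in>space M. X \<omega> \<in> cbox (0, 0) (1, 1)"
    and A': "integrable M' w'" "X' \<in> borel_measurable M'" "\<forall>\<omega>\<in>space M'. X' \<omega> \<in> cbox (0, 0) (1, 1)"
    and mom: "\<And>i j. (LINT \<omega>|M. w \<omega> * (fst (X \<omega>) ^ i * snd (X \<omega>) ^ j)) = (LINT \<omega>|M'. w' \<omega> * (fst (X' \<omega>) ^ i * snd (X' \<omega>) ^ j))"
    and S: "S \<in> sets borel"
  shows "(LINT \<omega>|M. w \<omega> * indicator S (X \<omega>)) = (LINT \<omega>|M'. w' \<omega> * indicator S (X' \<omega>))"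
proof -
  define E where "E f = (LINT \<omega>|M. w \<omega> * f (X \<omega>)) - (LINT \<omega>|M'. w' \<omega> * f (X' \<omega>))" for f :: "real \<times> real \<Rightarrow> real"
  note int = weighted_integrable_continuous[OF A] weighted_integrable_continuous[OF A']
  \<comment> \<open>Asking for all monomial multiples of \<open>f\<close> makes \<open>Eq\<close>
    stable under multiplication by the coordinates, so the induction over polynomials handles
    products without expanding them.\<close>
  define Eq where "Eq f \<longleftrightarrow> continuous_on UNIV f \<and> (\<forall>i j. E (\<lambda>v. f v * (fst v ^ i * snd v ^ j)) = 0)"
    for f :: "real \<times> real \<Rightarrow> real"
  have Eadd: "E (\<lambda>v. f v + g v) = E f + E g" if "continuous_on UNIV f" "continuous_on UNIV g" for f g
    using int(1)[OF that(1)] int(1)[OF that(2)] int(2)[OF that(1)] int(2)[OF that(2)]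
    by (simp add: E_def distrib_left)
  have Escale: "E (\<lambda>v. c * f v) = c * E f" for c f
    unfolding E_def by (simp add: mult.left_commute right_diff_distrib)
  have poly: "\<forall>f. Eq f \<longrightarrow> Eq (\<lambda>v. p v * f v)" if "real_polynomial_function p" for p
    using that
  proof (induction p rule: real_polynomial_function.induct)
    case (linear p)
    then interpret bounded_linear p .
    have p: "p v = fst v * p (1, 0) + snd v * p (0, 1)" for v
    proof -
      have "v = fst v *\<^sub>R (1, 0) + snd v *\<^sub>R (0, 1)" by (simp add: prod_eq_iff)
      then have "p v = p (fst v *\<^sub>R (1, 0) + snd v *\<^sub>R (0, 1))" by simp
      also have "\<dots> = fst v * p (1, 0) + snd v * p (0, 1)" unfolding add scaleR by simp
      finally show ?thesis .
    qed
    show ?case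
    proof (intro allI impI)
      fix f assume f: "Eq f"
      then have fc: "continuous_on UNIV f" by (simp add: Eq_def)
      have "E (\<lambda>v. p v * f v * (fst v ^ i * snd v ^ j)) = 0" for i j
      proof -
        have eq: "(\<lambda>v. p v * f v * (fst v ^ i * snd v ^ j)) =
            (\<lambda>v. p (1, 0) * (f v * (fst v ^ Suc i * snd v ^ j)) + p (0, 1) * (f v * (fst v ^ i * snd v ^ Suc j)))"
          by (subst p) (auto simp: algebra_simps)
        have c: "continuous_on UNIV (\<lambda>v. c * (f v * (fst v ^ k * snd v ^ l)))" for c k l
          by (intro continuous_intros fc)
        have "E (\<lambda>v. f v * (fst v ^ k * snd v ^ l)) = 0" for k l using f by (simp add: Eq_def)
        then show ?thesis unfolding eq Eadd[OF c c] Escale by (simp only: mult_zero_right add_0)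
      qed
      moreover have "continuous_on UNIV (\<lambda>v. p v * f v)"
        by (intro continuous_intros fc linear_continuous_on bounded_linear_axioms)
      ultimately show "Eq (\<lambda>v. p v * f v)" by (simp add: Eq_def)
    qed
  next
    case (const c)
    show ?case
    proof (intro allI impI)
      fix f assume f: "Eq f"
      then have "continuous_on UNIV (\<lambda>v. c * f v)" by (auto simp: Eq_def intro!: continuous_intros)
      then show "Eq (\<lambda>v. c * f v)" using f unfolding Eq_def mult.assoc Escale by simp
    qed
  next
    case (add p1 p2)
    show ?case
    proof (intro allI impI)
      fix f assume f: "Eq f"
      have 1: "Eq (\<lambda>v. p1 v * f v)" "Eq (\<lambda>v. p2 v * f v)" using add f by auto
      then have c: "continuous_on UNIV (\<lambda>v. p1 v * f v * (fst v ^ i * snd v ^ j))" "continuous_on UNIV (\<lambda>v. p2 v * f v * (fst v ^ i * snd v ^ j))" for i j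
        by (auto simp: Eq_def intro!: continuous_intros)
      have c': "continuous_on UNIV (\<lambda>v. (p1 v + p2 v) * f v)"
        using 1 unfolding distrib_right by (auto simp: Eq_def intro!: continuous_intros)
      have "E (\<lambda>v. (p1 v + p2 v) * f v * (fst v ^ i * snd v ^ j)) = 0" for i j
        unfolding distrib_right Eadd[OF c] using 1 by (simp add: Eq_def)
      then show "Eq (\<lambda>v. (p1 v + p2 v) * f v)" using c' by (simp add: Eq_def)
    qed
  next
    case (mult p1 p2)
    then show ?case by (simp add: mult.assoc)
  qed
  have "Eq (\<lambda>_. 1)" using mom by (simp add: Eq_def E_def)
  then have poly1: "E p = 0" if "real_polynomial_function p" for p
  proof -
    have "Eq (\<lambda>v. p v * 1)" using poly[OF that, rule_format, OF \<open>Eq (\<lambda>_. 1)\<close>] .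
    then have "E (\<lambda>v. p v * 1 * (fst v ^ 0 * snd v ^ 0)) = 0" unfolding Eq_def by blast
    then show ?thesis by simp
  qed
  have cont: "E f = 0" if f: "continuous_on UNIV f" for f
  proof -
    define W where "W = (LINT \<omega>|M. \<bar>w \<omega>\<bar>) + (LINT \<omega>|M'. \<bar>w' \<omega>\<bar>)"
    have W: "W \<ge> 0" by (simp add: W_def)
    have "\<bar>E f\<bar> \<le> 0 + d" if d: "d > 0" for d
    proof -
      \<comment> \<open>The total weight \<open>W\<close> may be 0, hence the added 1.\<close>
      define e where "e = d / (W + 1)"
      have e: "e > 0" using d W by (simp add: e_def)
      obtain p where p: "real_polynomial_function p" "\<And>v. v \<in> cbox (0, 0) (1, 1) \<Longrightarrow> \<bar>f v - p v\<bar> < e"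
        using Stone_Weierstrass_real_polynomial_function[OF compact_cbox continuous_on_subset[OF f] e, of "(0,0)" "(1,1)"] by auto
      have pc: "continuous_on UNIV p"
        using p(1) by (intro continuous_on_polymonial_function) (simp add: real_polynomial_function_eq)
      have "\<bar>(LINT \<omega>|M. w \<omega> * f (X \<omega>)) - (LINT \<omega>|M. w \<omega> * p (X \<omega>))\<bar> \<le> e * (LINT \<omega>|M. \<bar>w \<omega>\<bar>)"
        "\<bar>(LINT \<omega>|M'. w' \<omega> * f (X' \<omega>)) - (LINT \<omega>|M'. w' \<omega> * p (X' \<omega>))\<bar> \<le> e * (LINT \<omega>|M'. \<bar>w' \<omega>\<bar>)"
        by (rule weighted_integral_approx[OF A f pc] weighted_integral_approx[OF A' f pc], rule less_imp_le, erule p(2))+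
      then have "\<bar>E f\<bar> \<le> e * W" using poly1[OF p(1)] by (simp add: E_def W_def distrib_left)
      also have "\<dots> \<le> d" using d W by (simp add: e_def field_simps)
      finally show ?thesis by simp
    qed
    then have "\<bar>E f\<bar> \<le> 0" by (rule field_le_epsilon)
    then show ?thesis by simp
  qed
  have lim: "(\<lambda>k. E (f k)) \<longlonglongrightarrow> E g"
    if "\<And>k. f k \<in> borel_measurable borel" "g \<in> borel_measurable borel" "\<And>k v. \<bar>f k v\<bar> \<le> 1" "\<And>v. (\<lambda>k. f k v) \<longlonglongrightarrow> g v" for f g
    unfolding E_def by (intro tendsto_diff weighted_integral_tendsto[OF A that] weighted_integral_tendsto[OF A' that])
  have closed: "E (indicator C) = 0" if C: "closed C" for C
  proof (cases "C = {}")
    case True then show ?thesis by (simp add: E_def)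
  next
    case False
    define f where "f k v = max 0 (1 - real k * infdist v C)" for k v
    have fc: "continuous_on UNIV (f k)" for k unfolding f_def by (intro continuous_intros)
    have "(\<lambda>k. E (f k)) \<longlonglongrightarrow> E (indicator C)"
    proof (rule lim)
      show "f k \<in> borel_measurable borel" for k by (rule borel_measurable_continuous_onI) (rule fc)
      show "(indicator C :: _ \<Rightarrow> real) \<in> borel_measurable borel" using C by simp
      show "\<bar>f k v\<bar> \<le> 1" for k v by (auto simp: f_def infdist_nonneg)
      show "(\<lambda>k. f k v) \<longlonglongrightarrow> indicator C v" for v unfolding f_def by (rule indicator_closed_limit[OF C False])
    qed
    then show ?thesis unfolding cont[OF fc] by (simp add: LIMSEQ_const_iff)
  qed
  have indint: "integrable M (\<lambda>\<omega>. w \<omega> * indicator B (X \<omega>))" "integrable M' (\<lambda>\<omega>. w' \<omega> * indicator B (X' \<omega>))"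
    if B[measurable]: "B \<in> sets borel" for B
    using borel_measurable_integrable[OF A(1)] A(2) borel_measurable_integrable[OF A'(1)] A'(2)
    by (auto intro!: Bochner_Integration.integrable_bound[OF A(1)] Bochner_Integration.integrable_bound[OF A'(1)]
        borel_measurable_times measurable_compose[OF _ borel_measurable_indicator[OF B]] simp: indicator_def)
  have "S \<in> sigma_sets UNIV (Collect closed)" using S by (simp add: borel_eq_closed)
  then have "E (indicator S) = 0"
  proof (rule sigma_sets_induct_disjoint[where P = "\<lambda>A. E (indicator A) = 0", rotated 2])
    show "Int_stable (Collect (closed :: (real \<times> real) set \<Rightarrow> bool))" by (auto simp: Int_stable_def)
    show "E (indicator A) = 0" if "A \<in> Collect closed" for A using closed that by simp
    show "E (indicator {}) = 0" by (simp add: E_def)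
    fix B :: "(real \<times> real) set"
    assume B: "B \<in> sigma_sets UNIV (Collect closed)" "E (indicator B) = 0"
    then have Bm: "B \<in> sets borel" by (simp add: borel_eq_closed)
    have *: "(indicator (UNIV - B) :: _ \<Rightarrow> real) = (\<lambda>v. 1 - indicator B v)" by (auto simp: indicator_def)
    have "E (indicator (UNIV - B)) = E (\<lambda>_. 1) - E (indicator B)"
      unfolding * E_def using indint[OF Bm] A(1) A'(1) by (simp add: right_diff_distrib)
    then show "E (indicator (UNIV - B)) = 0" using B cont[of "\<lambda>_. 1"] by simp
  next
    fix F :: "nat \<Rightarrow> (real \<times> real) set"
    assume union: "disjoint_family F" "range F \<subseteq> sigma_sets UNIV (Collect closed)" "\<And>i. E (indicator (F i)) = 0"
    have F: "F i \<in> sets borel" for i using union by (auto simp: borel_eq_closed)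
    have fin: "E (indicator (\<Union>i<k. F i)) = 0" for k
    proof -
      have dj: "disjoint_family_on F {..<k}" using union(1) by (rule disjoint_family_on_mono[rotated]) simp
      have ind: "(indicator (\<Union>i<k. F i) :: _ \<Rightarrow> real) = (\<lambda>v. \<Sum>i<k. indicator (F i) v)"
        using dj by (intro ext indicator_UN_disjoint) auto
      have "E (\<lambda>v. \<Sum>i<k. indicator (F i) v) = (\<Sum>i<k. E (indicator (F i)))"
        unfolding E_def sum_distrib_left sum_subtractf
        by (intro arg_cong2[where f = minus] Bochner_Integration.integral_sum indint F)
      then show ?thesis unfolding ind using union(3) by simp
    qed
    have "(\<lambda>k. E (indicator (\<Union>i<k. F i))) \<longlonglongrightarrow> E (indicator (\<Union>i. F i))"
    proof (rule lim)
      show "(indicator (\<Union>i<k. F i) :: _ \<Rightarrow> real) \<in> borel_measurable borel" for k using F by measurable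
      show "(indicator (\<Union>i. F i) :: _ \<Rightarrow> real) \<in> borel_measurable borel" using F by measurable
      show "\<bar>indicator (\<Union>i<k. F i) v :: real\<bar> \<le> 1" for k v by (auto simp: indicator_def)
      show "(\<lambda>k. indicator (\<Union>i<k. F i) v :: real) \<longlonglongrightarrow> indicator (\<Union>i. F i) v" for v
        by (rule LIMSEQ_indicator_UN)
    qed
    then show "E (indicator (\<Union> (range F))) = 0" unfolding fin by (simp add: LIMSEQ_const_iff)
  qed auto
  then show ?thesis by (simp add: E_def)
qed

subsection \<open>The integral along the logarithm of the Hankel contour\<close>

text \<open>The inner integrand depends on \<open>x\<close>, \<open>w\<close> and \<epsilon> only
  through the single parameter
  \<open>r = 2 * x / sqrt (2 * w powr (1 / \<epsilon>))\<close>.\<close>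

definition hankel_fun :: "real \<Rightarrow> real \<Rightarrow> complex \<Rightarrow> complex" where
  "hankel_fun t r z = exp (- (z\<^sup>2 / (2 * of_real t))) * sinh z * exp (of_real r * cosh z)"

lemma Re_cosh_Complex: "Re (cosh (Complex s y)) = cosh s * cos y"
  by (simp add: cosh_field_def Re_exp Re_divide algebra_simps add_divide_distrib)

lemma norm_sinh_le: "norm (sinh (z::complex)) \<le> cosh (Re z)"
proof -
  have "norm (exp z - exp (- z)) \<le> norm (exp z) + norm (exp (- z))" by (rule norm_triangle_ineq4)
  then show ?thesis by (simp add: sinh_field_def cosh_field_def norm_divide)
qed

text \<open>For these \<open>y\<close> the cosine is nonpositive, so \<open>exp (r * cosh z)\<close>
  has modulus at most 1. This is where the range of \<theta> enters; the growth of sinh is absorbed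
  by half of the Gaussian.\<close>

lemma hankel_fun_bound:
  assumes t: "t > 0" and r: "r \<ge> 0" and y: "pi / 2 \<le> \<bar>y\<bar>" "\<bar>y\<bar> \<le> pi"
  shows "norm (hankel_fun t r (Complex s y)) \<le> exp (pi\<^sup>2 / (2 * t)) * exp t * exp (- (1 / (4 * t) * s\<^sup>2))"
proof -
  have "cos y = cos \<bar>y\<bar>" by simp
  also have "\<dots> \<le> cos (pi / 2)" using y by (intro cos_monotone_0_pi_le) auto
  finally have "cos y \<le> 0" by simp
  then have "r * (cosh s * cos y) \<le> 0" using r by (intro mult_nonneg_nonpos) auto
  then have 1: "norm (exp (of_real r * cosh (Complex s y))) \<le> 1"
    by (simp add: Re_cosh_Complex)
  have 2: "norm (sinh (Complex s y)) \<le> cosh s" using norm_sinh_le[of "Complex s y"] by simp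
  have "y\<^sup>2 \<le> pi\<^sup>2" using y by (simp add: abs_le_square_iff[symmetric])
  then have "(y\<^sup>2 - s\<^sup>2) / (2 * t) \<le> pi\<^sup>2 / (2 * t) + - s\<^sup>2 / (2 * t)"
    using t by (simp add: diff_divide_distrib divide_right_mono)
  then have 3: "norm (exp (- ((Complex s y)\<^sup>2 / (2 * of_real t)))) \<le> exp (pi\<^sup>2 / (2 * t)) * exp (- s\<^sup>2 / (2 * t))"
    unfolding exp_gauss_complex(2)[OF t] exp_add[symmetric] by simp
  have "norm (hankel_fun t r (Complex s y)) \<le> (exp (pi\<^sup>2 / (2 * t)) * exp (- s\<^sup>2 / (2 * t))) * cosh s * 1"
    unfolding hankel_fun_def norm_mult by (intro mult_mono 1 2 3) auto
  also have "\<dots> = exp (pi\<^sup>2 / (2 * t)) * (exp (- s\<^sup>2 / (2 * t)) * cosh s)" by simp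
  also have "\<dots> \<le> exp (pi\<^sup>2 / (2 * t)) * (exp t * exp (- (1 / (4 * t) * s\<^sup>2)))"
    by (intro mult_left_mono cosh_gauss_le t) auto
  finally show ?thesis by (simp add: mult.assoc)
qed

lemma hankel_fun_holomorphic: "t > 0 \<Longrightarrow> hankel_fun t r holomorphic_on UNIV"
  unfolding hankel_fun_def sinh_field_def cosh_field_def by (intro holomorphic_intros) auto

lemma hankel_fun_line_continuous:
  assumes "t > 0" shows "continuous_on UNIV (\<lambda>s. hankel_fun t r (Complex s y))"
proof -
  have "continuous_on UNIV (\<lambda>s. Complex s y)" unfolding Complex_eq by (intro continuous_intros)
  then show ?thesis
    by (rule continuous_on_compose2[OF holomorphic_on_imp_continuous_on[OF hankel_fun_holomorphic[OF assms]]]) auto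
qed

lemma hankel_fun_line_integrable:
  assumes t: "t > 0" and r: "r \<ge> 0" and y: "pi / 2 \<le> \<bar>y\<bar>" "\<bar>y\<bar> \<le> pi"
  shows "integrable lborel (\<lambda>s. hankel_fun t r (Complex s y))"
proof (rule Bochner_Integration.integrable_bound)
  show "integrable lborel (\<lambda>s. exp (pi\<^sup>2 / (2 * t)) * exp t * exp (- (1 / (4 * t) * s\<^sup>2)))"
    by (rule integrable_mult_right, rule integrable_exp_sq) (use t in simp)
  show "(\<lambda>s. hankel_fun t r (Complex s y)) \<in> borel_measurable lborel"
    using borel_measurable_continuous_onI[OF hankel_fun_line_continuous[OF t]] by simp
  show "AE s in lborel. norm (hankel_fun t r (Complex s y)) \<le> norm (exp (pi\<^sup>2 / (2 * t)) * exp t * exp (- (1 / (4 * t) * s\<^sup>2)))"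
    using hankel_fun_bound[OF assms] by (intro AE_I2) (simp add: abs_mult)
qed

text \<open>On \<open>Im z = pi\<close> both sinh and cosh change sign. The real part
  \<open>- B s\<close> of the integrand is odd and integrates to 0; the imaginary part is
  \<open>2 * pi\<close> times the integrand of \<open>Theta\<close>.\<close>

lemma hankel_fun_pi_line:
  assumes t: "t > 0" and r: "r \<ge> 0"
  shows "(LBINT s. hankel_fun t r (Complex s pi)) = 2 * of_real pi * \<i> * of_real (Theta t r)"
proof -
  define B where "B s = exp ((pi\<^sup>2 - s\<^sup>2) / (2 * t)) * sinh s * exp (- r * cosh s) * cos (pi * s / t)" for s
  have eq: "hankel_fun t r (Complex s pi) = 2 * of_real pi * \<i> * of_real (kappa t s * exp (- r * cosh s)) - of_real (B s)" for s
  proof -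
    have e: "exp (Complex s pi) = - of_real (exp s)" "exp (- Complex s pi) = - of_real (exp (- s))"
      by (simp_all add: complex_eq_iff Re_exp Im_exp)
    have 1: "sinh (Complex s pi) = - of_real (sinh s)" "cosh (Complex s pi) = - of_real (cosh s)"
      unfolding sinh_field_def cosh_field_def e by (simp_all add: field_simps)
    have 2: "exp (- (\<i> * of_real (s * pi / t))) = of_real (cos (pi * s / t)) - \<i> * of_real (sin (pi * s / t))"
      by (simp add: complex_eq_iff Re_exp Im_exp mult.commute)
    have 3: "exp (of_real r * - of_real (cosh s)) = complex_of_real (exp (- r * cosh s))"
      by (simp flip: exp_of_real)
    have 4: "exp ((pi\<^sup>2 - s\<^sup>2) / (2 * t)) = exp (pi\<^sup>2 / (2 * t)) * exp (- s\<^sup>2 / (2 * t))"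
      by (simp add: exp_add[symmetric] diff_divide_distrib)
    have "hankel_fun t r (Complex s pi) = of_real (exp ((pi\<^sup>2 - s\<^sup>2) / (2 * t))) * (of_real (cos (pi * s / t)) - \<i> * of_real (sin (pi * s / t)))
        * (- of_real (sinh s)) * of_real (exp (- r * cosh s))"
      unfolding hankel_fun_def exp_gauss_complex(1)[OF t] 1 2 3 ..
    also have "\<dots> = \<i> * of_real (exp ((pi\<^sup>2 - s\<^sup>2) / (2 * t)) * sinh s * exp (- r * cosh s) * sin (pi * s / t)) - of_real (B s)"
      by (simp add: B_def algebra_simps)
    also have "exp ((pi\<^sup>2 - s\<^sup>2) / (2 * t)) * sinh s * exp (- r * cosh s) * sin (pi * s / t) = 2 * pi * (kappa t s * exp (- r * cosh s))"
      unfolding 4 kappa_def by simp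
    finally show ?thesis by simp
  qed
  have ki: "integrable lborel (\<lambda>s. kappa t s * exp (- r * cosh s))" by (rule kappa_exp_integrable[OF t r])
  have "integrable lborel (\<lambda>s. 2 * of_real pi * \<i> * of_real (kappa t s * exp (- r * cosh s)) - hankel_fun t r (Complex s pi))"
    by (intro Bochner_Integration.integrable_diff integrable_mult_right integrable_of_real ki hankel_fun_line_integrable t r) auto
  then have "integrable lborel (\<lambda>s. complex_of_real (B s))" by (simp add: eq)
  then have Bi: "integrable lborel B" by (simp add: complex_of_real_integrable_eq)
  have "(LBINT s. B s) = (LBINT s. B (- s))"
    using lborel_integral_real_affine[of "-1" B 0] by simp
  also have "\<dots> = - (LBINT s. B s)" by (simp add: B_def)
  finally have B0: "(LBINT s. B s) = 0" by simp
  have "(LBINT s. hankel_fun t r (Complex s pi))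
      = (LBINT s. 2 * of_real pi * \<i> * of_real (kappa t s * exp (- r * cosh s))) - (LBINT s. of_real (B s))"
    unfolding eq by (intro Bochner_Integration.integral_diff integrable_mult_right integrable_of_real ki Bi)
  also have "\<dots> = 2 * of_real pi * \<i> * of_real (LBINT s. kappa t s * exp (- r * cosh s)) - of_real (LBINT s. B s)"
    unfolding integral_mult_right_zero integral_complex_of_real ..
  finally show ?thesis by (simp add: B0 Theta_def)
qed

text \<open>
  An even primitive \<open>F\<close> of the entire odd integrand expresses the contour integral as the limit of
  \<open>F (X + \<i>\<theta>) - F (X - \<i>\<theta>)\<close>, which does not see \<open>R\<close>, nor \<open>\<theta>\<close> by Gaussian decay; for \<open>\<theta> = pi\<close> it is
  the integral of \<open>F'\<close> along the whole line \<open>Im z = pi\<close>.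
\<close>

theorem log_hankel_Theta:
  assumes t: "t > 0" and r: "r \<ge> 0" and \<theta>: "\<theta> \<in> {pi / 2..pi}"
  shows "log_hankel_integrable \<theta> R (hankel_fun t r)"
    and "log_hankel_integral \<theta> R (hankel_fun t r) = 2 * of_real pi * \<i> * of_real (Theta t r)"
proof -
  define f where "f = hankel_fun t r"
  have fh: "f holomorphic_on UNIV" unfolding f_def by (rule hankel_fun_holomorphic[OF t])
  obtain F where F: "\<And>z. (F has_field_derivative f z) (at z)"
    using holomorphic_convex_primitive'[OF convex_UNIV open_UNIV fh] by auto
  define g where "g s = exp (pi\<^sup>2 / (2 * t)) * exp t * exp (- (1 / (4 * t) * s\<^sup>2))" for s
  have fg: "norm (f (Complex s y)) \<le> g s" if "pi / 2 \<le> \<bar>y\<bar>" "\<bar>y\<bar> \<le> pi" for s y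
    unfolding f_def g_def by (rule hankel_fun_bound[OF t r that])
  have th: "pi / 2 \<le> \<theta>" "\<theta> \<le> pi" "\<theta> > 0" using \<theta> pi_gt_zero by (auto simp: less_le_trans[of 0 "pi/2"])
  \<comment> \<open>\<open>f\<close> is odd, so \<open>F z - F (- z)\<close> has derivative 0, and
    it vanishes at 0.\<close>
  have Feven: "F (- z) = F z" for z
  proof -
    have "((\<lambda>z. F z - F (- z)) has_field_derivative f z - f (- z) * (- 1)) (at z)" for z
      by (intro DERIV_diff F DERIV_chain2[OF F]) (auto intro!: derivative_eq_intros)
    moreover have "f (- z) = - f z" for z by (simp add: f_def hankel_fun_def)
    ultimately have "((\<lambda>z. F z - F (- z)) has_field_derivative 0) (at z)" for z by simp
    then obtain c where "\<And>z. F z - F (- z) = c"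
      using has_field_derivative_zero_constant[of UNIV "\<lambda>z. F z - F (- z)"] by auto
    from this[of 0] this[of z] show ?thesis by simp
  qed
  have dF: "((\<lambda>s. F (Complex s y)) has_vector_derivative f (Complex s y)) (at s within A)" for s y A
  proof -
    have "((\<lambda>x. Complex x y) has_vector_derivative 1) (at s)"
      unfolding Complex_eq has_vector_derivative_def
      by (auto intro!: derivative_eq_intros simp: scaleR_conv_of_real)
    from field_vector_diff_chain_at[OF this F] show ?thesis
      by (simp add: o_def has_vector_derivative_at_within)
  qed
  have fc: "continuous_on A (\<lambda>s. f (Complex s y))" for A y
    using hankel_fun_line_continuous[OF t] unfolding f_def by (rule continuous_on_subset) simp
  have FTC: "(LBINT s:{a..b}. f (Complex s y)) = F (Complex b y) - F (Complex a y)" if "a \<le> b" for a b y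
    unfolding set_lebesgue_integral_def by (rule integral_FTC_Icc[OF that dF fc])
  have li: "integrable lborel (\<lambda>s. f (Complex s y))" if "pi / 2 \<le> \<bar>y\<bar>" "\<bar>y\<bar> \<le> pi" for y
    unfolding f_def by (rule hankel_fun_line_integrable[OF t r that])
  have si: "set_integrable lborel A (\<lambda>s. f (Complex s y))" if "pi / 2 \<le> \<bar>y\<bar>" "\<bar>y\<bar> \<le> pi" "A \<in> sets borel" for y A
    unfolding set_integrable_def by (rule integrable_mult_indicator) (use li that in auto)
  have cont_int: "(f has_contour_integral F b - F a) (linepath a b)" for a b
    using contour_integral_primitive[of UNIV F f "linepath a b"] F by simp
  have sis: "set_integrable lborel {ln R..} (\<lambda>s. f (Complex s \<theta>))" "set_integrable lborel {ln R..} (\<lambda>s. f (Complex s (- \<theta>)))"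
    by (rule si; use th in simp)+
  show "log_hankel_integrable \<theta> R (hankel_fun t r)"
    unfolding log_hankel_integrable_def f_def[symmetric]
    using sis cont_int by (auto intro: has_contour_integral_integrable)
  have half: "((\<lambda>b. F (Complex b y) - F (Complex (ln R) y)) \<longlongrightarrow> (LBINT s:{ln R..}. f (Complex s y))) at_top"
    if y: "pi / 2 \<le> \<bar>y\<bar>" "\<bar>y\<bar> \<le> pi" for y
  proof (rule Lim_transform_eventually)
    show "((\<lambda>b. LBINT s:{ln R..b}. f (Complex s y)) \<longlongrightarrow> (LBINT s:{ln R..}. f (Complex s y))) at_top"
      by (rule tendsto_set_lebesgue_integral_at_top) (use si[OF y] in auto)
    show "eventually (\<lambda>b. (LBINT s:{ln R..b}. f (Complex s y)) = F (Complex b y) - F (Complex (ln R) y)) at_top"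
      using eventually_ge_at_top[of "ln R"] by eventually_elim (rule FTC)
  qed
  define H where "H = log_hankel_integral \<theta> R f"
  have "((\<lambda>b. - (F (Complex b (- \<theta>)) - F (Complex (ln R) (- \<theta>))) + (F (Complex (ln R) \<theta>) - F (Complex (ln R) (- \<theta>)))
        + (F (Complex b \<theta>) - F (Complex (ln R) \<theta>))) \<longlongrightarrow> H) at_top"
    unfolding H_def log_hankel_integral_def contour_integral_unique[OF cont_int]
    by (intro tendsto_intros half) (use th in auto)
  \<comment> \<open>The values of \<open>F\<close> at the corners over \<open>ln R\<close> cancel,
    which removes \<open>R\<close>.\<close>
  then have 1: "((\<lambda>b. F (Complex b \<theta>) - F (Complex b (- \<theta>))) \<longlongrightarrow> H) at_top" by simp
  have g0: "((\<lambda>b. g b * pi) \<longlongrightarrow> 0) at_top"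
    unfolding g_def using t by real_asymp
  have vert: "norm (F (Complex b u) - F (Complex b v)) \<le> g b * pi"
    if "pi / 2 \<le> u" "u \<le> v" "v \<le> pi" for b u v
  proof -
    define T where "T = {z. Re z \<le> b} \<inter> {z. Re z \<ge> b} \<inter> {z. Im z \<le> v} \<inter> {z. Im z \<ge> u}"
    have Tc: "convex T" unfolding T_def
      by (intro convex_Int convex_halfspace_Im_le convex_halfspace_Im_ge convex_halfspace_Re_le convex_halfspace_Re_ge)
    have "norm (F (Complex b u) - F (Complex b v)) \<le> g b * norm (Complex b u - Complex b v)"
    proof (rule field_differentiable_bound[OF Tc])
      fix z assume z: "z \<in> T"
      show "(F has_field_derivative f z) (at z within T)" by (rule has_field_derivative_at_within[OF F])
      have "z = Complex b (Im z)" "pi / 2 \<le> \<bar>Im z\<bar>" "\<bar>Im z\<bar> \<le> pi"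
        using z that by (auto simp: T_def complex_eq_iff)
      then show "norm (f z) \<le> g b" using fg[of "Im z" b] by metis
    qed (use that in \<open>auto simp: T_def\<close>)
    also have "norm (Complex b u - Complex b v) \<le> pi"
      using that pi_gt_zero by (simp add: cmod_def)
    then have "g b * norm (Complex b u - Complex b v) \<le> g b * pi"
      by (intro mult_left_mono) (auto simp: g_def)
    finally show ?thesis .
  qed
  have "((\<lambda>b. F (Complex b \<theta>) - F (Complex b pi)) \<longlongrightarrow> 0) at_top"
    by (rule Lim_null_comparison[OF _ g0]) (use vert th in auto)
  moreover have "((\<lambda>b. F (Complex b (- \<theta>)) - F (Complex b (- pi))) \<longlongrightarrow> 0) at_top"
  proof (rule Lim_null_comparison[OF _ g0])
    \<comment> \<open>By evenness a point of the lower half-line becomes a point of the upper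
      half-plane with negated real part, so \<open>vert\<close> also controls the lower
      lines.\<close>
    have "F (Complex b (- y)) = F (Complex (- b) y)" for b y
      using Feven[of "Complex (- b) y"] by (simp add: Complex_eq)
    moreover have "g (- b) = g b" for b by (simp add: g_def)
    ultimately show "eventually (\<lambda>b. norm (F (Complex b (- \<theta>)) - F (Complex b (- pi))) \<le> g b * pi) at_top"
      using vert[of \<theta> pi "- b" for b] th by (intro always_eventually allI) (metis order_refl)
  qed
  ultimately have "((\<lambda>b. (F (Complex b \<theta>) - F (Complex b (- \<theta>))) - ((F (Complex b \<theta>) - F (Complex b pi)) - (F (Complex b (- \<theta>)) - F (Complex b (- pi))))) \<longlongrightarrow> H - (0 - 0)) at_top"
    by (intro tendsto_diff 1)
  then have 2: "((\<lambda>b. F (Complex b pi) - F (Complex b (- pi))) \<longlongrightarrow> H) at_top" by (simp add: algebra_simps)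
  have "((\<lambda>b. LBINT s. indicator {- b..b} s *\<^sub>R f (Complex s pi)) \<longlongrightarrow> (LBINT s. f (Complex s pi))) at_top"
  proof (rule integral_dominated_convergence_at_top[where w = "\<lambda>s. norm (f (Complex s pi))"])
    have i: "integrable lborel (\<lambda>s. f (Complex s pi))" by (rule li) auto
    then show "integrable lborel (\<lambda>s. norm (f (Complex s pi)))" by simp
    note [measurable] = borel_measurable_integrable[OF i]
    show "(\<lambda>s. f (Complex s pi)) \<in> borel_measurable lborel" by measurable
    show "(\<lambda>s. indicator {- b..b} s *\<^sub>R f (Complex s pi)) \<in> borel_measurable lborel" for b :: real by measurable
    have "((\<lambda>b. indicator {- b..b} s *\<^sub>R f (Complex s pi)) \<longlongrightarrow> f (Complex s pi)) at_top" for s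
      by (rule tendsto_eventually, rule eventually_mono[OF eventually_ge_at_top[of "\<bar>s\<bar>"]]) (auto simp: abs_le_iff indicator_def)
    then show "AE s in lborel. ((\<lambda>b. indicator {- b..b} s *\<^sub>R f (Complex s pi)) \<longlongrightarrow> f (Complex s pi)) at_top" by simp
    show "eventually (\<lambda>b. AE s in lborel. norm (indicator {- b..b} s *\<^sub>R f (Complex s pi)) \<le> norm (f (Complex s pi))) at_top"
      by (intro always_eventually allI AE_I2) (simp add: indicator_def)
  qed
  moreover have "eventually (\<lambda>b. (LBINT s. indicator {- b..b} s *\<^sub>R f (Complex s pi)) = F (Complex b pi) - F (Complex b (- pi))) at_top"
    using eventually_ge_at_top[of 0]
  proof eventually_elim
    fix b :: real assume "b \<ge> 0"
    then have "(LBINT s:{- b..b}. f (Complex s pi)) = F (Complex b pi) - F (Complex (- b) pi)" by (intro FTC) simp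
    \<comment> \<open>Evenness once more: the lower end over \<open>b\<close> is the left end of the
      segment on \<open>Im z = pi\<close>.\<close>
    also have "F (Complex (- b) pi) = F (Complex b (- pi))" using Feven[of "Complex b (- pi)"] by (simp add: Complex_eq)
    finally show "(LBINT s. indicator {- b..b} s *\<^sub>R f (Complex s pi)) = F (Complex b pi) - F (Complex b (- pi))"
      by (simp add: set_lebesgue_integral_def)
  qed
  ultimately have "((\<lambda>b. F (Complex b pi) - F (Complex b (- pi))) \<longlongrightarrow> (LBINT s. f (Complex s pi))) at_top"
    by (rule Lim_transform_eventually)
  then have "H = (LBINT s. f (Complex s pi))" using 2 by (intro tendsto_unique[of at_top]) auto
  then show "log_hankel_integral \<theta> R (hankel_fun t r) = 2 * of_real pi * \<i> * of_real (Theta t r)"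
    unfolding H_def f_def hankel_fun_pi_line[OF t r] .
qed

lemma inner_integrand_eq_hankel_fun:
  "inner_integrand \<epsilon> t w x = hankel_fun t (2 * x / sqrt (2 * w powr (1 / \<epsilon>)))"
  by (auto simp: inner_integrand_def hankel_fun_def)

subsection \<open>The law of the exponential functional\<close>

text \<open>The set of disagreement is open and null, hence empty. This serves both the sign of
  \<open>Theta\<close> and the uniqueness of the density.\<close>

lemma continuous_AE_eq:
  fixes f g :: "real \<Rightarrow> real"
  assumes f: "continuous_on {0<..} f" and g: "continuous_on {0<..} g"
    and ae: "AE x in lborel. x > 0 \<longrightarrow> f x = g x" and x: "x > 0"
  shows "f x = g x"
proof (rule ccontr)
  assume ne: "f x \<noteq> g x"
  define U where "U = {x \<in> {0<..}. f x - g x \<in> - {0}}"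
  have "open ((\<lambda>x. f x - g x) -` (- {0}) \<inter> {0<..})"
    by (rule continuous_on_open_vimage[THEN iffD1, rule_format]) (auto intro!: continuous_intros f g)
  then have U: "open U" by (simp add: U_def vimage_def Int_def conj_commute)
  have "AE x in lborel. x \<notin> U" using ae by eventually_elim (auto simp: U_def)
  then have "U \<in> null_sets lborel" using U by (simp add: AE_iff_null_sets)
  then have "negligible U" by (simp add: negligible_iff_null_sets null_sets_completionI)
  moreover have "x \<in> U" using ne x by (simp add: U_def)
  ultimately show False using open_not_negligible[OF U] by blast
qed

text \<open>As \<open>cosh \<eta>\<close> takes every value from 1 upwards, the coefficient
  \<open>a * cosh \<eta>\<close> takes every value from \<open>a = sqrt (2 * n)\<close>
  upwards.\<close>

lemma laplace_param:
  fixes b n :: real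
  assumes "n > 0" "b \<ge> sqrt (2 * n)"
  obtains a \<eta> where "a > 0" "a\<^sup>2 / 2 = n" "a * cosh \<eta> = b"
proof
  have b: "b / sqrt (2 * n) \<ge> 1" using assms by simp
  show "sqrt (2 * n) > 0" "(sqrt (2 * n))\<^sup>2 / 2 = n" using assms by auto
  show "sqrt (2 * n) * cosh (arcosh (b / sqrt (2 * n))) = b" using assms b by (simp add: cosh_arcosh_real)
qed

text \<open>
  The moments of \<open>(exp (- \<rho>), exp (- 2 * \<rho> - A))\<close> have exponents in the range \<open>b \<ge> a\<close> in which the
  transform is known.
\<close>

lemma moment_param:
  obtains a \<eta> :: real where "a > 0" "a\<^sup>2 / 2 = 1 + real j" "a * cosh \<eta> = 2 + real i + 2 * real j"
proof (rule laplace_param[of "1 + real j" "2 + real i + 2 * real j"])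
  have "sqrt (2 * (1 + real j)) \<le> sqrt ((2 + 2 * real j)\<^sup>2)"
    unfolding real_sqrt_le_iff by (simp add: power2_eq_square algebra_simps)
  then show "sqrt (2 * (1 + real j)) \<le> 2 + real i + 2 * real j" by simp
qed auto

section \<open>The joint law of \<open>(\<rho> / A, ln A)\<close> and the sign of
  \<open>Theta\<close>\<close>

locale bm_time =
  fixes M :: "'a measure" and B :: "real \<Rightarrow> 'a \<Rightarrow> real" and \<nu> t :: real
  assumes bm: "standard_brownian_motion M B" and t: "t > 0"
begin

sublocale prob_space M using bm by (simp add: standard_brownian_motion_def)

definition "\<rho> \<omega> = exp (\<nu> * t + B t \<omega>)"
definition "A = exp_functional \<nu> B t"
abbreviation "Z \<omega> \<equiv> (\<rho> \<omega> / A \<omega>, ln (A \<omega>))"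
abbreviation "D \<omega> \<equiv> exp (- \<nu> * B t \<omega> - \<nu>\<^sup>2 * t / 2)"
text \<open>The exponential factor realises the moment with \<open>i = j = 0\<close>. Its
  counterpart in \<open>hdens_weight\<close> makes that weight integrable before anything is known
  about the mass of \<open>hdens\<close>.\<close>

definition "bm_weight \<omega> = D \<omega> * exp (- (2 * \<rho> \<omega>) - A \<omega>)"
definition "hdens_weight p = hdens t (fst p) (snd p) * exp (- (2 * (fst p * exp (snd p))) - exp (snd p))"

lemma B_meas[measurable]: "B t \<in> borel_measurable M"
  using bm t by (simp add: standard_brownian_motion_def)

lemma \<rho>_meas[measurable]: "\<rho> \<in> borel_measurable M" unfolding \<rho>_def[abs_def] by measurable
lemma A_meas[measurable]: "A \<in> borel_measurable M" unfolding A_def by (rule exp_functional_measurable[OF bm t])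
lemma A_pos: "\<omega> \<in> space M \<Longrightarrow> A \<omega> > 0" unfolding A_def by (rule exp_functional_measurable(3)[OF bm t])
lemma \<rho>_pos: "\<rho> \<omega> > 0" by (simp add: \<rho>_def)

lemma bm_weight_integrable: "integrable M bm_weight"
proof (rule Bochner_Integration.integrable_bound)
  show "integrable M (\<lambda>\<omega>. D \<omega>)"
    by (rule feynman_kac_cosh(1)[OF bm t zero_less_one])
  show "bm_weight \<in> borel_measurable M" unfolding bm_weight_def[abs_def] by measurable
  show "AE \<omega> in M. norm (bm_weight \<omega>) \<le> norm (D \<omega>)"
  proof (rule AE_I2)
    fix \<omega> assume "\<omega> \<in> space M"
    then have "- (2 * \<rho> \<omega>) - A \<omega> \<le> 0" using A_pos[of \<omega>] \<rho>_pos[of \<omega>] by simp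
    then have "exp (- (2 * \<rho> \<omega>) - A \<omega>) \<le> 1" by simp
    then show "norm (bm_weight \<omega>) \<le> norm (D \<omega>)"
      by (simp add: bm_weight_def abs_mult mult_left_le)
  qed
qed

lemma hdens_weight_integrable: "integrable lborel2 hdens_weight"
proof -
  obtain a \<eta> :: real where a: "a > 0" "a\<^sup>2 / 2 = 1 + real 0" "a * cosh \<eta> = 2 + real 0 + 2 * real 0"
    by (rule moment_param)
  show ?thesis
    using hdens_laplace(1)[OF t a(1), of \<eta>] unfolding a(2,3) by (simp add: hdens_weight_def[abs_def])
qed

text \<open>All mixed moments of \<open>X\<close> and \<open>X'\<close> under the two weights agree
  by \<open>feynman_kac_cosh\<close> and \<open>hdens_laplace\<close>, and \<open>\<Phi>\<close>
  recovers the pair from these bounded coordinates.\<close>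

lemma joint_law:
  assumes T: "T \<in> sets (borel :: (real \<times> real) measure)"
  shows "(LINT \<omega>|M. bm_weight \<omega> * indicator T (Z \<omega>)) = (LINT p|lborel2. hdens_weight p * indicator T p)"
proof -
  define X where "X \<omega> = (exp (- \<rho> \<omega>), exp (- (2 * \<rho> \<omega>) - A \<omega>))" for \<omega>
  \<comment> \<open>\<open>X\<close> in the coordinates \<open>\<rho> = q * exp y\<close> and
    \<open>A = exp y\<close>. The truncation at 0 keeps the values in the square also for
    \<open>q \<le> 0\<close>, where \<open>hdens\<close> vanishes.\<close>
  define X' :: "real \<times> real \<Rightarrow> real \<times> real" where
    "X' p = (exp (- (max 0 (fst p) * exp (snd p))), exp (- (2 * (max 0 (fst p) * exp (snd p))) - exp (snd p)))" for p
  \<comment> \<open>Inverts the coordinates: \<open>\<rho> = - ln (fst v)\<close> and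
    \<open>A = 2 * ln (fst v) - ln (snd v)\<close>.\<close>
  define \<Phi> :: "real \<times> real \<Rightarrow> real \<times> real" where
    "\<Phi> v = (- ln (fst v) / (2 * ln (fst v) - ln (snd v)), ln (2 * ln (fst v) - ln (snd v)))" for v
  have \<Phi>m: "\<Phi> \<in> borel_measurable borel" unfolding \<Phi>_def[abs_def] borel_prod[symmetric] by measurable
  have S: "\<Phi> -` T \<in> sets borel" using measurable_sets[OF \<Phi>m T] by simp
  have Xm: "X \<in> borel_measurable M" unfolding X_def[abs_def] borel_prod[symmetric] by measurable
  have X'm: "X' \<in> borel_measurable lborel2" unfolding X'_def[abs_def] borel_prod[symmetric] by measurable
  have boxX: "\<forall>\<omega>\<in>space M. X \<omega> \<in> cbox (0, 0) (1, 1)"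
  proof
    fix \<omega> assume "\<omega> \<in> space M"
    then show "X \<omega> \<in> cbox (0, 0) (1, 1)" using A_pos[of \<omega>] \<rho>_pos[of \<omega>] by (simp add: X_def)
  qed
  have boxX': "\<forall>p\<in>space lborel2. X' p \<in> cbox (0, 0) (1, 1)"
  proof
    fix p :: "real \<times> real"
    have "0 \<le> max 0 (fst p) * exp (snd p)" by simp
    moreover have "0 < exp (snd p)" by simp
    ultimately have "- (max 0 (fst p) * exp (snd p)) \<le> 0" "- (2 * (max 0 (fst p) * exp (snd p))) - exp (snd p) \<le> 0"
      by linarith+
    then show "X' p \<in> cbox (0, 0) (1, 1)" unfolding X'_def by (simp only: cbox_Pair_eq mem_Times_iff fst_conv snd_conv) simp
  qed
  have mom: "(LINT \<omega>|M. bm_weight \<omega> * (fst (X \<omega>) ^ i * snd (X \<omega>) ^ j)) = (LINT p|lborel2. hdens_weight p * (fst (X' p) ^ i * snd (X' p) ^ j))" for i j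
  proof -
    obtain a \<eta> :: real where a: "a > 0" "a\<^sup>2 / 2 = 1 + real j" "a * cosh \<eta> = 2 + real i + 2 * real j"
      by (rule moment_param)
    have ex: "exp (- (2 * r) - s) * (exp (- r) ^ i * exp (- (2 * r) - s) ^ j) = exp (- ((2 + real i + 2 * real j) * r) - (1 + real j) * s)" for r s :: real
      by (simp add: exp_of_nat_mult[symmetric] exp_add[symmetric] algebra_simps)
    have "(LINT \<omega>|M. bm_weight \<omega> * (fst (X \<omega>) ^ i * snd (X \<omega>) ^ j))
        = (LINT \<omega>|M. D \<omega> * exp (- (a * cosh \<eta> * exp (\<nu> * t + B t \<omega>)) - a\<^sup>2 / 2 * exp_functional \<nu> B t \<omega>))"
      unfolding bm_weight_def X_def fst_conv snd_conv mult.assoc[of "exp (- \<nu> * B t _ - \<nu>\<^sup>2 * t / 2)"] ex a(2,3) \<rho>_def A_def ..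
    also have "\<dots> = (LINT z|gauss t. exp (- a * cosh (\<eta> + z)))" by (rule feynman_kac_cosh(2)[OF bm t a(1)])
    also have "\<dots> = (LINT p|lborel2. hdens t (fst p) (snd p) * exp (- (a * cosh \<eta> * (fst p * exp (snd p))) - a\<^sup>2 / 2 * exp (snd p)))"
      by (rule hdens_laplace(2)[OF t a(1), symmetric])
    also have "\<dots> = (LINT p|lborel2. hdens_weight p * (fst (X' p) ^ i * snd (X' p) ^ j))"
    proof (rule Bochner_Integration.integral_cong[OF refl])
      fix p :: "real \<times> real"
      show "hdens t (fst p) (snd p) * exp (- (a * cosh \<eta> * (fst p * exp (snd p))) - a\<^sup>2 / 2 * exp (snd p)) = hdens_weight p * (fst (X' p) ^ i * snd (X' p) ^ j)"
      proof (cases "fst p > 0")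
        case True
        then have m: "max 0 (fst p) = fst p" by simp
        show ?thesis unfolding hdens_weight_def X'_def fst_conv snd_conv m mult.assoc[of "hdens _ _ _"] ex a(2,3) ..
      qed (simp add: hdens_weight_def hdens_def)
    qed
    finally show ?thesis .
  qed
  have "(LINT \<omega>|M. bm_weight \<omega> * indicator (\<Phi> -` T) (X \<omega>)) = (LINT p|lborel2. hdens_weight p * indicator (\<Phi> -` T) (X' p))"
    by (rule signed_moments_unique[OF bm_weight_integrable Xm boxX hdens_weight_integrable X'm boxX' mom S])
  moreover have "indicator (\<Phi> -` T) (X \<omega>) = (indicator T (Z \<omega>) :: real)" for \<omega>
    by (simp add: X_def \<Phi>_def indicator_def)
  moreover have "hdens_weight p * indicator (\<Phi> -` T) (X' p) = hdens_weight p * indicator T p" for p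
  proof (cases "fst p > 0")
    case True
    then have "\<Phi> (X' p) = p" by (cases p) (simp add: X'_def \<Phi>_def)
    then show ?thesis by (simp add: indicator_def)
  qed (simp add: hdens_weight_def hdens_def)
  ultimately show ?thesis by simp
qed

text \<open>Test \<open>joint_law\<close> on the set where \<open>Theta\<close> is negative: one
  side is nonnegative, the other nonpositive, so the set is null. Continuity then removes the
  exceptional points.\<close>

lemma Theta_nonneg:
  assumes q: "q > 0" shows "Theta t q \<ge> 0"
proof -
  define T where "T = {p :: real \<times> real. fst p > 0 \<and> Theta t (fst p) < 0}"
  have Tm: "T \<in> sets borel"
  proof -
    have "{p \<in> space (borel \<Otimes>\<^sub>M borel). fst p > 0 \<and> Theta t (fst p) < 0} \<in> sets ((borel :: real measure) \<Otimes>\<^sub>M (borel :: real measure))"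
      by measurable
    then show ?thesis unfolding borel_prod by (simp add: T_def)
  qed
  have i: "integrable lborel2 (\<lambda>p. hdens_weight p * indicator T p)"
  proof -
    have "T \<in> sets lborel2"
      unfolding lborel_prod using Tm by simp
    then have "integrable lborel2 (\<lambda>p. indicator T p *\<^sub>R hdens_weight p)"
      using hdens_weight_integrable by (rule integrable_mult_indicator)
    then show ?thesis by (simp add: mult.commute)
  qed
  have neg: "hdens_weight p * indicator T p \<le> 0" for p
  proof (cases "p \<in> T")
    case True
    then have "hdens t (fst p) (snd p) \<le> 0"
      using t by (auto simp: T_def hdens_def divide_le_0_iff mult_le_0_iff)
    then show ?thesis using True by (simp add: hdens_weight_def mult_le_0_iff)
  qed simp
  have "0 \<le> (LINT \<omega>|M. bm_weight \<omega> * indicator T (Z \<omega>))"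
    by (rule integral_nonneg_AE) (simp add: bm_weight_def)
  then have "0 \<le> (LINT p|lborel2. hdens_weight p * indicator T p)" by (simp add: joint_law[OF Tm])
  then have "(LINT p|lborel2. - (hdens_weight p * indicator T p)) = 0"
    using integral_nonneg_AE[of "\<lambda>p. - (hdens_weight p * indicator T p)" "lborel2"] neg by simp
  then have "AE p in lborel2. - (hdens_weight p * indicator T p) = 0"
    using integral_nonneg_eq_0_iff_AE[of "lborel2" "\<lambda>p. - (hdens_weight p * indicator T p)"] i neg by simp
  \<comment> \<open>Phrased as an equation between two continuous functions of \<open>q\<close>, the
    form that \<open>continuous_AE_eq\<close> takes.\<close>
  then have "AE p in lborel2. fst p > 0 \<longrightarrow> \<bar>Theta t (fst p)\<bar> = Theta t (fst p)"
  proof eventually_elim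
    fix p :: "real \<times> real" assume p: "- (hdens_weight p * indicator T p) = 0"
    show "fst p > 0 \<longrightarrow> \<bar>Theta t (fst p)\<bar> = Theta t (fst p)"
    proof (intro impI, rule ccontr)
      assume "fst p > 0" "\<bar>Theta t (fst p)\<bar> \<noteq> Theta t (fst p)"
      then have "p \<in> T" "hdens t (fst p) (snd p) \<noteq> 0" using t by (auto simp: T_def hdens_def)
      then show False using p by (simp add: hdens_weight_def)
    qed
  qed
  then have "AE q in lborel. AE y in lborel. fst (q, y :: real) > 0 \<longrightarrow> \<bar>Theta t (fst (q, y))\<bar> = Theta t (fst (q, y))"
    by (rule lborel_pair.AE_pair)
  then have "AE q in lborel. q > 0 \<longrightarrow> \<bar>Theta t q\<bar> = Theta t q"
  proof eventually_elim
    fix q assume ae: "AE y in lborel. fst (q, y :: real) > 0 \<longrightarrow> \<bar>Theta t (fst (q, y))\<bar> = Theta t (fst (q, y))"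
    show "q > 0 \<longrightarrow> \<bar>Theta t q\<bar> = Theta t q"
    proof (rule ccontr)
      assume "\<not> (q > 0 \<longrightarrow> \<bar>Theta t q\<bar> = Theta t q)"
      \<comment> \<open>The condition does not involve \<open>y\<close>, so its failure at
        \<open>q\<close> would make the whole line null.\<close>
      then have "AE y in lborel. (y :: real) \<notin> UNIV" using ae by simp
      then have "(UNIV :: real set) \<in> null_sets lborel" by (subst (asm) AE_iff_null_sets[symmetric]) auto
      then show False by (auto simp: null_sets_def)
    qed
  qed
  then have "\<bar>Theta t q\<bar> = Theta t q"
    by (intro continuous_AE_eq[of "\<lambda>q. \<bar>Theta t q\<bar>" "Theta t"] continuous_intros
          continuous_on_subset[OF Theta_continuous[OF t]] q) auto
  then show ?thesis by linarith
qed

lemma hdens_nonneg: "hdens t q y \<ge> 0"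
  using Theta_nonneg[of q] t by (auto simp: hdens_def indicator_def)

end

section \<open>The law of \<open>ln A\<close> under the original measure\<close>

context bm_time
begin

lemma hdens_weight_nonneg: "hdens_weight p \<ge> 0" by (simp add: hdens_weight_def hdens_nonneg)
lemma bm_weight_nonneg: "bm_weight \<omega> \<ge> 0" by (simp add: bm_weight_def)

text \<open>Equality on sets is equality of two measures, hence of all nonnegative integrals. This
  admits unbounded \<open>G\<close>, such as the one that undoes the weights.\<close>

lemma nn_joint_law:
  assumes G: "G \<in> borel_measurable (borel :: (real \<times> real) measure)"
  shows "(\<integral>\<^sup>+\<omega>. ennreal (bm_weight \<omega>) * G (Z \<omega>) \<partial>M) = (\<integral>\<^sup>+p. ennreal (hdens_weight p) * G p \<partial>lborel2)"
proof -
  note [measurable] = borel_measurable_integrable[OF bm_weight_integrable] borel_measurable_integrable[OF hdens_weight_integrable]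
  have S2: "sets lborel2 = sets borel"
    unfolding lborel_prod by simp
  have Xm[measurable]: "Z \<in> borel_measurable M"
    unfolding borel_prod[symmetric] by measurable
  define N1 where "N1 = distr (density M (\<lambda>\<omega>. ennreal (bm_weight \<omega>))) borel Z"
  define N2 where "N2 = density lborel2 (\<lambda>p. ennreal (hdens_weight p))"
  have "N1 = N2"
  proof (rule measure_eqI)
    show "sets N1 = sets N2" unfolding N1_def N2_def sets_distr sets_density S2 ..
    fix T assume "T \<in> sets N1"
    then have T[measurable]: "T \<in> sets borel" by (simp add: N1_def)
    have T2[measurable]: "T \<in> sets lborel2" unfolding S2 by (rule T)
    have i1: "integrable M (\<lambda>\<omega>. bm_weight \<omega> * indicator T (Z \<omega>))"
    proof (rule Bochner_Integration.integrable_bound[OF bm_weight_integrable])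
      show "(\<lambda>\<omega>. bm_weight \<omega> * indicator T (Z \<omega>)) \<in> borel_measurable M" by measurable
    qed (auto simp: indicator_def)
    have i2: "integrable lborel2 (\<lambda>p. hdens_weight p * indicator T p)"
    proof (rule Bochner_Integration.integrable_bound[OF hdens_weight_integrable])
      show "(\<lambda>p. hdens_weight p * indicator T p) \<in> borel_measurable lborel2" by measurable
    qed (auto simp: indicator_def)
    have "emeasure N1 T = (\<integral>\<^sup>+\<omega>. indicator T (Z \<omega>) \<partial>density M (\<lambda>\<omega>. ennreal (bm_weight \<omega>)))"
    proof -
      have "emeasure N1 T = (\<integral>\<^sup>+p. indicator T p \<partial>N1)" by (simp add: N1_def)
      also have "\<dots> = (\<integral>\<^sup>+\<omega>. indicator T (Z \<omega>) \<partial>density M (\<lambda>\<omega>. ennreal (bm_weight \<omega>)))"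
        unfolding N1_def by (rule nn_integral_distr) simp_all
      finally show ?thesis .
    qed
    also have "\<dots> = (\<integral>\<^sup>+\<omega>. ennreal (bm_weight \<omega>) * indicator T (Z \<omega>) \<partial>M)"
      by (rule nn_integral_density) measurable
    also have "\<dots> = (\<integral>\<^sup>+\<omega>. ennreal (bm_weight \<omega> * indicator T (Z \<omega>)) \<partial>M)"
      by (intro nn_integral_cong) (simp add: indicator_def)
    also have "\<dots> = ennreal (LINT \<omega>|M. bm_weight \<omega> * indicator T (Z \<omega>))"
      by (rule nn_integral_eq_integral[OF i1]) (simp add: bm_weight_nonneg)
    also have "\<dots> = ennreal (LINT p|lborel2. hdens_weight p * indicator T p)" by (simp add: joint_law[OF T])
    also have "\<dots> = (\<integral>\<^sup>+p. ennreal (hdens_weight p * indicator T p) \<partial>lborel2)"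
      by (rule nn_integral_eq_integral[OF i2, symmetric]) (simp add: hdens_weight_nonneg)
    also have "\<dots> = (\<integral>\<^sup>+p. ennreal (hdens_weight p) * indicator T p \<partial>lborel2)"
      by (intro nn_integral_cong) (simp add: indicator_def)
    also have "\<dots> = emeasure N2 T" unfolding N2_def by (rule emeasure_density[symmetric]) measurable
    finally show "emeasure N1 T = emeasure N2 T" .
  qed
  have G2[measurable]: "G \<in> borel_measurable lborel2"
    using G by (simp add: measurable_cong_sets[OF S2 refl])
  have GX[measurable]: "(\<lambda>\<omega>. G (Z \<omega>)) \<in> borel_measurable M"
    by (rule measurable_compose[OF Xm G])
  have "(\<integral>\<^sup>+\<omega>. ennreal (bm_weight \<omega>) * G (Z \<omega>) \<partial>M) = (\<integral>\<^sup>+\<omega>. G (Z \<omega>) \<partial>density M (\<lambda>\<omega>. ennreal (bm_weight \<omega>)))"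
    by (rule nn_integral_density[symmetric]) measurable
  also have "\<dots> = integral\<^sup>N N1 G"
    unfolding N1_def by (rule nn_integral_distr[symmetric]) (use G in simp_all)
  also have "\<dots> = (\<integral>\<^sup>+p. ennreal (hdens_weight p) * G p \<partial>lborel2)"
    unfolding \<open>N1 = N2\<close> N2_def by (rule nn_integral_density) measurable
  finally show ?thesis .
qed

text \<open>Up to scaling this is the outer integrand: \<open>c\<close> plays the role of a value of
  \<open>A\<close>, and \<open>q\<close> that of a value of \<open>\<rho> / A\<close>.\<close>

definition "theta_power c q = indicator {0<..} q * (q powr \<nu> * exp (- (q\<^sup>2 * c / 2)) * Theta t q)"
definition "lnA_pre y = exp (- (exp (- y) / 2)) * exp (\<nu> * y - \<nu>\<^sup>2 * t / 2) / sqrt (2 * pi * t)"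

lemma theta_power_nonneg: "theta_power c q \<ge> 0" using Theta_nonneg[of q] by (auto simp: theta_power_def indicator_def)
lemma lnA_pre_pos: "lnA_pre y > 0" using t by (simp add: lnA_pre_def)
lemma theta_power_measurable[measurable]: "theta_power c \<in> borel_measurable borel" unfolding theta_power_def[abs_def] by measurable
lemma lnA_pre_measurable[measurable]: "lnA_pre \<in> borel_measurable borel" unfolding lnA_pre_def[abs_def] by measurable

text \<open>\<open>g\<close> is the reciprocal of \<open>bm_weight\<close>: since
  \<open>1 / D\<close> equals \<open>\<rho> powr \<nu> * exp (- (\<nu>\<^sup>2 * t / 2))\<close>,
  undoing the change of measure creates the power \<open>q powr \<nu>\<close>. The inner integral is
  not yet known to be finite, hence \<open>ennreal\<close>.\<close>

lemma law_ln_A_nn: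
  assumes S[measurable]: "S \<in> sets borel"
  shows "(\<integral>\<^sup>+\<omega>. indicator S (ln (A \<omega>)) \<partial>M) = (\<integral>\<^sup>+y. ennreal (lnA_pre y) * (\<integral>\<^sup>+q. ennreal (theta_power (exp y) q) \<partial>lborel) * indicator S y \<partial>lborel)"
proof -
  define g where "g p = (exp (2 * (fst p * exp (snd p)) + exp (snd p)) * (fst p * exp (snd p)) powr \<nu> * exp (- (\<nu>\<^sup>2 * t / 2)))" for p :: "real \<times> real"
  define G where "G p = ennreal (g p) * indicator S (snd p)" for p
  have Gm: "G \<in> borel_measurable borel" unfolding G_def[abs_def] g_def borel_prod[symmetric] by measurable
  have "(\<integral>\<^sup>+\<omega>. indicator S (ln (A \<omega>)) \<partial>M) = (\<integral>\<^sup>+\<omega>. ennreal (bm_weight \<omega>) * G (Z \<omega>) \<partial>M)"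
  proof (rule nn_integral_cong)
    fix \<omega> assume "\<omega> \<in> space M"
    then have A: "A \<omega> > 0" by (rule A_pos)
    have "g (Z \<omega>) = exp (2 * \<rho> \<omega> + A \<omega>) * \<rho> \<omega> powr \<nu> * exp (- (\<nu>\<^sup>2 * t / 2))"
      using A by (simp add: g_def)
    also have "\<rho> \<omega> powr \<nu> = exp (\<nu> * (\<nu> * t + B t \<omega>))" by (simp add: \<rho>_def powr_def)
    finally have "bm_weight \<omega> * g (Z \<omega>) = 1"
      by (simp add: bm_weight_def exp_add[symmetric] algebra_simps power2_eq_square)
    then have "ennreal (bm_weight \<omega>) * ennreal (g (Z \<omega>)) = 1"
      by (simp add: ennreal_mult[symmetric] bm_weight_nonneg g_def)
    then show "indicator S (ln (A \<omega>)) = ennreal (bm_weight \<omega>) * G (Z \<omega>)"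
      by (simp add: G_def mult.assoc[symmetric])
  qed
  also have "\<dots> = (\<integral>\<^sup>+p. ennreal (hdens_weight p) * G p \<partial>lborel2)" by (rule nn_joint_law[OF Gm])
  also have "\<dots> = (\<integral>\<^sup>+p. ennreal (lnA_pre (snd p)) * ennreal (theta_power (exp (snd p)) (fst p)) * indicator S (snd p) \<partial>lborel2)"
  proof (rule nn_integral_cong)
    fix p :: "real \<times> real"
    have "hdens_weight p * g p = lnA_pre (snd p) * theta_power (exp (snd p)) (fst p)"
    proof (cases "fst p > 0")
      case True
      obtain q y where p: "p = (q, y)" by fastforce
      have q: "q > 0" using True p by simp
      have pw: "(q * exp y) powr \<nu> = q powr \<nu> * exp (\<nu> * y)" using q by (simp add: powr_mult powr_def exp_add[symmetric] ln_mult distrib_left)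
      have "hdens_weight p * g p = Theta t q / sqrt (2 * pi * t) * q powr \<nu> * (exp (- (exp (- y) / 2) - q\<^sup>2 * exp y / 2) * exp (- (2 * (q * exp y)) - exp y)
          * exp (2 * (q * exp y) + exp y) * exp (\<nu> * y) * exp (- (\<nu>\<^sup>2 * t / 2)))"
        using q unfolding hdens_weight_def g_def p fst_conv snd_conv pw hdens_def by simp
      also have "\<dots> = Theta t q / sqrt (2 * pi * t) * q powr \<nu> * (exp (- (exp (- y) / 2)) * exp (\<nu> * y - \<nu>\<^sup>2 * t / 2) * exp (- (q\<^sup>2 * exp y / 2)))"
        unfolding exp_add[symmetric] by simp
      also have "\<dots> = lnA_pre (snd p) * theta_power (exp (snd p)) (fst p)"
        using q unfolding p lnA_pre_def theta_power_def by simp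
      finally show ?thesis .
    qed (simp add: hdens_weight_def hdens_def theta_power_def)
    then have "ennreal (hdens_weight p) * ennreal (g p) = ennreal (lnA_pre (snd p)) * ennreal (theta_power (exp (snd p)) (fst p))"
      using lnA_pre_pos[of "snd p"] by (simp add: ennreal_mult[symmetric] hdens_weight_nonneg theta_power_nonneg g_def less_imp_le)
    then show "ennreal (hdens_weight p) * G p = ennreal (lnA_pre (snd p)) * ennreal (theta_power (exp (snd p)) (fst p)) * indicator S (snd p)"
      by (simp add: G_def mult.assoc[symmetric])
  qed
  also have "\<dots> = (\<integral>\<^sup>+y. \<integral>\<^sup>+q. ennreal (lnA_pre y) * ennreal (theta_power (exp y) q) * indicator S y \<partial>lborel \<partial>lborel)"
  proof -
    have "(\<lambda>p. ennreal (lnA_pre (snd p)) * ennreal (theta_power (exp (snd p)) (fst p)) * indicator S (snd p)) \<in> borel_measurable lborel2"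
      unfolding theta_power_def by measurable
    from lborel_pair.nn_integral_snd[OF this] show ?thesis by simp
  qed
  also have "\<dots> = (\<integral>\<^sup>+y. ennreal (lnA_pre y) * (\<integral>\<^sup>+q. ennreal (theta_power (exp y) q) \<partial>lborel) * indicator S y \<partial>lborel)"
    by (intro nn_integral_cong) (simp add: nn_integral_cmult nn_integral_multc)
  finally show ?thesis .
qed

text \<open>The law of \<open>ln A\<close> has mass 1, so the integral is finite for almost every
  \<open>y\<close>, in particular for some \<open>y < ln c\<close>, and the integrand decreases in
  \<open>c\<close>. This covers \<nu> \<le> -1, where \<open>q powr \<nu>\<close> alone is not
  integrable at 0.\<close>

lemma theta_power_integrable:
  assumes c: "c > 0" shows "integrable lborel (theta_power c)"
proof -
  define J where "J y = (\<integral>\<^sup>+q. ennreal (theta_power (exp y) q) \<partial>lborel)" for y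
  have "(\<integral>\<^sup>+y. ennreal (lnA_pre y) * J y \<partial>lborel) = (\<integral>\<^sup>+\<omega>. indicator UNIV (ln (A \<omega>)) \<partial>M)"
    using law_ln_A_nn[of UNIV] by (simp add: J_def)
  also have "\<dots> = 1" by (simp add: emeasure_space_1)
  finally have fin: "(\<integral>\<^sup>+y. ennreal (lnA_pre y) * J y \<partial>lborel) \<noteq> \<infinity>" by simp
  have Jm: "J \<in> borel_measurable borel"
    unfolding J_def[abs_def] theta_power_def by measurable
  have "AE y in lborel. ennreal (lnA_pre y) * J y \<noteq> \<infinity>"
    by (rule nn_integral_noteq_infinite[OF _ fin]) (use Jm in measurable)
  then have ae: "AE y in lborel. J y \<noteq> \<infinity>"
  proof eventually_elim
    fix y assume "ennreal (lnA_pre y) * J y \<noteq> \<infinity>"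
    then show "J y \<noteq> \<infinity>" using lnA_pre_pos[of y] by (auto simp: ennreal_mult_eq_top_iff)
  qed
  have "\<exists>y<ln c. J y \<noteq> \<infinity>"
  proof (rule ccontr)
    assume "\<not> (\<exists>y<ln c. J y \<noteq> \<infinity>)"
    then have "AE y in lborel. y \<notin> {..<ln c}" using ae by (auto elim: eventually_mono)
    then have "{..<ln c} \<in> null_sets lborel" by (simp add: AE_iff_null_sets)
    then have "negligible {..<ln c}" by (simp add: negligible_iff_null_sets null_sets_completionI)
    then show False using open_not_negligible[of "{..<ln c}"] by auto
  qed
  then obtain y where y: "y < ln c" "J y \<noteq> \<infinity>" by blast
  have yc: "exp y \<le> c" using y(1) c by (metis exp_less_mono exp_ln less_imp_le)
  have "integrable lborel (theta_power (exp y))"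
    by (rule integrableI_nonneg) (use y(2) theta_power_nonneg in \<open>auto simp: J_def top.not_eq_extremum\<close>)
  then show ?thesis
  proof (rule Bochner_Integration.integrable_bound)
    have "exp (- (q\<^sup>2 * c / 2)) \<le> exp (- (q\<^sup>2 * exp y / 2))" for q using yc by (simp add: mult_left_mono)
    then have "theta_power c q \<le> theta_power (exp y) q" for q
      unfolding theta_power_def using Theta_nonneg[of q] by (auto simp: indicator_def intro!: mult_right_mono mult_left_mono)
    then show "AE q in lborel. norm (theta_power c q) \<le> norm (theta_power (exp y) q)" by (simp add: theta_power_nonneg)
  qed measurable
qed

definition "theta_moment c = (LBINT q. theta_power c q)"

text \<open>On \<open>{e<..}\<close> the integrand is dominated by \<open>theta_power e\<close>, and
  these sets exhaust the half-line.\<close>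

lemma theta_moment_continuous: "continuous_on {0<..} theta_moment"
proof -
  have "continuous_on {e<..} theta_moment" if e: "e > 0" for e
    unfolding continuous_on_sequentially
  proof (intro ballI allI impI, elim conjE)
    fix c x assume c: "c \<in> {e<..}" and x: "\<forall>n. (x n :: real) \<in> {e<..}" "x \<longlonglongrightarrow> c"
    show "(theta_moment \<circ> x) \<longlonglongrightarrow> theta_moment c"
      unfolding o_def theta_moment_def
    proof (rule integral_dominated_convergence[where w = "theta_power e"])
      show "integrable lborel (theta_power e)" by (rule theta_power_integrable[OF e])
      show "AE q in lborel. (\<lambda>i. theta_power (x i) q) \<longlonglongrightarrow> theta_power c q"
        unfolding theta_power_def by (intro AE_I2 tendsto_intros x) simp
      fix i
      have xe: "e \<le> x i" using x(1) by (simp add: less_imp_le)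
      have "exp (- (q\<^sup>2 * x i / 2)) \<le> exp (- (q\<^sup>2 * e / 2))" for q using xe by (simp add: mult_left_mono)
      then have "theta_power (x i) q \<le> theta_power e q" for q
        unfolding theta_power_def using Theta_nonneg[of q] by (auto simp: indicator_def intro!: mult_right_mono mult_left_mono)
      then show "AE q in lborel. norm (theta_power (x i) q) \<le> theta_power e q" by (simp add: theta_power_nonneg)
    qed measurable
  qed
  then have "continuous_on (\<Union>e\<in>{0<..}. {e<..}) theta_moment"
    by (intro continuous_on_open_UN) auto
  moreover have "(\<Union>e\<in>{0<..}. {e<..}) = ({0<..} :: real set)"
  proof -
    have "x \<in> (\<Union>e\<in>{0<..}. {e<..})" if "x > 0" for x :: real
      using that by (intro UN_I[of "x / 2"]) auto
    then show ?thesis by auto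
  qed
  ultimately show ?thesis by simp
qed

definition "lnA_density y = lnA_pre y * theta_moment (exp y)"

lemma lnA_density_continuous: "continuous_on UNIV lnA_density"
  unfolding lnA_density_def[abs_def] lnA_pre_def
  by (intro continuous_intros continuous_on_compose2[OF theta_moment_continuous]) (use t in auto)

lemma lnA_density_nonneg: "lnA_density y \<ge> 0"
  using lnA_pre_pos[of y] by (simp add: lnA_density_def theta_moment_def theta_power_nonneg less_imp_le)

lemma law_ln_A:
  assumes S[measurable]: "S \<in> sets borel"
  shows "(\<integral>\<^sup>+\<omega>. indicator S (ln (A \<omega>)) \<partial>M) = (\<integral>\<^sup>+y. ennreal (lnA_density y) * indicator S y \<partial>lborel)"
  unfolding law_ln_A_nn[OF S]
proof (rule nn_integral_cong)
  fix y :: real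
  have "(\<integral>\<^sup>+q. ennreal (theta_power (exp y) q) \<partial>lborel) = ennreal (theta_moment (exp y))"
    unfolding theta_moment_def by (rule nn_integral_eq_integral) (auto intro!: theta_power_integrable simp: theta_power_nonneg)
  then show "ennreal (lnA_pre y) * (\<integral>\<^sup>+q. ennreal (theta_power (exp y) q) \<partial>lborel) * indicator S y = ennreal (lnA_density y) * indicator S y"
    using lnA_pre_pos[of y] by (simp add: lnA_density_def ennreal_mult' less_imp_le)
qed

end

section \<open>Change of variables by the exponential function\<close>

lemma nn_integral_exp_substitution_indicator:
  assumes S[measurable]: "S \<in> sets borel"
  shows "(\<integral>\<^sup>+u. indicator S u * indicator {0<..} u \<partial>lborel) = (\<integral>\<^sup>+x. indicator S (exp x) * ennreal (exp x) \<partial>(lborel :: real measure))"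
proof -
  \<comment> \<open>The substitution rule is applied on the compact intervals
    \<open>{- real n..real n}\<close>, which exhaust the line.\<close>
  define f where "f n u = ennreal (indicator S u * indicator {exp (- real n)..exp (real n)} u)" for n u
  define g where "g n x = ennreal (indicator S (exp x) * exp x * indicator {- real n..real n} x)" for n x
  have eq: "integral\<^sup>N lborel (f n) = integral\<^sup>N lborel (g n)" for n
    unfolding f_def g_def
  proof (rule nn_integral_substitution)
    show "set_borel_measurable borel {exp (- real n)..exp (real n)} (indicator S :: real \<Rightarrow> real)"
      unfolding set_borel_measurable_def by measurable
    show "(exp has_real_derivative exp x) (at x)" for x :: real by (rule DERIV_exp)
  qed (auto intro!: continuous_intros)
  have "(\<lambda>n. integral\<^sup>N lborel (f n)) \<longlonglongrightarrow> (\<integral>\<^sup>+u. indicator S u * indicator {0<..} u \<partial>lborel)"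
  proof (rule nn_integral_LIMSEQ)
    show "incseq f"
    proof (intro incseq_SucI le_funI)
      fix n u
      have "exp (- real (Suc n)) \<le> u" if "exp (- real n) \<le> u" by (rule order_trans[OF _ that]) simp
      moreover have "u \<le> exp (real (Suc n))" if "u \<le> exp (real n)" by (rule order_trans[OF that]) simp
      ultimately show "f n u \<le> f (Suc n) u" unfolding f_def indicator_def by auto
    qed
    show "f n \<in> borel_measurable lborel" for n unfolding f_def by measurable
    fix u
    show "(\<lambda>n. f n u) \<longlonglongrightarrow> indicator S u * indicator {0<..} u"
    proof (cases "u > 0")
      case True
      obtain N where N: "\<bar>ln u\<bar> \<le> real N" using real_arch_simple by blast
      have "f n u = indicator S u * indicator {0<..} u" if "n \<ge> N" for n
      proof -
        have "- real n \<le> ln u" "ln u \<le> real n" using N that by linarith+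
        then have "exp (- real n) \<le> u" "u \<le> exp (real n)"
          using True by (metis exp_le_cancel_iff exp_ln)+
        then show ?thesis using True by (simp add: f_def indicator_def)
      qed
      then show ?thesis by (intro tendsto_eventually) (auto simp: eventually_sequentially)
    next
      case False
      then have "f n u = 0" for n unfolding f_def indicator_def using less_le_trans[OF exp_gt_zero, of "- real n" u] by auto
      then show ?thesis using False by simp
    qed
  qed
  moreover have "(\<lambda>n. integral\<^sup>N lborel (g n)) \<longlonglongrightarrow> (\<integral>\<^sup>+x. indicator S (exp x) * ennreal (exp x) \<partial>lborel)"
  proof (rule nn_integral_LIMSEQ)
    show "incseq g" by (intro incseq_SucI le_funI) (auto simp: g_def indicator_def)
    show "g n \<in> borel_measurable lborel" for n unfolding g_def by measurable
    fix x :: real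
    obtain N where N: "\<bar>x\<bar> \<le> real N" using real_arch_simple by blast
    have "g n x = indicator S (exp x) * ennreal (exp x)" if "n \<ge> N" for n
    proof -
      have "- real n \<le> x" "x \<le> real n" using N that by linarith+
      then show ?thesis by (simp add: g_def indicator_def)
    qed
    then show "(\<lambda>n. g n x) \<longlonglongrightarrow> indicator S (exp x) * ennreal (exp x)"
      by (intro tendsto_eventually) (auto simp: eventually_sequentially)
  qed
  ultimately show ?thesis unfolding eq by (rule LIMSEQ_unique)
qed

lemma nn_integral_exp_substitution:
  fixes f :: "real \<Rightarrow> ennreal"
  assumes f[measurable]: "f \<in> borel_measurable borel"
  shows "(\<integral>\<^sup>+u. f u * indicator {0<..} u \<partial>lborel) = (\<integral>\<^sup>+x. f (exp x) * ennreal (exp x) \<partial>lborel)"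
proof -
  define N where "N = distr (density lborel (\<lambda>x. ennreal (exp x))) borel (exp :: real \<Rightarrow> real)"
  have "N = density lborel (indicator {0<..})"
  proof (rule measure_eqI)
    fix S assume "S \<in> sets N"
    then have S[measurable]: "S \<in> sets borel" by (simp add: N_def)
    have "emeasure N S = (\<integral>\<^sup>+u. indicator S u \<partial>N)" using S by (simp add: N_def)
    also have "\<dots> = (\<integral>\<^sup>+x. indicator S (exp x) \<partial>density lborel (\<lambda>x. ennreal (exp x)))"
      unfolding N_def by (rule nn_integral_distr) simp_all
    also have "\<dots> = (\<integral>\<^sup>+x. ennreal (exp x) * indicator S (exp x) \<partial>lborel)"
      by (rule nn_integral_density) measurable
    also have "\<dots> = (\<integral>\<^sup>+u. indicator {0<..} u * indicator S u \<partial>lborel)"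
      using nn_integral_exp_substitution_indicator[OF S] by (simp add: mult.commute)
    also have "\<dots> = emeasure (density lborel (indicator {0<..})) S"
      by (rule emeasure_density[symmetric]) measurable
    finally show "emeasure N S = emeasure (density lborel (indicator {0<..})) S" .
  qed (simp add: N_def)
  moreover have "integral\<^sup>N N f = (\<integral>\<^sup>+x. ennreal (exp x) * f (exp x) \<partial>lborel)"
    unfolding N_def by (simp add: nn_integral_distr nn_integral_density)
  moreover have "integral\<^sup>N (density lborel (indicator {0<..})) f = (\<integral>\<^sup>+u. indicator {0<..} u * f u \<partial>lborel)"
    by (rule nn_integral_density) measurable
  ultimately show ?thesis by (simp add: mult.commute)
qed

section \<open>The density of the powers and its explicit form\<close>

context bm_time
begin

abbreviation "A_powr \<epsilon> \<omega> \<equiv> exp_functional \<nu> B t \<omega> powr \<epsilon>"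

definition "power_density \<epsilon> w = lnA_density (ln w / \<epsilon>) / (\<bar>\<epsilon>\<bar> * w)"

lemma power_density_continuous: "\<epsilon> \<noteq> 0 \<Longrightarrow> continuous_on {0<..} (power_density \<epsilon>)"
  unfolding power_density_def[abs_def]
  by (intro continuous_intros continuous_on_compose2[OF lnA_density_continuous]) auto

lemma power_density_nonneg: "w > 0 \<Longrightarrow> power_density \<epsilon> w \<ge> 0"
  by (simp add: power_density_def lnA_density_nonneg)

lemma continuous_density_power:
  assumes e: "\<epsilon> \<noteq> 0"
  shows "continuous_density_pos M (A_powr \<epsilon>) (power_density \<epsilon>)"
proof -
  have [measurable]: "lnA_density \<in> borel_measurable borel"
    by (rule borel_measurable_continuous_onI[OF lnA_density_continuous])
  have dm[measurable]: "(\<lambda>w. ennreal (indicator {0<..} w * power_density \<epsilon> w)) \<in> borel_measurable borel"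
    unfolding power_density_def by measurable
  have Xm[measurable]: "(A_powr \<epsilon>) \<in> borel_measurable M"
    using A_meas unfolding A_def by measurable
  have "distr M lborel (A_powr \<epsilon>) = density lborel (\<lambda>w. ennreal (indicator {0<..} w * power_density \<epsilon> w))"
  proof (rule measure_eqI)
    fix S assume "S \<in> sets (distr M lborel (A_powr \<epsilon>))"
    then have S[measurable]: "S \<in> sets borel" by simp
    have S'm: "{y. exp (\<epsilon> * y) \<in> S} \<in> sets borel"
    proof -
      have "(\<lambda>y. exp (\<epsilon> * y)) \<in> borel_measurable borel" by measurable
      from measurable_sets[OF this S] show ?thesis by (simp add: vimage_def)
    qed
    define f where "f w = ennreal (lnA_density (ln w / \<epsilon>) / w) * indicator S w" for w
    have fm[measurable]: "f \<in> borel_measurable borel" unfolding f_def by measurable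
    have "emeasure (distr M lborel (A_powr \<epsilon>)) S
        = (\<integral>\<^sup>+x. indicator S x \<partial>distr M lborel (A_powr \<epsilon>))" by simp
    also have "\<dots> = (\<integral>\<^sup>+\<omega>. indicator S (A_powr \<epsilon> \<omega>) \<partial>M)"
      by (rule nn_integral_distr) simp_all
    also have "\<dots> = (\<integral>\<^sup>+\<omega>. indicator {y. exp (\<epsilon> * y) \<in> S} (ln (A \<omega>)) \<partial>M)"
    proof (rule nn_integral_cong)
      fix \<omega> assume "\<omega> \<in> space M"
      then have "exp_functional \<nu> B t \<omega> > 0" using A_pos by (simp add: A_def)
      then show "indicator S (A_powr \<epsilon> \<omega>) = (indicator {y. exp (\<epsilon> * y) \<in> S} (ln (A \<omega>)) :: ennreal)"
        by (simp add: A_def powr_def indicator_def)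
    qed
    also have "\<dots> = (\<integral>\<^sup>+y. ennreal (lnA_density y) * indicator {y. exp (\<epsilon> * y) \<in> S} y \<partial>lborel)"
      by (rule law_ln_A[OF S'm])
    also have "\<dots> = (\<integral>\<^sup>+y. ennreal (lnA_density y) * indicator S (exp (\<epsilon> * y)) \<partial>lborel)"
      by (intro nn_integral_cong) (simp add: indicator_def)
    \<comment> \<open>The affine change \<open>y = z / \<epsilon>\<close> treats both signs of
      \<epsilon> at once; its Jacobian is the factor \<open>\<bar>\<epsilon>\<bar>\<close> in
      \<open>power_density\<close>.\<close>
    also have "\<dots> = ennreal \<bar>1 / \<epsilon>\<bar> * (\<integral>\<^sup>+z. ennreal (lnA_density (0 + 1 / \<epsilon> * z)) * indicator S (exp (\<epsilon> * (0 + 1 / \<epsilon> * z))) \<partial>lborel)"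
      by (rule nn_integral_real_affine) (use e in simp_all)
    also have "(\<integral>\<^sup>+z. ennreal (lnA_density (0 + 1 / \<epsilon> * z)) * indicator S (exp (\<epsilon> * (0 + 1 / \<epsilon> * z))) \<partial>lborel)
        = (\<integral>\<^sup>+z. f (exp z) * ennreal (exp z) \<partial>lborel)"
    proof (rule nn_integral_cong)
      fix z :: real
      have "ennreal (lnA_density (z / \<epsilon>) / exp z) * ennreal (exp z) = ennreal (lnA_density (z / \<epsilon>))"
        by (simp add: ennreal_mult[symmetric] lnA_density_nonneg)
      then show "ennreal (lnA_density (0 + 1 / \<epsilon> * z)) * indicator S (exp (\<epsilon> * (0 + 1 / \<epsilon> * z))) = f (exp z) * ennreal (exp z)"
        using e by (simp add: f_def mult.assoc mult.commute[of "indicator S _"]) (simp add: mult.assoc[symmetric])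
    qed
    also have "\<dots> = (\<integral>\<^sup>+w. f w * indicator {0<..} w \<partial>lborel)"
      by (rule nn_integral_exp_substitution[OF fm, symmetric])
    also have "ennreal \<bar>1 / \<epsilon>\<bar> * \<dots> = (\<integral>\<^sup>+w. ennreal \<bar>1 / \<epsilon>\<bar> * (f w * indicator {0<..} w) \<partial>lborel)"
      by (rule nn_integral_cmult[symmetric]) measurable
    also have "\<dots> = (\<integral>\<^sup>+w. ennreal (indicator {0<..} w * power_density \<epsilon> w) * indicator S w \<partial>lborel)"
    proof (rule nn_integral_cong)
      fix w :: real
      have "ennreal \<bar>1 / \<epsilon>\<bar> * ennreal (lnA_density (ln w / \<epsilon>) / w) = ennreal (power_density \<epsilon> w)" if "w > 0"
        using that lnA_density_nonneg[of "ln w / \<epsilon>"] by (simp add: ennreal_mult[symmetric] power_density_def)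
      then show "ennreal \<bar>1 / \<epsilon>\<bar> * (f w * indicator {0<..} w) = ennreal (indicator {0<..} w * power_density \<epsilon> w) * indicator S w"
        by (cases "w > 0") (simp_all add: f_def mult.assoc[symmetric])
    qed
    also have "\<dots> = emeasure (density lborel (\<lambda>w. ennreal (indicator {0<..} w * power_density \<epsilon> w))) S"
      by (rule emeasure_density[symmetric]) simp_all
    finally show "emeasure (distr M lborel (A_powr \<epsilon>)) S
      = emeasure (density lborel (\<lambda>w. ennreal (indicator {0<..} w * power_density \<epsilon> w))) S" .
  qed simp
  then show ?thesis
    by (simp add: continuous_density_pos_def distributed_def power_density_continuous[OF e] power_density_nonneg)
qed

lemma continuous_density_unique:
  assumes e: "\<epsilon> \<noteq> 0" and \<alpha>: "continuous_density_pos M (A_powr \<epsilon>) \<alpha>" and w: "w > 0"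
  shows "\<alpha> w = power_density \<epsilon> w"
proof (rule continuous_AE_eq[of \<alpha> "power_density \<epsilon>"])
  have "AE w in lborel. ennreal (indicator {0<..} w * \<alpha> w) = ennreal (indicator {0<..} w * power_density \<epsilon> w)"
  proof (rule distributed_unique)
    show "distributed M lborel (A_powr \<epsilon>) (\<lambda>w. ennreal (indicator {0<..} w * \<alpha> w))"
      using \<alpha> unfolding continuous_density_pos_def by (elim conjE)
    show "distributed M lborel (A_powr \<epsilon>) (\<lambda>w. ennreal (indicator {0<..} w * power_density \<epsilon> w))"
      using continuous_density_power[OF e] unfolding continuous_density_pos_def by (elim conjE)
  qed
  then show "AE w in lborel. w > 0 \<longrightarrow> \<alpha> w = power_density \<epsilon> w"
  proof eventually_elim
    fix w :: real
    assume *: "ennreal (indicator {0<..} w * \<alpha> w) = ennreal (indicator {0<..} w * power_density \<epsilon> w)"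
    show "w > 0 \<longrightarrow> \<alpha> w = power_density \<epsilon> w"
    proof
      assume w: "w > 0"
      \<comment> \<open>\<open>ennreal\<close> is injective only on nonnegative reals, so here the
        sign condition of \<open>continuous_density_pos\<close> is used.\<close>
      have "\<alpha> w \<ge> 0" using \<alpha> w by (simp add: continuous_density_pos_def)
      then show "\<alpha> w = power_density \<epsilon> w" using * w power_density_nonneg[OF w, of \<epsilon>] by simp
    qed
  qed
qed (use \<alpha> w e power_density_continuous in \<open>auto simp: continuous_density_pos_def\<close>)

text \<open>Everything is an exponential in \<open>L = ln w / \<epsilon>\<close>. As
  \<open>k = sqrt (2 / u)\<close>, the factor \<open>k powr (- \<nu>) / k\<close> raises the power
  of \<open>u\<close> from \<open>(\<nu> - 1) / 2\<close> to \<open>\<nu>\<close> and lowers that of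
  2 from \<open>\<nu> / 2\<close> to \<open>- 1 / 2\<close>, which turns
  \<open>sqrt (pi * t)\<close> into \<open>sqrt (2 * pi * t)\<close>.\<close>

lemma prefactor_identity:
  assumes e: "\<epsilon> \<noteq> 0" and w: "w > 0"
  defines "u \<equiv> w powr (1 / \<epsilon>)"
  defines "k \<equiv> 2 / sqrt (2 * u)"
  shows "prefactor \<nu> \<epsilon> t w * (k powr (- \<nu>) / k) * theta_moment u = power_density \<epsilon> w"
proof -
  have u: "u > 0" using w by (simp add: u_def)
  define L where "L = ln w / \<epsilon>"
  have uL: "u = exp L" using w by (simp add: u_def powr_def L_def)
  have wL: "ln w = \<epsilon> * L" using e by (simp add: L_def)
  have w1: "w powr (- 1 / \<epsilon>) = exp (- L)" using w e by (simp add: powr_def wL)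
  have w2: "w powr (1 / (2 * \<epsilon>) * (\<nu> - 1) - 1) = exp (L * (\<nu> - 1) / 2) / w"
  proof -
    have "w powr (1 / (2 * \<epsilon>) * (\<nu> - 1) - 1) = w powr (1 / (2 * \<epsilon>) * (\<nu> - 1)) / w"
      using w by (simp add: powr_diff)
    also have "w powr (1 / (2 * \<epsilon>) * (\<nu> - 1)) = exp (L * (\<nu> - 1) / 2)"
      using w e by (simp add: powr_def wL field_simps)
    finally show ?thesis .
  qed
  have k: "k > 0" using u by (simp add: k_def)
  have lk: "ln k = (ln 2 - L) / 2"
  proof -
    have "ln k = ln 2 - ln (2 * u) / 2" using u by (simp add: k_def ln_div ln_sqrt)
    also have "ln (2 * u) = ln 2 + L" using u by (simp add: ln_mult uL)
    finally show ?thesis by (simp add: field_simps)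
  qed
  have k1: "k powr (- \<nu>) / k = exp (- (\<nu> + 1) * ((ln 2 - L) / 2))"
  proof -
    have "k powr (- \<nu>) / k = k powr (- \<nu> - 1)" using k by (simp add: powr_diff)
    also have "\<dots> = exp (- (\<nu> + 1) * ((ln 2 - L) / 2))" using k unfolding powr_def lk by (simp add: algebra_simps)
    finally show ?thesis .
  qed
  have s2: "sqrt (2 * pi * t) = exp (ln 2 / 2) * sqrt (pi * t)"
  proof -
    have "exp (ln 2 / 2) = sqrt 2"
      using exp_ln[of "sqrt 2"] by (simp add: ln_sqrt)
    then show ?thesis by (simp add: real_sqrt_mult)
  qed
  have "prefactor \<nu> \<epsilon> t w * (k powr (- \<nu>) / k)
      = 1 / (\<bar>\<epsilon>\<bar> * w * sqrt (pi * t)) * (exp (\<nu> / 2 * ln 2) * exp (- (1 / 2) * (\<nu>\<^sup>2 * t + exp (- L))) * exp (L * (\<nu> - 1) / 2) * exp (- (\<nu> + 1) * ((ln 2 - L) / 2)))"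
    unfolding prefactor_def w1 w2 k1 by (simp add: powr_def)
  also have "exp (\<nu> / 2 * ln 2) * exp (- (1 / 2) * (\<nu>\<^sup>2 * t + exp (- L))) * exp (L * (\<nu> - 1) / 2) * exp (- (\<nu> + 1) * ((ln 2 - L) / 2))
     = exp (- (exp (- L) / 2) + (\<nu> * L - \<nu>\<^sup>2 * t / 2) - ln 2 / 2)"
    unfolding exp_add[symmetric] by (simp add: algebra_simps diff_divide_distrib add_divide_distrib)
  also have "\<dots> = exp (- (exp (- L) / 2)) * exp (\<nu> * L - \<nu>\<^sup>2 * t / 2) / exp (ln 2 / 2)"
    unfolding exp_diff exp_add ..
  also have "1 / (\<bar>\<epsilon>\<bar> * w * sqrt (pi * t)) * \<dots> = lnA_pre L / (\<bar>\<epsilon>\<bar> * w)"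
    unfolding lnA_pre_def s2 by simp
  finally show ?thesis
    by (simp add: power_density_def lnA_density_def L_def[symmetric] uL)
qed

text \<open>Substitute \<open>q = k * x\<close>: as \<open>k\<^sup>2 * u = 2\<close>, the Gaussian
  \<open>exp (- (q\<^sup>2 * u / 2))\<close> becomes \<open>exp (- x\<^sup>2)\<close>. The factors
  \<open>k powr (- \<nu>)\<close> and \<open>1 / k\<close> come from the power and from the
  Jacobian.\<close>

lemma scaled_Theta_integral:
  assumes u: "u > 0"
  defines "k \<equiv> 2 / sqrt (2 * u)"
  defines "F \<equiv> \<lambda>x. indicator {0<..} x * (x powr \<nu> * exp (- x\<^sup>2) * Theta t (2 * x / sqrt (2 * u)))"
  shows "integrable lborel F" "integral\<^sup>L lborel F = k powr (- \<nu>) / k * theta_moment u"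
proof -
  have k: "k > 0" using u by (simp add: k_def)
  have k2: "k\<^sup>2 * u = 2" using u by (simp add: k_def power_divide)
  have F: "F x = k powr (- \<nu>) * theta_power u (0 + k * x)" for x
  proof (cases "x > 0")
    case True
    have "(k * x) powr \<nu> = k powr \<nu> * x powr \<nu>" using k True by (simp add: powr_mult)
    then have "x powr \<nu> = k powr (- \<nu>) * (k * x) powr \<nu>" using k by (simp add: powr_minus field_simps)
    moreover have "(k * x)\<^sup>2 * u / 2 = x\<^sup>2"
    proof -
      have "(k * x)\<^sup>2 * u / 2 = (k\<^sup>2 * u) * x\<^sup>2 / 2" by (simp add: power_mult_distrib)
      then show ?thesis by (simp add: k2)
    qed
    moreover have "2 * x / sqrt (2 * u) = k * x" by (simp add: k_def)
    ultimately show ?thesis using True k by (simp add: F_def theta_power_def)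
  next
    case False
    then have "\<not> k * x > 0" using k by (simp add: zero_less_mult_iff)
    then show ?thesis using False by (simp add: F_def theta_power_def)
  qed
  show "integrable lborel F"
    unfolding F[abs_def] by (intro integrable_mult_right lborel_integrable_real_affine theta_power_integrable u) (use k in simp)
  have "theta_moment u = k * (LBINT x. theta_power u (0 + k * x))"
    unfolding theta_moment_def using lborel_integral_real_affine[of k "theta_power u" 0] k by simp
  then have "(LBINT x. theta_power u (0 + k * x)) = theta_moment u / k" using k by simp
  then show "integral\<^sup>L lborel F = k powr (- \<nu>) / k * theta_moment u"
    unfolding F[abs_def] by simp
qed

end

theorem mainTheorem1:
  fixes M :: "'a measure" and B :: "real \<Rightarrow> 'a \<Rightarrow> real" and \<nu> \<epsilon> t :: real
  assumes "standard_brownian_motion M B"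
    and "\<epsilon> \<noteq> 0" and "t > 0"
  shows "(\<exists>\<alpha>. continuous_density_pos M (\<lambda>\<omega>. exp_functional \<nu> B t \<omega> powr \<epsilon>) \<alpha>) \<and>
    (\<forall>\<alpha>. continuous_density_pos M (\<lambda>\<omega>. exp_functional \<nu> B t \<omega> powr \<epsilon>) \<alpha> \<longrightarrow>
      (\<forall>w>0. \<forall>\<theta>\<in>{pi / 2..pi}. \<forall>R\<ge>1.
        (\<forall>x>0. log_hankel_integrable \<theta> R (inner_integrand \<epsilon> t w x)) \<and>
        set_integrable lborel {0<..} (outer_integrand \<nu> \<epsilon> t w \<theta> R) \<and>
        complex_of_real (\<alpha> w) =
          of_real (prefactor \<nu> \<epsilon> t w) * (LBINT x:{0<..}. outer_integrand \<nu> \<epsilon> t w \<theta> R x)))"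
proof -
  interpret bm_time M B \<nu> t using assms by unfold_locales
  show ?thesis
  proof (intro conjI allI impI ballI exI)
    show "continuous_density_pos M (\<lambda>\<omega>. exp_functional \<nu> B t \<omega> powr \<epsilon>) (power_density \<epsilon>)"
      by (rule continuous_density_power[OF assms(2)])
  next
    fix \<alpha> w \<theta> R x :: real
    assume "\<theta> \<in> {pi / 2..pi}" "x > 0" "w > 0"
    then show "log_hankel_integrable \<theta> R (inner_integrand \<epsilon> t w x)"
      unfolding inner_integrand_eq_hankel_fun by (intro log_hankel_Theta t) auto
  next
    fix \<alpha> and w \<theta> R :: real
    assume \<alpha>: "continuous_density_pos M (\<lambda>\<omega>. exp_functional \<nu> B t \<omega> powr \<epsilon>) \<alpha>"
      and w: "w > 0" and \<theta>: "\<theta> \<in> {pi / 2..pi}"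
    define u where "u = w powr (1 / \<epsilon>)"
    have u: "u > 0" using w by (simp add: u_def)
    define F where "F x = indicator {0<..} x * (x powr \<nu> * exp (- x\<^sup>2) * Theta t (2 * x / sqrt (2 * u)))" for x
    \<comment> \<open>\<open>log_hankel_Theta\<close> cancels the factor
      \<open>1 / (2 * pi * \<i>)\<close>, so the outer integrand is real and independent of \<theta>
      and \<open>R\<close>.\<close>
    have outer: "indicator {0<..} x *\<^sub>R outer_integrand \<nu> \<epsilon> t w \<theta> R x = complex_of_real (F x)" for x
    proof (cases "x > 0")
      case True
      then have "log_hankel_integral \<theta> R (inner_integrand \<epsilon> t w x) = 2 * of_real pi * \<i> * of_real (Theta t (2 * x / sqrt (2 * u)))"
        unfolding inner_integrand_eq_hankel_fun u_def[symmetric] using u by (intro log_hankel_Theta t \<theta>) simp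
      then show ?thesis using True by (simp add: outer_integrand_def F_def)
    qed (simp add: F_def)
    note S = scaled_Theta_integral[OF u, folded F_def]
    show "set_integrable lborel {0<..} (outer_integrand \<nu> \<epsilon> t w \<theta> R)"
      unfolding set_integrable_def outer by (intro integrable_of_real) (use S(1) in simp)
    have "(LBINT x:{0<..}. outer_integrand \<nu> \<epsilon> t w \<theta> R x) = of_real (LBINT x. F x)"
      unfolding set_lebesgue_integral_def outer by (rule integral_complex_of_real)
    moreover have "prefactor \<nu> \<epsilon> t w * (LBINT x. F x) = \<alpha> w"
      unfolding S(2) continuous_density_unique[OF assms(2) \<alpha> w]
      using prefactor_identity[OF assms(2) w, folded u_def] by (simp only: mult.assoc)
    ultimately show "complex_of_real (\<alpha> w) = of_real (prefactor \<nu> \<epsilon> t w) * (LBINT x:{0<..}. outer_integrand \<nu> \<epsilon> t w \<theta> R x)"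
      by (simp flip: of_real_mult)
  qed
qed

end
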